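(* Let $d\ge1$, let $\alpha\in\mathbb{T}^d$ be rationally independent, $\omega\in\mathbb{T}$ and $\lambda\in\mathbb{C}$. Let $V\in C^\omega(\mathbb{T}^d,\mathbb{R})$ be real analytic, real-valued and non-constant. Then the family of operators $H^V_\alpha(\lambda,\omega)$ is $\mathscr{P}\mathscr{T}$ symmetric and displays $\mathscr{P}\mathscr{T}$ symmetric breaking. In particular, denoting $$\lambda_0(V)=e^{\min_{z\in R(V)}G_d(z)},\qquad \lambda_1(V)=e^{\max_{z\in R(V)}G_d(z)},$$ one has: (1) If $|\lambda|\le\lambda_0(V)$, then $\sigma(H^V_\alpha(\lambda,\omega))=[\min_{\theta\in\mathbb{T}^d}V(\theta),\max_{\theta\in\mathbb{T}^d}V(\theta)]\subset\mathbb{R}$. (2) If $\lambda_0(V)<|\lambda|\le\lambda_1(V)$, then $\sigma(H^V_\alpha(\lambda,\omega))$ has both complex spectrum and real spectrum, i.e. it meets both $\mathbb{C}\setminus\mathbb{R}$ and $\mathbb{R}$. (3) If $|\lambda|>\lambda_1(V)$, then $\sigma(H^V_\alpha(\lambda,\omega))$ is a real analytic curve in $\mathbb{R}^2\cong\mathbb{C}$.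
   Context: $\mathbb{T}=\mathbb{R}/\mathbb{Z}$. A vector $\alpha\in\mathbb{T}^d$ is rationally independent if $(1,\alpha_1,\dots,\alpha_d)$ is linearly independent over $\mathbb{Q}$. Write $V(\theta)=\sum_{k\in\mathbb{Z}^d}v_k e^{2\pi i\langle k,\theta\rangle}$ and let $R(V)$ be the range of $V$. The operator $H^V_\alpha(\lambda,\omega)$ acts on $\ell^2(\mathbb{Z}^d)$ by $$(H^V_\alpha(\lambda,\omega)u)(n)=\sum_{k\in\mathbb{Z}^d}v_k u(n-k)+\lambda e^{2\pi i(\omega+\langle n,\alpha\rangle)}u(n),\quad n\in\mathbb{Z}^d.$$ $G_d(z)=\int_{\mathbb{T}^d}\log|z-V(\theta)|\,d\theta$ (a continuous function of $z$ for such $V$). $H^V_\alpha(\lambda,\omega)$ is $\mathscr{P}\mathscr{T}$ symmetric if and only if $\lambda\in\mathbb{R}$, $\omega=0$ and $v_k=\overline{v_{-k}}$ for all $k$; the family $H^V_\alpha(\lambda,\omega)$ is said to have $\mathscr{P}\mathscr{T}$ symmetry if $H^V_\alpha(|\lambda|,0)$ is $\mathscr{P}\mathscr{T}$ symmetric. $\mathscr{P}\mathscr{T}$ symmetric breaking means that a $\mathscr{P}\mathscr{T}$ symmetric operator has non-real spectrum (here: this occurs for some values of $\lambda$). A real analytic curve in $\mathbb{R}^2$ is a one-dimensional real analytic submanifold of $\mathbb{R}^2$. *)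

theory Defs
  imports "HOL-Analysis.Analysis"
begin

text \<open>Functions on the torus \<open>\<real>\<^sup>d / \<int>\<^sup>d\<close> are \<open>\<int>\<^sup>d\<close>-periodic functions on \<open>real ^ 'd\<close>, and points
  of the torus are represented by arbitrary lifts; integration over the torus is integration over
  the unit cube \<open>cbox 0 1\<close>. The lattice \<open>\<int>\<^sup>d\<close> is \<open>int ^ 'd\<close>, where \<open>d = CARD('d)\<close>.\<close>

definition real_vec :: "int ^ 'd \<Rightarrow> real ^ 'd" where
  "real_vec k = (\<chi> i. real_of_int (k $ i))"

definition torus_periodic :: "(real ^ 'd \<Rightarrow> 'b) \<Rightarrow> bool" where
  "torus_periodic f \<longleftrightarrow> (\<forall>\<theta> k. f (\<theta> + real_vec k) = f \<theta>)"

definition rationally_independent :: "real ^ 'd \<Rightarrow> bool" where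
  "rationally_independent \<alpha> \<longleftrightarrow>
     (\<forall>(q0 :: rat) (q :: rat ^ 'd).
        of_rat q0 * 1 + (\<Sum>i\<in>UNIV. of_rat (q $ i) * \<alpha> $ i) = 0 \<longrightarrow> q0 = 0 \<and> (\<forall>i. q $ i = 0))"

text \<open>Local expansion into a power series in several variables: the index set
  \<open>Basis \<rightarrow>\<^sub>E UNIV\<close> is the set of multi-indices, one exponent per coordinate.\<close>

definition real_analytic_on ::
    "('a::euclidean_space \<Rightarrow> 'b::real_normed_vector) \<Rightarrow> 'a set \<Rightarrow> bool" where
  "real_analytic_on f S \<longleftrightarrow>
     (\<forall>x\<in>S. \<exists>c. \<exists>r>0. \<forall>y\<in>ball x r.
        ((\<lambda>m :: 'a \<Rightarrow> nat. (\<Prod>b\<in>Basis. ((y - x) \<bullet> b) ^ m b) *\<^sub>R c m) has_sum f y) (Basis \<rightarrow>\<^sub>E UNIV))"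

text \<open>A one-dimensional (embedded, nonempty) real analytic submanifold of the plane
  \<open>\<real>\<^sup>2 = \<complex>\<close>: around each of its points a real analytic diffeomorphism \<open>\<phi>\<close> between open sets, with
  inverse \<open>\<psi>\<close>, straightens it to the real axis.\<close>

definition real_analytic_curve :: "complex set \<Rightarrow> bool" where
  "real_analytic_curve S \<longleftrightarrow> S \<noteq> {} \<and>
     (\<forall>p\<in>S. \<exists>U W (\<phi> :: complex \<Rightarrow> complex) \<psi>. open U \<and> open W \<and> p \<in> U \<and> homeomorphism U W \<phi> \<psi> \<and>
        real_analytic_on \<phi> U \<and> real_analytic_on \<psi> W \<and> \<phi> ` (S \<inter> U) = W \<inter> \<real>)"

definition ell2 :: "('i \<Rightarrow> complex) set" where
  "ell2 = {u. (\<lambda>n. (cmod (u n))\<^sup>2) summable_on UNIV}"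

definition ell2_norm :: "('i \<Rightarrow> complex) \<Rightarrow> real" where
  "ell2_norm u = sqrt (\<Sum>\<^sub>\<infinity>n. (cmod (u n))\<^sup>2)"

text \<open>A point \<open>z\<close> is in the resolvent set iff \<open>z - A\<close> is a bijection of \<open>ell2\<close> with bounded inverse.\<close>

definition ell2_resolvent_set :: "(('i \<Rightarrow> complex) \<Rightarrow> 'i \<Rightarrow> complex) \<Rightarrow> complex set" where
  "ell2_resolvent_set A =
     {z. bij_betw (\<lambda>u n. z * u n - A u n) ell2 ell2 \<and>
         (\<exists>C. \<forall>u\<in>ell2. ell2_norm u \<le> C * ell2_norm (\<lambda>n. z * u n - A u n))}"

definition ell2_spectrum :: "(('i \<Rightarrow> complex) \<Rightarrow> 'i \<Rightarrow> complex) \<Rightarrow> complex set" where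
  "ell2_spectrum A = - ell2_resolvent_set A"

definition fourier_coeff :: "(real ^ 'd \<Rightarrow> complex) \<Rightarrow> int ^ 'd \<Rightarrow> complex" where
  "fourier_coeff V k = (LINT \<theta>:cbox 0 1|lborel. V \<theta> * cis (- 2 * pi * (real_vec k \<bullet> \<theta>)))"

definition H_op ::
    "(real ^ 'd \<Rightarrow> complex) \<Rightarrow> real ^ 'd \<Rightarrow> complex \<Rightarrow> real \<Rightarrow>
     (int ^ 'd \<Rightarrow> complex) \<Rightarrow> int ^ 'd \<Rightarrow> complex" where
  "H_op V \<alpha> lam \<omega> u n =
     (\<Sum>\<^sub>\<infinity>k. fourier_coeff V k * u (n - k)) +
     lam * cis (2 * pi * (\<omega> + real_vec n \<bullet> \<alpha>)) * u n"

definition G_fun :: "(real ^ 'd \<Rightarrow> complex) \<Rightarrow> complex \<Rightarrow> real" where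
  "G_fun V z = (LINT \<theta>:cbox 0 1|lborel. ln (cmod (z - V \<theta>)))"

text \<open>\<open>INF\<close> and \<open>SUP\<close> stand for the minimum and the maximum over the range of \<open>V\<close>: for real analytic
  nonconstant \<open>V\<close> the function \<open>G_fun V\<close> is continuous and the range is compact. (In \<open>G_fun\<close>, the
  convention \<open>ln 0 = 0\<close> only concerns a null set of \<open>\<theta>\<close>.)\<close>

definition lambda_0 :: "(real ^ 'd \<Rightarrow> complex) \<Rightarrow> real" where
  "lambda_0 V = exp (INF z\<in>range V. G_fun V z)"

definition lambda_1 :: "(real ^ 'd \<Rightarrow> complex) \<Rightarrow> real" where
  "lambda_1 V = exp (SUP z\<in>range V. G_fun V z)"

text \<open>\<open>\<omega> \<in> \<int>\<close> says that \<open>\<omega>\<close> is zero in \<open>\<real> / \<int>\<close>.\<close>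

definition pt_symmetric :: "(real ^ 'd \<Rightarrow> complex) \<Rightarrow> complex \<Rightarrow> real \<Rightarrow> bool" where
  "pt_symmetric V lam \<omega> \<longleftrightarrow>
     lam \<in> \<real> \<and> \<omega> \<in> \<int> \<and> (\<forall>k. fourier_coeff V k = cnj (fourier_coeff V (- k)))"

definition pt_symmetric_family :: "(real ^ 'd \<Rightarrow> complex) \<Rightarrow> bool" where
  "pt_symmetric_family V \<longleftrightarrow> (\<forall>lam::complex. pt_symmetric V (complex_of_real (cmod lam)) 0)"

definition pt_symmetric_breaking :: "(real ^ 'd \<Rightarrow> complex) \<Rightarrow> real ^ 'd \<Rightarrow> bool" where
  "pt_symmetric_breaking V \<alpha> \<longleftrightarrow>
     (\<exists>lam::complex. pt_symmetric V (complex_of_real (cmod lam)) 0 \<and>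
        \<not> ell2_spectrum (H_op V \<alpha> (complex_of_real (cmod lam)) 0) \<subseteq> \<real>)"

text \<open>For real \<open>lam\<close> and \<open>\<omega> = 0\<close>, being PT symmetric amounts to commuting with the composition of
  the parity \<open>u n \<mapsto> u (- n)\<close> and the time reversal \<open>u n \<mapsto> cnj (u n)\<close>.\<close>

definition pt_op :: "(int ^ 'd \<Rightarrow> complex) \<Rightarrow> int ^ 'd \<Rightarrow> complex" where
  "pt_op u n = cnj (u (- n))"

lemma pt_symmetric_iff_commutes:
  fixes V :: "real ^ 'd \<Rightarrow> complex" and \<alpha> :: "real ^ 'd"
  assumes "lam \<in> \<real>"
  shows "pt_symmetric V lam 0 \<longleftrightarrow>
    (\<forall>u\<in>ell2. H_op V \<alpha> lam 0 (pt_op u) = pt_op (H_op V \<alpha> lam 0 u))"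
proof
  let ?v = "fourier_coeff V"
  have cnj_l: "cnj lam = lam"
    using assms by (rule Reals_cnj_iff[THEN iffD1])
  have rv: "real_vec (- n) = - real_vec n" for n :: "int ^ 'd"
    by (simp add: real_vec_def vec_eq_iff)
  show "\<forall>u\<in>ell2. H_op V \<alpha> lam 0 (pt_op u) = pt_op (H_op V \<alpha> lam 0 u)" if "pt_symmetric V lam 0"
  proof (intro ballI ext)
    fix u :: "int ^ 'd \<Rightarrow> complex" and n
    have v: "cnj (?v (- k)) = ?v k" for k
      using that by (metis pt_symmetric_def)
    have "cnj (\<Sum>\<^sub>\<infinity>k. ?v k * u (- n - k)) = (\<Sum>\<^sub>\<infinity>k. cnj (?v k) * cnj (u (- n - k)))"
      by (simp flip: infsum_cnj)
    also have "\<dots> = (\<Sum>\<^sub>\<infinity>k. cnj (?v (- k)) * cnj (u (- n - (- k))))"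
      by (rule infsum_reindex_bij_betw[OF bij_uminus, symmetric])
    also have "\<dots> = (\<Sum>\<^sub>\<infinity>k. ?v k * cnj (u (- (n - k))))"
      by (simp add: v)
    finally show "H_op V \<alpha> lam 0 (pt_op u) n = pt_op (H_op V \<alpha> lam 0 u) n"
      by (simp add: H_op_def pt_op_def cnj_l cis_cnj rv)
  qed
  show "pt_symmetric V lam 0" if comm: "\<forall>u\<in>ell2. H_op V \<alpha> lam 0 (pt_op u) = pt_op (H_op V \<alpha> lam 0 u)"
  proof -
    define e :: "int ^ 'd \<Rightarrow> complex" where "e n = (if n = 0 then 1 else 0)" for n
    have "e \<in> ell2"
      unfolding ell2_def mem_Collect_eq
      by (subst summable_on_cong_neutral[where T = "{0}" and g = "\<lambda>_. 1"]) (auto simp: e_def)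
    moreover have "pt_op e = e"
      by (auto simp: pt_op_def e_def)
    ultimately have eq: "H_op V \<alpha> lam 0 e n = cnj (H_op V \<alpha> lam 0 e (- n))" for n
      using comm by (metis pt_op_def)
    have "(\<Sum>\<^sub>\<infinity>k. ?v k * e (n - k)) = ?v n" for n
    proof -
      have "(\<Sum>\<^sub>\<infinity>k. ?v k * e (n - k)) = (\<Sum>\<^sub>\<infinity>k\<in>{n}. ?v k)"
        by (rule infsum_cong_neutral) (auto simp: e_def)
      then show ?thesis by simp
    qed
    then have He: "H_op V \<alpha> lam 0 e n = ?v n + (if n = 0 then lam else 0)" for n
      by (simp add: H_op_def e_def real_vec_def inner_vec_def)
    have "?v n = cnj (?v (- n))" for n
    proof -
      have "?v n + (if n = 0 then lam else 0) = cnj (?v (- n)) + (if n = 0 then lam else 0)"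
        using eq[of n] unfolding He by (simp only: complex_cnj_add if_distrib[of cnj] cnj_l
            complex_cnj_zero neg_equal_0_iff_equal)
      then show ?thesis
        by (rule add_right_imp_eq)
    qed
    then show ?thesis
      unfolding pt_symmetric_def using assms Ints_0 by blast
  qed
qed

end

theory Submission
  imports Defs "HOL-Complex_Analysis.Complex_Analysis"
begin

text \<open>Fourier series turn \<open>H\<close> into \<open>F \<mapsto> V F + \<mu> (F \<circ> T)\<close> on the torus, where \<open>T \<theta> = \<theta> + \<alpha>\<close> and
\<open>\<mu> = \<lambda> e\<^sup>2\<^sup>\<pi>\<^sup>i\<^sup>\<omega>\<close>. Thus \<open>z - H\<close> is the weighted translation \<open>F \<mapsto> a F - \<mu> (F \<circ> T)\<close> with \<open>a = z - V\<close>, and the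
whole statement follows from a description of the spectrum by the potential \<open>G\<close>
(\<open>mem_spectrum_iff\<close>): outside the range of \<open>V\<close>, the point \<open>z\<close> is in the spectrum iff
\<open>\<bar>\<lambda>\<bar> = exp (G z)\<close>; in the range, iff \<open>\<bar>\<lambda>\<bar> \<le> exp (G z)\<close>.

The translation by a rationally independent vector makes every continuous function cohomologous
to its mean, up to a small uniform error (\<open>approximate_coboundary\<close>): trigonometric polynomials
of mean zero are exact coboundaries \<open>w \<circ> T - w\<close>, and they are uniformly dense. Conjugation with the
multiplication by \<open>exp w\<close> replaces \<open>a\<close> by \<open>a exp (w - w \<circ> T)\<close>. Applied to \<open>log \<bar>a\<bar>\<close>, this makes
\<open>\<bar>a\<bar>\<close> nearly equal to the constant \<open>exp (G z)\<close>, and a Neumann series inverts \<open>a - \<mu> T\<close> as soon as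
\<open>\<bar>\<mu>\<bar> < exp (G z)\<close>. If \<open>\<bar>\<mu>\<bar> > exp (G z)\<close>, a continuous majorant of \<open>log \<bar>a\<bar>\<close> whose mean is close to \<open>G z\<close>
suffices, even if \<open>a\<close> has zeros.

Conversely, if \<open>a - \<mu> T\<close> is invertible then it is bounded below, and so are all the \<open>a - \<mu>' T\<close> with
\<open>\<bar>\<mu>'\<bar> = \<bar>\<mu>\<bar>\<close>, with the same constant: multiplication by a character rotates \<open>\<mu>\<close>, and these rotations are
dense. Outside the range of \<open>V\<close>, \<open>a\<close> has a continuous logarithm, and the coboundary approximation of it
gives approximate eigenfunctions when \<open>\<bar>\<mu>\<bar> = exp (G z)\<close>. For a real point \<open>x\<close> of the range,
a lower bound at \<open>x\<close> would persist at \<open>z = x + i y\<close>, where the inverse is given by the series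
\<open>\<Sum> (a\<^sup>-\<^sup>1 \<mu> T)\<^sup>n a\<^sup>-\<^sup>1\<close>; averaging over the phases of \<open>\<mu>\<close> isolates its first term \<open>a\<^sup>-\<^sup>1\<close>, which would have to be
bounded uniformly in \<open>y\<close>, although \<open>\<bar>a\<bar> = y\<close> where \<open>V = x\<close>.

The potential \<open>G\<close> is bounded below because \<open>log \<bar>x - V\<bar>\<close> is integrable, uniformly in \<open>x\<close>. Along each
orbit of the flow in direction \<open>\<alpha>\<close>, \<open>V\<close> is a nonconstant analytic function of one variable, so that
some derivative does not vanish; by compactness, the order of this derivative and a lower
bound for it can be chosen from finitely many. A sublevel set estimate
(\<open>emeasure_sublevel_le\<close>) then bounds the logarithmic integrals over short orbit segments, and
averaging over the torus bounds the mean (\<open>truncated_log_mean_bounded_below\<close>).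

The rest is geometry of \<open>G\<close>. Moving away from the range strictly increases \<open>G\<close>, so below
\<open>\<lambda>\<^sub>0\<close> only the range remains. If \<open>G x < log \<bar>\<lambda>\<bar>\<close> for some \<open>x\<close> in the range, the value
\<open>log \<bar>\<lambda>\<bar>\<close> is attained on the vertical line through \<open>x\<close>, at a nonreal point. Off the range \<open>G\<close> is locally
the real part of a holomorphic function whose derivative \<open>\<integral> 1 / (z - V)\<close> does not vanish, and
so its level sets are real analytic curves.\<close>

section \<open>Continuous functions and means on the torus\<close>

definition torus_cont :: "(real ^ 'd \<Rightarrow> 'b::topological_space) \<Rightarrow> bool" where
  "torus_cont f \<longleftrightarrow> continuous_on UNIV f \<and> torus_periodic f"

text \<open>The unit cube as a probability space: means over the torus are integrals with respect to this
measure, so that the integration theorems of measure spaces apply directly.\<close>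

definition cube :: "(real ^ 'd) measure" where
  "cube = restrict_space lborel (cbox 0 1)"

definition torus_mean :: "(real ^ 'd \<Rightarrow> 'b::{banach,second_countable_topology}) \<Rightarrow> 'b" where
  "torus_mean f = integral\<^sup>L cube f"

lemma torus_mean_eq: "torus_mean f = (LINT \<theta>:cbox 0 1|lborel. f \<theta>)"
  unfolding torus_mean_def cube_def set_lebesgue_integral_def
  by (subst integral_restrict_space) auto

lemma emeasure_cube: "emeasure cube (space (cube :: (real ^ 'd) measure)) = 1"
proof -
  have "emeasure lborel (cbox (0 :: real ^ 'd) 1) = 1"
    by (subst emeasure_lborel_cbox) (auto intro!: prod.neutral simp: inner_axis Basis_vec_def)
  then show ?thesis
    by (simp add: cube_def emeasure_restrict_space space_restrict_space)
qed

lemma prob_space_cube: "finite_measure cube" "measure cube (space cube) = 1"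
  by (auto intro!: finite_measureI simp: measure_def emeasure_cube)

lemma torus_cont_measurable: "torus_cont f \<Longrightarrow> f \<in> borel_measurable cube"
  unfolding torus_cont_def cube_def
  by (intro measurable_restrict_space1) (simp add: borel_measurable_continuous_onI)

lemma torus_cont_integrable:
  fixes f :: "real ^ 'd \<Rightarrow> 'b::{banach,second_countable_topology}"
  assumes "torus_cont f"
  shows "integrable cube f"
proof -
  have "integrable lborel (\<lambda>x. indicator (cbox 0 1) x *\<^sub>R f x)"
    using assms by (intro borel_integrable_compact compact_cbox)
      (auto simp: torus_cont_def intro: continuous_on_subset)
  then show ?thesis
    unfolding cube_def by (subst integrable_restrict_space) auto
qed

lemma torus_mean_const [simp]: "torus_mean (\<lambda>_::real ^ 'd. c) = (c::'b::{banach,second_countable_topology})"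
  unfolding torus_mean_def by (simp add: prob_space_cube)

lemma torus_mean_add:
  fixes f g :: "real ^ 'd \<Rightarrow> 'b::{banach,second_countable_topology}"
  assumes "torus_cont f" "torus_cont g"
  shows "torus_mean (\<lambda>\<theta>. f \<theta> + g \<theta>) = torus_mean f + torus_mean g"
  unfolding torus_mean_def using assms by (intro Bochner_Integration.integral_add torus_cont_integrable)

lemma torus_mean_diff:
  fixes f g :: "real ^ 'd \<Rightarrow> 'b::{banach,second_countable_topology}"
  assumes "torus_cont f" "torus_cont g"
  shows "torus_mean (\<lambda>\<theta>. f \<theta> - g \<theta>) = torus_mean f - torus_mean g"
  unfolding torus_mean_def using assms by (intro Bochner_Integration.integral_diff torus_cont_integrable)

lemma torus_mean_cmult:
  "torus_mean (\<lambda>\<theta>::real ^ 'd. c * f \<theta>) = c * torus_mean (f :: _ \<Rightarrow> 'b::{real_normed_field,banach,second_countable_topology})"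
  unfolding torus_mean_def by simp

lemma torus_mean_mono:
  fixes f g :: "real ^ 'd \<Rightarrow> real"
  assumes "torus_cont f" "torus_cont g" "\<And>\<theta>. f \<theta> \<le> g \<theta>"
  shows "torus_mean f \<le> torus_mean g"
  unfolding torus_mean_def using assms by (intro integral_mono torus_cont_integrable)

lemma torus_mean_norm_le:
  fixes f :: "real ^ 'd \<Rightarrow> 'b::{banach,second_countable_topology}"
  assumes "torus_cont f" "\<And>\<theta>. norm (f \<theta>) \<le> B"
  shows "norm (torus_mean f) \<le> B"
proof -
  have "norm (torus_mean f) \<le> torus_mean (\<lambda>\<theta>. norm (f \<theta>))"
    unfolding torus_mean_def by (rule integral_norm_bound)
  also have "\<dots> \<le> torus_mean (\<lambda>\<theta>::real ^ 'd. B)"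
    using assms by (intro torus_mean_mono) (auto simp: torus_cont_def torus_periodic_def intro!: continuous_intros)
  finally show ?thesis by simp
qed

lemma torus_mean_of_real:
  assumes "torus_cont f"
  shows "torus_mean (\<lambda>\<theta>. complex_of_real (f \<theta>)) = complex_of_real (torus_mean f)"
  unfolding torus_mean_def using torus_cont_integrable[OF assms] by (rule integral_of_real)

lemma torus_mean_Re:
  assumes "torus_cont f"
  shows "torus_mean (\<lambda>\<theta>. Re (f \<theta>)) = Re (torus_mean f)"
  unfolding torus_mean_def using torus_cont_integrable[OF assms] by (rule integral_Re)

lemma torus_cont_compose:
  "torus_cont f \<Longrightarrow> continuous_on (range f) g \<Longrightarrow> torus_cont (\<lambda>\<theta>. g (f \<theta>))"
  unfolding torus_cont_def torus_periodic_def by (auto intro: continuous_on_compose2)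

lemma torus_cont_const: "torus_cont (\<lambda>_. c)"
  by (auto simp: torus_cont_def torus_periodic_def intro!: continuous_intros)

lemma torus_cont_add: "torus_cont f \<Longrightarrow> torus_cont g \<Longrightarrow> torus_cont (\<lambda>\<theta>. f \<theta> + g \<theta> :: 'b::real_normed_vector)"
  by (auto simp: torus_cont_def torus_periodic_def intro!: continuous_intros)

lemma torus_cont_diff: "torus_cont f \<Longrightarrow> torus_cont g \<Longrightarrow> torus_cont (\<lambda>\<theta>. f \<theta> - g \<theta> :: 'b::real_normed_vector)"
  by (auto simp: torus_cont_def torus_periodic_def intro!: continuous_intros)

lemma torus_cont_mult: "torus_cont f \<Longrightarrow> torus_cont g \<Longrightarrow> torus_cont (\<lambda>\<theta>. f \<theta> * g \<theta> :: 'b::real_normed_algebra)"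
  by (auto simp: torus_cont_def torus_periodic_def intro!: continuous_intros)

lemma torus_cont_norm: "torus_cont f \<Longrightarrow> torus_cont (\<lambda>\<theta>. norm (f \<theta> :: 'b::real_normed_vector))"
  by (auto simp: torus_cont_def torus_periodic_def intro!: continuous_intros)

lemma torus_cont_cnj: "torus_cont f \<Longrightarrow> torus_cont (\<lambda>\<theta>. cnj (f \<theta>))"
  by (auto simp: torus_cont_def torus_periodic_def intro!: continuous_intros)

lemma torus_cont_of_real: "torus_cont f \<Longrightarrow> torus_cont (\<lambda>\<theta>. of_real (f \<theta>) :: complex)"
  by (auto simp: torus_cont_def torus_periodic_def intro!: continuous_intros)

lemma torus_cont_Re: "torus_cont f \<Longrightarrow> torus_cont (\<lambda>\<theta>. Re (f \<theta>))"
  by (auto simp: torus_cont_def torus_periodic_def intro!: continuous_intros)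

lemma torus_cont_Im: "torus_cont f \<Longrightarrow> torus_cont (\<lambda>\<theta>. Im (f \<theta>))"
  by (auto simp: torus_cont_def torus_periodic_def intro!: continuous_intros)

lemma torus_cont_power: "torus_cont f \<Longrightarrow> torus_cont (\<lambda>\<theta>. f \<theta> ^ n :: 'b::real_normed_algebra_1)"
  by (auto simp: torus_cont_def torus_periodic_def intro!: continuous_intros)

lemma torus_cont_exp: "torus_cont f \<Longrightarrow> torus_cont (\<lambda>\<theta>. exp (f \<theta> :: 'b::{real_normed_field,banach}))"
  by (auto simp: torus_cont_def torus_periodic_def intro!: continuous_intros)

lemma torus_cont_divide:
  "torus_cont f \<Longrightarrow> torus_cont g \<Longrightarrow> (\<And>\<theta>. g \<theta> \<noteq> 0) \<Longrightarrow> torus_cont (\<lambda>\<theta>. f \<theta> / g \<theta> :: 'b::real_normed_field)"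
  by (auto simp: torus_cont_def torus_periodic_def intro!: continuous_intros)

lemma torus_cont_ln: "torus_cont f \<Longrightarrow> (\<And>\<theta>. f \<theta> > (0::real)) \<Longrightarrow> torus_cont (\<lambda>\<theta>. ln (f \<theta>))"
  by (auto simp: torus_cont_def torus_periodic_def less_imp_neq[symmetric] intro!: continuous_intros)

lemma torus_cont_max: "torus_cont f \<Longrightarrow> torus_cont g \<Longrightarrow> torus_cont (\<lambda>\<theta>. max (f \<theta>) (g \<theta>) :: real)"
  by (auto simp: torus_cont_def torus_periodic_def intro!: continuous_intros)

lemma torus_cont_sum:
  "(\<And>i. i \<in> I \<Longrightarrow> torus_cont (f i)) \<Longrightarrow> torus_cont (\<lambda>\<theta>. \<Sum>i\<in>I. f i \<theta> :: 'b::real_normed_vector)"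
  by (auto simp: torus_cont_def torus_periodic_def intro!: continuous_intros)

lemma torus_cont_translate: "torus_cont f \<Longrightarrow> torus_cont (\<lambda>\<theta>. f (\<theta> + v))"
  unfolding torus_cont_def torus_periodic_def
  by (auto intro!: continuous_on_compose2[of UNIV f] continuous_intros)
     (metis add.assoc add.commute)

lemmas torus_cont_intros =
  torus_cont_const torus_cont_add torus_cont_diff torus_cont_mult torus_cont_norm torus_cont_cnj
  torus_cont_of_real torus_cont_Re torus_cont_Im torus_cont_power torus_cont_exp torus_cont_divide
  torus_cont_ln torus_cont_max torus_cont_sum

lemma torus_mean_sum:
  fixes f :: "'i \<Rightarrow> real ^ 'd \<Rightarrow> 'b::{banach,second_countable_topology}"
  assumes "\<And>i. i \<in> I \<Longrightarrow> torus_cont (f i)"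
  shows "torus_mean (\<lambda>\<theta>. \<Sum>i\<in>I. f i \<theta>) = (\<Sum>i\<in>I. torus_mean (f i))"
  unfolding torus_mean_def using assms by (intro Bochner_Integration.integral_sum torus_cont_integrable)

lemma exists_cube_representative: "\<exists>k :: int ^ 'd. \<theta> + real_vec k \<in> cbox 0 1"
proof (rule exI[of _ "\<chi> i. - \<lfloor>\<theta> $ i\<rfloor>"])
  have "0 \<le> \<theta> $ i - \<lfloor>\<theta> $ i\<rfloor> \<and> \<theta> $ i - \<lfloor>\<theta> $ i\<rfloor> \<le> 1" for i
    by linarith
  then show "\<theta> + real_vec (\<chi> i. - \<lfloor>\<theta> $ i\<rfloor>) \<in> cbox 0 1"
    by (simp add: mem_box_cart real_vec_def)
qed

lemma torus_periodic_image: "torus_periodic f \<Longrightarrow> f ` cbox 0 1 = range f"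
  unfolding torus_periodic_def by (metis (no_types, lifting) exists_cube_representative image_eqI image_iff subsetI subset_UNIV subset_antisym image_mono)

lemma torus_cont_compact_range: "torus_cont f \<Longrightarrow> compact (range f)"
  unfolding torus_cont_def
  by (metis compact_cbox compact_continuous_image continuous_on_subset subset_UNIV torus_periodic_image)

lemma torus_cont_bounded:
  assumes "torus_cont (f :: _ \<Rightarrow> 'b::real_normed_vector)"
  obtains B where "B > 0" "\<And>\<theta>. norm (f \<theta>) \<le> B"
  using compact_imp_bounded[OF torus_cont_compact_range[OF assms]]
  by (metis bounded_pos rangeI)

text \<open>The mean of a continuous nonnegative function controls its values: this turns statements about
\<open>L\<^sup>2\<close> norms and about averages along orbits into pointwise ones.\<close>

lemma torus_mean_eq_0_imp:
  fixes f :: "real ^ 'd \<Rightarrow> real"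
  assumes f: "torus_cont f" and nonneg: "\<And>\<theta>. 0 \<le> f \<theta>" and zero: "torus_mean f = 0"
  shows "f \<theta> = 0"
proof -
  have c: "continuous_on (cbox 0 1) f"
    using f by (auto simp: torus_cont_def intro: continuous_on_subset)
  have "set_integrable lborel (cbox 0 1) f"
    unfolding set_integrable_def using c by (intro borel_integrable_compact compact_cbox)
  then have "integral (cbox 0 1) f = 0"
    using zero by (simp add: torus_mean_eq set_borel_integral_eq_integral)
  moreover have "box (0 :: real ^ 'd) 1 \<noteq> {}"
    by (auto simp: box_ne_empty inner_axis Basis_vec_def)
  ultimately have "\<forall>x\<in>cbox 0 1. f x = 0"
    using integral_cbox_eq_0_iff[OF c] nonneg by blast
  then show ?thesis
    using exists_cube_representative[of \<theta>] f by (metis torus_cont_def torus_periodic_def)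
qed

section \<open>Characters and uniform approximation by trigonometric polynomials\<close>

definition character :: "int ^ 'd \<Rightarrow> real ^ 'd \<Rightarrow> complex" where
  "character k \<theta> = cis (2 * pi * (real_vec k \<bullet> \<theta>))"

lemma real_vec_simps [simp]:
  "real_vec 0 = 0" "real_vec (k + l) = real_vec k + real_vec l" "real_vec (- k) = - real_vec k"
  "real_vec (k - l) = real_vec k - real_vec l"
  by (simp_all add: real_vec_def vec_eq_iff)

lemma norm_character [simp]: "cmod (character k \<theta>) = 1"
  by (simp add: character_def)

lemma character_nonzero [simp]: "character k \<theta> \<noteq> 0"
  by (simp add: character_def)

lemma character_0 [simp]: "character 0 \<theta> = 1" "character k 0 = 1"
  by (simp_all add: character_def)

lemma character_add: "character (k + l) \<theta> = character k \<theta> * character l \<theta>"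
  by (simp add: character_def inner_add_left ring_distribs cis_mult)

lemma character_add_right: "character k (\<theta> + \<eta>) = character k \<theta> * character k \<eta>"
  by (simp add: character_def inner_add_right ring_distribs cis_mult)

lemma character_minus: "character (- k) \<theta> = cnj (character k \<theta>)"
  by (simp add: character_def cis_cnj)

lemma character_real_vec: "character k (real_vec l) = 1"
proof -
  have "real_vec k \<bullet> real_vec l = of_int (\<Sum>i\<in>UNIV. k $ i * l $ i)"
    by (simp add: inner_vec_def real_vec_def)
  then show ?thesis
    by (metis character_def cis_multiple_2pi Ints_of_int)
qed

lemma torus_cont_character [intro]: "torus_cont (character k)"
  unfolding torus_cont_def torus_periodic_def
  by (auto simp: character_add_right character_real_vec)
     (auto simp: character_def[abs_def] intro!: continuous_intros)

lemma character_prod: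
  "character k \<theta> = (\<Prod>b\<in>Basis. cis (2 * pi * (real_vec k \<bullet> b) * (\<theta> \<bullet> b)))"
proof -
  have "2 * pi * (real_vec k \<bullet> \<theta>) = (\<Sum>b\<in>Basis. 2 * pi * (real_vec k \<bullet> b) * (\<theta> \<bullet> b))"
    by (subst euclidean_inner) (simp add: sum_distrib_left mult_ac)
  moreover have "cis (\<Sum>b\<in>A. g b) = (\<Prod>b\<in>A. cis (g b))" for A and g :: "real^'a \<Rightarrow> real"
    by (induction A rule: infinite_finite_induct) (simp_all flip: cis_mult)
  ultimately show ?thesis by (simp add: character_def)
qed

lemma integral_cis_unit_interval:
  "integral\<^sup>L lborel (\<lambda>t. indicator {0..1} t *\<^sub>R cis (2 * pi * real_of_int m * t)) = (if m = 0 then 1 else 0)"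
proof (cases "m = 0")
  case False
  let ?c = "2 * pi * real_of_int m"
  have c: "?c \<noteq> 0" using False by simp
  have "integral\<^sup>L lborel (\<lambda>t. indicator {0..1} t *\<^sub>R cis (?c * t))
      = cis (?c * 1) / (\<i> * ?c) - cis (?c * 0) / (\<i> * ?c)"
  proof (rule integral_FTC_atLeastAtMost)
    fix x :: real
    have "((\<lambda>t. exp (\<i> * ?c * of_real t) / (\<i> * ?c)) has_vector_derivative exp (\<i> * ?c * of_real x)) (at x within {0..1})"
      using c by (auto intro!: derivative_eq_intros has_vector_derivative_real_field)
    then show "((\<lambda>t. cis (?c * t) / (\<i> * ?c)) has_vector_derivative cis (?c * x)) (at x within {0..1})"
      by (simp add: cis_conv_exp mult_ac)
  qed (auto intro!: continuous_intros)
  also have "\<dots> = 0"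
    using cis_multiple_2pi[of "of_int m"] by simp
  finally show ?thesis using False by simp
qed simp

text \<open>The integral over the cube factors into one-dimensional integrals of \<open>e\<^sup>2\<^sup>\<pi>\<^sup>i\<^sup>m\<^sup>t\<close> over the unit interval.\<close>

lemma torus_mean_character: "torus_mean (character k) = (if k = 0 then 1 else 0 :: complex)"
proof -
  let ?f = "\<lambda>b t. indicator {0..1::real} t *\<^sub>R cis (2 * pi * (real_vec k \<bullet> b) * t)"
  have ind: "indicator (cbox 0 1) \<theta> *\<^sub>R character k \<theta> = (\<Prod>b\<in>Basis. ?f b (\<theta> \<bullet> b))" for \<theta>
  proof -
    have "(indicator (cbox 0 1) \<theta> :: real) = (\<Prod>b\<in>Basis. indicator {0..1} (\<theta> \<bullet> b))"
    proof (cases "\<theta> \<in> cbox 0 1")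
      case True
      then have "\<theta> \<bullet> b \<in> {0..1}" if "b \<in> Basis" for b
        using that by (auto simp: mem_box Basis_vec_def inner_axis)
      then show ?thesis using True by simp
    next
      case False
      then obtain b where "b \<in> Basis" "\<theta> \<bullet> b \<notin> {0..1}"
        by (force simp: mem_box Basis_vec_def inner_axis)
      then have "(\<Prod>b\<in>Basis. indicator {0..1} (\<theta> \<bullet> b)) = (0::real)"
        by (intro prod_zero bexI[of _ b]) auto
      then show ?thesis using False by simp
    qed
    then show ?thesis
      by (simp add: character_prod scaleR_conv_of_real prod.distrib)
  qed
  interpret product_sigma_finite "\<lambda>_ :: real ^ 'a. interval_measure (\<lambda>x. x)"
    unfolding lborel_eq_real[symmetric] by standard
  have int: "integrable lborel (?f b)" for b
    by (intro borel_integrable_compact) (auto intro!: continuous_intros)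
  have meas: "(\<lambda>x. ?f b (x \<bullet> b)) \<in> borel_measurable borel" for b
    using measurable_compose[of "\<lambda>x. x \<bullet> b" borel borel "?f b" borel] borel_measurable_integrable[OF int[of b]]
    by simp
  have "torus_mean (character k) = integral\<^sup>L lborel (\<lambda>\<theta>. (\<Prod>b\<in>Basis. ?f b (\<theta> \<bullet> b)))"
    unfolding torus_mean_eq set_lebesgue_integral_def ind ..
  also have "\<dots> = (\<Prod>b\<in>Basis. integral\<^sup>L lborel (?f b))"
  proof -
    have "integral\<^sup>L lborel (\<lambda>\<theta>. (\<Prod>b\<in>Basis. ?f b (\<theta> \<bullet> b)))
        = integral\<^sup>L (\<Pi>\<^sub>M b\<in>(Basis::(real^'a) set). interval_measure (\<lambda>x. x))
            (\<lambda>g. \<Prod>b\<in>Basis. ?f b ((\<Sum>b\<in>Basis. g b *\<^sub>R b) \<bullet> b))"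
      unfolding lborel_def[where 'a="real^'a"]
      by (subst integral_distr) (auto intro!: borel_measurable_prod meas)
    also have "\<dots> = integral\<^sup>L (\<Pi>\<^sub>M b\<in>(Basis::(real^'a) set). interval_measure (\<lambda>x. x))
            (\<lambda>g. \<Prod>b\<in>Basis. ?f b (g b))"
      by simp
    also have "\<dots> = (\<Prod>b\<in>Basis. integral\<^sup>L (interval_measure (\<lambda>x. x)) (?f b))"
      using int by (intro product_integral_prod) (auto simp: lborel_eq_real)
    finally show ?thesis by (simp add: lborel_eq_real)
  qed
  also have "\<dots> = (\<Prod>i\<in>UNIV. integral\<^sup>L lborel (?f (axis i 1)))"
    by (subst prod.reindex_cong[of "\<lambda>i. axis i 1" UNIV])
       (auto simp: Basis_vec_def inj_on_def axis_eq_axis)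
  also have "\<dots> = (\<Prod>i\<in>UNIV. if k $ i = 0 then 1 else 0)"
    using integral_cis_unit_interval by (simp add: inner_axis real_vec_def)
  also have "\<dots> = (if k = 0 then 1 else 0)"
    by (auto simp: vec_eq_iff)
  finally show ?thesis .
qed

inductive trig_poly :: "(real ^ 'd \<Rightarrow> complex) \<Rightarrow> bool" where
  monomial: "trig_poly (\<lambda>\<theta>. c * character k \<theta>)"
| add: "trig_poly f \<Longrightarrow> trig_poly g \<Longrightarrow> trig_poly (\<lambda>\<theta>. f \<theta> + g \<theta>)"

lemma trig_poly_torus_cont: "trig_poly p \<Longrightarrow> torus_cont p"
  by (induction rule: trig_poly.induct) (auto intro!: torus_cont_intros)

lemma trig_poly_const: "trig_poly (\<lambda>_. c)"
  using trig_poly.monomial[of c 0] by simp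

lemma trig_poly_mult:
  assumes "trig_poly f" "trig_poly g"
  shows "trig_poly (\<lambda>\<theta>. f \<theta> * g \<theta>)"
  using assms(1)
proof (induction rule: trig_poly.induct)
  case (monomial c k)
  from assms(2) show ?case
  proof (induction rule: trig_poly.induct)
    case (monomial c' l)
    then show ?case using trig_poly.monomial[of "c * c'" "k + l"] by (simp add: character_add mult_ac)
  qed (use trig_poly.add in \<open>simp add: ring_distribs\<close>)
qed (use trig_poly.add in \<open>simp add: ring_distribs\<close>)

lemma trig_poly_cmult: "trig_poly f \<Longrightarrow> trig_poly (\<lambda>\<theta>. c * f \<theta>)"
  by (rule trig_poly_mult[OF trig_poly_const])

lemma trig_poly_sum:
  "finite I \<Longrightarrow> (\<And>i. i \<in> I \<Longrightarrow> trig_poly (f i)) \<Longrightarrow> trig_poly (\<lambda>\<theta>. \<Sum>i\<in>I. f i \<theta>)"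
  by (induction I rule: finite_induct) (auto intro: trig_poly_const trig_poly.add)

lemma trig_poly_expansion:
  assumes "trig_poly p"
  shows "\<exists>K c. finite K \<and> p = (\<lambda>\<theta>. \<Sum>k\<in>K. c k * character k \<theta>)"
  using assms
proof (induction rule: trig_poly.induct)
  case (monomial c k)
  show ?case by (rule exI[of _ "{k}"], rule exI[of _ "\<lambda>_. c"]) simp
next
  case (add f g)
  then obtain K c L d where K: "finite K" "f = (\<lambda>\<theta>. \<Sum>k\<in>K. c k * character k \<theta>)"
    and L: "finite L" "g = (\<lambda>\<theta>. \<Sum>k\<in>L. d k * character k \<theta>)" by blast
  let ?e = "\<lambda>k. (if k \<in> K then c k else 0) + (if k \<in> L then d k else 0)"
  have "f \<theta> + g \<theta> = (\<Sum>k\<in>K \<union> L. ?e k * character k \<theta>)" for \<theta>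
  proof -
    have "f \<theta> = (\<Sum>k\<in>K \<union> L. (if k \<in> K then c k else 0) * character k \<theta>)"
      unfolding K(2) using K(1) L(1) by (intro sum.mono_neutral_cong_left) auto
    moreover have "g \<theta> = (\<Sum>k\<in>K \<union> L. (if k \<in> L then d k else 0) * character k \<theta>)"
      unfolding L(2) using K(1) L(1) by (intro sum.mono_neutral_cong_left) auto
    ultimately show ?thesis by (simp add: sum.distrib ring_distribs)
  qed
  then show ?case using K(1) L(1)
    by (intro exI[of _ "K \<union> L"] exI[of _ ?e]) auto
qed

text \<open>The torus as a compact subset of \<open>\<complex>\<^sup>d\<close>. Periodic continuous functions factor through this map, and
polynomials in the real coordinates of the image are trigonometric polynomials; this is how
the theorem of Stone and Weierstrass for compact subsets of Euclidean space applies.\<close>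

definition circle_map :: "real ^ 'd \<Rightarrow> complex ^ 'd" where
  "circle_map \<theta> = (\<chi> i. cis (2 * pi * \<theta> $ i))"

lemma circle_map_eq_imp:
  assumes "circle_map \<theta> = circle_map \<eta>"
  shows "\<exists>k. \<eta> = \<theta> + real_vec k"
proof -
  have "\<exists>m::int. \<eta> $ i = \<theta> $ i + of_int m" for i
  proof -
    have "cis (2 * pi * \<theta> $ i) = cis (2 * pi * \<eta> $ i)"
      using assms by (simp add: circle_map_def vec_eq_iff)
    then have "exp (\<i> * complex_of_real (2 * pi * \<eta> $ i)) = exp (\<i> * complex_of_real (2 * pi * \<theta> $ i))"
      by (simp add: cis_conv_exp)
    then obtain n :: int where n: "\<i> * complex_of_real (2 * pi * \<eta> $ i) = \<i> * complex_of_real (2 * pi * \<theta> $ i) + of_int (2 * n) * pi * \<i>"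
      unfolding exp_eq by blast
    then have "Im (\<i> * complex_of_real (2 * pi * \<eta> $ i)) = Im (\<i> * complex_of_real (2 * pi * \<theta> $ i) + of_int (2 * n) * pi * \<i>)"
      by simp
    then have "2 * pi * \<eta> $ i = 2 * pi * (\<theta> $ i + n)"
      by (simp add: algebra_simps)
    then have "\<eta> $ i = \<theta> $ i + n"
      by (metis mult_cancel_left pi_neq_zero mult_eq_0_iff zero_neq_numeral)
    then show ?thesis by blast
  qed
  then obtain m :: "'a \<Rightarrow> int" where "\<And>i. \<eta> $ i = \<theta> $ i + of_int (m i)" by metis
  then show ?thesis by (intro exI[of _ "\<chi> i. m i"]) (simp add: vec_eq_iff real_vec_def)
qed

text \<open>The real and imaginary parts of \<open>e\<^sup>2\<^sup>\<pi>\<^sup>i\<^sup>t\<close> are combinations of the two characters \<open>e\<^sup>2\<^sup>\<pi>\<^sup>i\<^sup>t\<close> and \<open>e\<^sup>-\<^sup>2\<^sup>\<pi>\<^sup>i\<^sup>t\<close>.\<close>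

lemma bounded_linear_circle_map_trig_poly:
  fixes l :: "complex ^ 'd \<Rightarrow> real"
  assumes "bounded_linear l"
  shows "trig_poly (\<lambda>\<theta>. complex_of_real (l (circle_map \<theta>)))"
proof -
  interpret bounded_linear l by fact
  have cm: "circle_map \<theta> = (\<Sum>i\<in>UNIV. cos (2 * pi * \<theta> $ i) *\<^sub>R axis i 1 + sin (2 * pi * \<theta> $ i) *\<^sub>R axis i \<i>)" for \<theta> :: "real ^ 'd"
    unfolding circle_map_def vec_eq_iff
    by (auto simp: axis_def if_distrib[of "scaleR _"] if_distribR sum.distrib cong: if_cong)
       (simp add: complex_eq_iff)
  have chi: "character (axis i 1) \<theta> = cis (2 * pi * \<theta> $ i)" "character (axis i (-1)) \<theta> = cis (- (2 * pi * \<theta> $ i))"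
    for i and \<theta> :: "real ^ 'd"
    by (simp_all add: character_def real_vec_def inner_vec_def axis_def if_distrib if_distribR cong: if_cong)
  let ?A = "\<lambda>i. complex_of_real (l (axis i 1))" and ?B = "\<lambda>i. complex_of_real (l (axis i \<i>))"
  have eq: "complex_of_real (l (circle_map \<theta>)) =
     (\<Sum>i\<in>UNIV. (?A i - \<i> * ?B i) / 2 * character (axis i 1) \<theta> + (?A i + \<i> * ?B i) / 2 * character (axis i (-1)) \<theta>)" for \<theta>
    unfolding cm chi by (simp add: sum add scaleR) (auto intro!: sum.cong simp: complex_eq_iff field_simps)
  show ?thesis
    unfolding eq by (intro trig_poly_sum trig_poly.intros) auto
qed

theorem trig_poly_dense_real:
  fixes f :: "real ^ 'd \<Rightarrow> real"
  assumes f: "torus_cont f" and "\<epsilon> > 0"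
  obtains p where "trig_poly p" "\<And>\<theta>. cmod (complex_of_real (f \<theta>) - p \<theta>) < \<epsilon>"
proof -
  let ?E = "circle_map :: real ^ 'd \<Rightarrow> _"
  define S where "S = ?E ` cbox 0 1"
  have contE: "continuous_on A ?E" for A
    unfolding circle_map_def[abs_def] by (intro continuous_intros)
  have S: "compact S" unfolding S_def by (intro compact_continuous_image contE compact_cbox)
  define g where "g z = f (inv_into (cbox 0 1) ?E z)" for z
  have gE: "g (?E \<theta>) = f \<theta>" if "\<theta> \<in> cbox 0 1" for \<theta>
  proof -
    have "?E (inv_into (cbox 0 1) ?E (?E \<theta>)) = ?E \<theta>"
      using that by (intro f_inv_into_f) auto
    then show ?thesis unfolding g_def using f circle_map_eq_imp
      by (metis torus_cont_def torus_periodic_def)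
  qed
  have "continuous_on S g"
    unfolding continuous_on_closed_vimage[OF compact_imp_closed[OF S]]
  proof (intro allI impI)
    fix B :: "real set" assume "closed B"
    have "g -` B \<inter> S = ?E ` (cbox 0 1 \<inter> f -` B)"
      using gE by (auto simp: S_def)
    moreover have "closed (f -` B)"
      using f \<open>closed B\<close> by (auto simp: torus_cont_def intro: continuous_closed_vimage continuous_on_eq_continuous_at[THEN iffD1, rule_format])
    then have "compact (cbox 0 1 \<inter> f -` B)"
      by (intro compact_Int_closed compact_cbox)
    ultimately show "closed (g -` B \<inter> S)"
      by (metis compact_continuous_image compact_imp_closed contE)
  qed
  then obtain h where h: "real_polynomial_function h" "\<And>z. z \<in> S \<Longrightarrow> \<bar>g z - h z\<bar> < \<epsilon>"
    using Stone_Weierstrass_real_polynomial_function[OF S _ \<open>\<epsilon> > 0\<close>] by blast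
  have tp: "trig_poly (\<lambda>\<theta>. complex_of_real (h (?E \<theta>)))"
    using h(1)
  proof (induction rule: real_polynomial_function.induct)
    case (linear f)
    then show ?case by (rule bounded_linear_circle_map_trig_poly)
  qed (auto intro: trig_poly_const trig_poly.add trig_poly_mult)
  have "cmod (complex_of_real (f \<theta>) - complex_of_real (h (?E \<theta>))) < \<epsilon>" for \<theta>
  proof -
    obtain k where k: "\<theta> + real_vec k \<in> cbox 0 1" using exists_cube_representative by blast
    have "f (\<theta> + real_vec k) = f \<theta>" using f by (simp add: torus_cont_def torus_periodic_def)
    moreover have "?E (\<theta> + real_vec k) = ?E \<theta>"
      using cis_multiple_2pi[of "of_int _"]
      by (simp add: circle_map_def vec_eq_iff real_vec_def ring_distribs flip: cis_mult)
    ultimately have "\<bar>f \<theta> - h (?E \<theta>)\<bar> < \<epsilon>"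
      using h(2)[of "?E (\<theta> + real_vec k)"] gE[OF k] k unfolding S_def by (metis imageI)
    then show ?thesis by (metis norm_of_real of_real_diff)
  qed
  with tp show ?thesis using that by blast
qed

theorem trig_poly_dense:
  assumes f: "torus_cont f" and "\<epsilon> > 0"
  obtains p where "trig_poly p" "\<And>\<theta>. cmod (f \<theta> - p \<theta>) < \<epsilon>"
proof -
  obtain p where p: "trig_poly p" "\<And>\<theta>. cmod (complex_of_real (Re (f \<theta>)) - p \<theta>) < \<epsilon> / 2"
    using trig_poly_dense_real[OF torus_cont_Re[OF f], of "\<epsilon> / 2"] \<open>\<epsilon> > 0\<close> by auto
  obtain q where q: "trig_poly q" "\<And>\<theta>. cmod (complex_of_real (Im (f \<theta>)) - q \<theta>) < \<epsilon> / 2"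
    using trig_poly_dense_real[OF torus_cont_Im[OF f], of "\<epsilon> / 2"] \<open>\<epsilon> > 0\<close> by auto
  have "cmod (f \<theta> - (p \<theta> + \<i> * q \<theta>)) < \<epsilon>" for \<theta>
  proof -
    have "f \<theta> - (p \<theta> + \<i> * q \<theta>) = (complex_of_real (Re (f \<theta>)) - p \<theta>) + \<i> * (complex_of_real (Im (f \<theta>)) - q \<theta>)"
      by (subst complex_eq[of "f \<theta>"]) (simp add: algebra_simps)
    also have "cmod \<dots> \<le> cmod (complex_of_real (Re (f \<theta>)) - p \<theta>) + cmod (complex_of_real (Im (f \<theta>)) - q \<theta>)"
      by (rule norm_triangle_le) (simp add: norm_mult)
    also have "\<dots> < \<epsilon>" using p(2)[of \<theta>] q(2)[of \<theta>] by linarith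
    finally show ?thesis .
  qed
  moreover have "trig_poly (\<lambda>\<theta>. p \<theta> + \<i> * q \<theta>)"
    by (intro trig_poly.add trig_poly_cmult p(1) q(1))
  ultimately show ?thesis using that by blast
qed

lemma torus_mean_translate_trig:
  "trig_poly p \<Longrightarrow> torus_mean (\<lambda>\<theta>. p (\<theta> + v)) = torus_mean p"
proof (induction rule: trig_poly.induct)
  case (monomial c k)
  have "torus_mean (\<lambda>\<theta>. c * character k (\<theta> + v)) = c * character k v * torus_mean (character k)"
    by (subst torus_mean_cmult[symmetric]) (simp add: character_add_right mult_ac)
  also have "\<dots> = c * torus_mean (character k)" by (simp add: torus_mean_character)
  finally show ?case by (simp add: torus_mean_cmult)
next
  case (add f g)
  then show ?case
    by (simp add: torus_mean_add trig_poly_torus_cont torus_cont_translate)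
qed

text \<open>Invariance is immediate for characters, since the nontrivial ones have mean zero, and uniform
density of their span carries it over to all continuous functions.\<close>

theorem torus_mean_translate_complex:
  fixes f :: "real ^ 'd \<Rightarrow> complex"
  assumes f: "torus_cont f"
  shows "torus_mean (\<lambda>\<theta>. f (\<theta> + v)) = torus_mean f"
proof (rule ccontr)
  define \<epsilon> where "\<epsilon> = cmod (torus_mean (\<lambda>\<theta>. f (\<theta> + v)) - torus_mean f) / 2"
  assume "torus_mean (\<lambda>\<theta>. f (\<theta> + v)) \<noteq> torus_mean f"
  then have "\<epsilon> > 0" by (simp add: \<epsilon>_def)
  then have "\<epsilon> / 2 > 0" by simp
  then obtain p where p: "trig_poly p" "\<And>\<theta>. cmod (f \<theta> - p \<theta>) < \<epsilon> / 2"
    using trig_poly_dense[OF f] by blast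
  note pc = trig_poly_torus_cont[OF p(1)]
  have "cmod (torus_mean (\<lambda>\<theta>. f \<theta> - p \<theta>)) \<le> \<epsilon> / 2"
    using p(2) less_imp_le by (intro torus_mean_norm_le torus_cont_intros f pc) blast
  moreover have "cmod (torus_mean (\<lambda>\<theta>. f (\<theta> + v) - p (\<theta> + v))) \<le> \<epsilon> / 2"
    using p(2) less_imp_le by (intro torus_mean_norm_le torus_cont_diff torus_cont_translate f pc) blast
  ultimately have "cmod (torus_mean f - torus_mean p) \<le> \<epsilon> / 2"
      "cmod (torus_mean (\<lambda>\<theta>. f (\<theta> + v)) - torus_mean p) \<le> \<epsilon> / 2"
    by (simp_all add: torus_mean_diff torus_cont_translate f pc torus_mean_translate_trig[OF p(1)])
  then have "cmod (torus_mean (\<lambda>\<theta>. f (\<theta> + v)) - torus_mean f) \<le> \<epsilon>"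
    by (smt (verit) norm_minus_commute norm_diff_triangle_ineq norm_triangle_ineq4 diff_add_cancel add_diff_eq field_sum_of_halves diff_diff_eq2)
  then show False using \<open>\<epsilon> > 0\<close> by (simp add: \<epsilon>_def)
qed

lemma torus_mean_translate:
  fixes f :: "real ^ 'd \<Rightarrow> real"
  assumes f: "torus_cont f"
  shows "torus_mean (\<lambda>\<theta>. f (\<theta> + v)) = torus_mean f"
  using torus_mean_translate_complex[OF torus_cont_of_real[OF f], of v]
  by (simp add: torus_mean_of_real torus_cont_translate f)

section \<open>Square-summable families\<close>

lemma ell2_L2_set_le:
  assumes "u \<in> ell2"
  shows "L2_set (\<lambda>i. cmod (u i)) J \<le> ell2_norm u"
proof (cases "finite J")
  case True
  have "(\<Sum>i\<in>J. (cmod (u i))\<^sup>2) \<le> (\<Sum>\<^sub>\<infinity>i. (cmod (u i))\<^sup>2)"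
    using assms True by (intro finite_sum_le_infsum) (auto simp: ell2_def)
  then show ?thesis by (simp add: L2_set_def ell2_norm_def)
qed (simp add: L2_set_def ell2_norm_def infsum_nonneg)

text \<open>Together with \<open>ell2_L2_set_le\<close> this reduces statements about the norm to finite sums, where the
inequalities for \<open>L2_set\<close> apply.\<close>

lemma ell2_boundI:
  assumes "\<And>J. finite J \<Longrightarrow> L2_set (\<lambda>i. cmod (u i)) J \<le> B"
  shows "u \<in> ell2" "ell2_norm u \<le> B"
proof -
  have B: "0 \<le> B" using assms[of "{}"] by simp
  have le: "(\<Sum>i\<in>J. (cmod (u i))\<^sup>2) \<le> B\<^sup>2" if "finite J" for J
    using assms[OF that] unfolding L2_set_def by (rule sqrt_le_D)
  have s: "(\<lambda>i. (cmod (u i))\<^sup>2) summable_on UNIV"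
    using le by (intro nonneg_bdd_above_summable_on bdd_aboveI[of _ "B\<^sup>2"]) auto
  then show "u \<in> ell2" by (simp add: ell2_def)
  have "(\<Sum>\<^sub>\<infinity>i. (cmod (u i))\<^sup>2) \<le> B\<^sup>2"
    using le s by (intro infsum_le_finite_sums) auto
  then show "ell2_norm u \<le> B"
    unfolding ell2_norm_def using B by (intro real_le_lsqrt)
qed

lemma ell2_norm_nonneg [simp]: "0 \<le> ell2_norm u"
  by (simp add: ell2_norm_def infsum_nonneg)

lemma ell2_add:
  assumes "u \<in> ell2" "v \<in> ell2"
  shows "(\<lambda>n. u n + v n) \<in> ell2" "ell2_norm (\<lambda>n. u n + v n) \<le> ell2_norm u + ell2_norm v"
proof -
  have "L2_set (\<lambda>i. cmod (u i + v i)) J \<le> ell2_norm u + ell2_norm v" for J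
  proof -
    have "L2_set (\<lambda>i. cmod (u i + v i)) J \<le> L2_set (\<lambda>i. cmod (u i) + cmod (v i)) J"
      by (intro L2_set_mono norm_triangle_ineq) auto
    also have "\<dots> \<le> L2_set (\<lambda>i. cmod (u i)) J + L2_set (\<lambda>i. cmod (v i)) J"
      by (rule L2_set_triangle_ineq)
    also have "\<dots> \<le> ell2_norm u + ell2_norm v"
      by (intro add_mono ell2_L2_set_le assms)
    finally show ?thesis .
  qed
  then show "(\<lambda>n. u n + v n) \<in> ell2" "ell2_norm (\<lambda>n. u n + v n) \<le> ell2_norm u + ell2_norm v"
    by (auto intro!: ell2_boundI)
qed

lemma ell2_cmult:
  assumes "u \<in> ell2"
  shows "(\<lambda>n. c * u n) \<in> ell2" "ell2_norm (\<lambda>n. c * u n) = cmod c * ell2_norm u"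
proof -
  show "(\<lambda>n. c * u n) \<in> ell2"
    using assms by (auto simp: ell2_def norm_mult power_mult_distrib intro: summable_on_cmult_right)
  have "(\<Sum>\<^sub>\<infinity>n. (cmod (c * u n))\<^sup>2) = (cmod c)\<^sup>2 * (\<Sum>\<^sub>\<infinity>n. (cmod (u n))\<^sup>2)"
    using assms by (simp add: ell2_def norm_mult power_mult_distrib infsum_cmult_right)
  then show "ell2_norm (\<lambda>n. c * u n) = cmod c * ell2_norm u"
    by (simp add: ell2_norm_def real_sqrt_mult)
qed

lemma ell2_diff:
  assumes "u \<in> ell2" "v \<in> ell2"
  shows "(\<lambda>n. u n - v n) \<in> ell2" "ell2_norm (\<lambda>n. u n - v n) \<le> ell2_norm u + ell2_norm v"
  using ell2_add[OF assms(1) ell2_cmult(1)[OF assms(2), of "-1"]] ell2_cmult(2)[OF assms(2), of "-1"]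
  by simp_all

lemma ell2_norm_cong_cmod:
  assumes "\<And>n. cmod (u n) = cmod (v n)"
  shows "u \<in> ell2 \<longleftrightarrow> v \<in> ell2" "ell2_norm u = ell2_norm v"
  using assms by (simp_all add: ell2_def ell2_norm_def)

lemma ell2_coordinate_le: "u \<in> ell2 \<Longrightarrow> cmod (u n) \<le> ell2_norm u"
  using ell2_L2_set_le[of u "{n}"] by simp

lemma ell2_zero: "(\<lambda>_. 0) \<in> ell2" "ell2_norm (\<lambda>_. 0) = 0"
  by (simp_all add: ell2_def ell2_norm_def)

lemma ell2_norm_eq_0_imp: "u \<in> ell2 \<Longrightarrow> ell2_norm u \<le> 0 \<Longrightarrow> u = (\<lambda>_. 0)"
  using ell2_coordinate_le[of u] by (intro ext) (meson norm_le_zero_iff order_trans)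

lemma ell2_finite_support: "finite K \<Longrightarrow> (\<And>n. n \<notin> K \<Longrightarrow> u n = 0) \<Longrightarrow> u \<in> ell2"
  unfolding ell2_def mem_Collect_eq
  by (subst summable_on_cong_neutral[where T = K and g = "\<lambda>n. (cmod (u n))\<^sup>2"]) auto

lemma ell2_restrict:
  assumes "u \<in> ell2"
  shows "(\<lambda>n. if n \<in> S then u n else 0) \<in> ell2"
    "ell2_norm (\<lambda>n. if n \<in> S then u n else 0) \<le> ell2_norm u"
proof -
  have "L2_set (\<lambda>n. cmod (if n \<in> S then u n else 0)) J \<le> ell2_norm u" for J
    by (rule order_trans[OF L2_set_mono ell2_L2_set_le[OF assms, of J]]) auto
  then show "(\<lambda>n. if n \<in> S then u n else 0) \<in> ell2"
    "ell2_norm (\<lambda>n. if n \<in> S then u n else 0) \<le> ell2_norm u"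
    by (auto intro!: ell2_boundI)
qed

lemma ell2_restrict_compl: "u \<in> ell2 \<Longrightarrow> (\<lambda>n. if n \<in> S then 0 else u n) \<in> ell2"
proof -
  have "(\<lambda>n. if n \<in> S then 0 else u n) = (\<lambda>n. if n \<in> - S then u n else 0)" by auto
  then show "u \<in> ell2 \<Longrightarrow> (\<lambda>n. if n \<in> S then 0 else u n) \<in> ell2"
    using ell2_restrict(1)[of u "- S"] by simp
qed

lemma ell2_small_tail:
  assumes u: "u \<in> ell2" and "\<epsilon> > 0"
  obtains S where "finite S" "ell2_norm (\<lambda>n. if n \<in> S then 0 else u n) \<le> \<epsilon>"
proof -
  let ?s = "\<Sum>\<^sub>\<infinity>n. (cmod (u n))\<^sup>2"
  have sm: "(\<lambda>n. (cmod (u n))\<^sup>2) summable_on UNIV" using u by (simp add: ell2_def)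
  then have "(sum (\<lambda>n. (cmod (u n))\<^sup>2) \<longlongrightarrow> ?s) (finite_subsets_at_top UNIV)"
    by (rule infsum_tendsto)
  then have "eventually (\<lambda>S. dist (sum (\<lambda>n. (cmod (u n))\<^sup>2) S) ?s < \<epsilon>\<^sup>2) (finite_subsets_at_top UNIV)"
    using \<open>\<epsilon> > 0\<close> by (intro tendstoD) auto
  then obtain S where S: "finite S" "dist (sum (\<lambda>n. (cmod (u n))\<^sup>2) S) ?s < \<epsilon>\<^sup>2"
    by (auto simp: eventually_finite_subsets_at_top)
  have "L2_set (\<lambda>n. cmod (if n \<in> S then 0 else u n)) J \<le> \<epsilon>" if "finite J" for J
  proof -
    have "(\<Sum>n\<in>J. (cmod (if n \<in> S then 0 else u n))\<^sup>2) = (\<Sum>n\<in>J - S. (cmod (u n))\<^sup>2)"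
      using that by (intro sum.mono_neutral_cong_right) auto
    also have "\<dots> = (\<Sum>n\<in>J \<union> S. (cmod (u n))\<^sup>2) - (\<Sum>n\<in>S. (cmod (u n))\<^sup>2)"
      using that S(1) by (subst sum_diff[symmetric]) (auto intro: sum.cong)
    also have "\<dots> \<le> ?s - (\<Sum>n\<in>S. (cmod (u n))\<^sup>2)"
      using that S(1) by (intro diff_right_mono finite_sum_le_infsum sm) auto
    also have "\<dots> \<le> \<epsilon>\<^sup>2" using S(2) by (simp add: dist_real_def)
    finally show ?thesis
      unfolding L2_set_def using \<open>\<epsilon> > 0\<close> by (intro real_le_lsqrt) (auto intro: sum_nonneg)
  qed
  then show ?thesis by (intro that[OF S(1)] ell2_boundI(2))
qed

text \<open>The solution is the sum of the Neumann series of \<open>S\<close>. Its partial sums converge in each coordinate,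
and the bound for the tails passes to the limit on finite index sets, which is
the completeness of \<open>\<ell>\<^sup>2\<close> for this particular sequence.\<close>

lemma ell2_contraction_surj:
  fixes S :: "('i \<Rightarrow> complex) \<Rightarrow> 'i \<Rightarrow> complex"
  assumes S: "\<And>u. u \<in> ell2 \<Longrightarrow> S u \<in> ell2"
    and add: "\<And>u v n. u \<in> ell2 \<Longrightarrow> v \<in> ell2 \<Longrightarrow> S (\<lambda>n. u n + v n) n = S u n + S v n"
    and bound: "\<And>u. u \<in> ell2 \<Longrightarrow> ell2_norm (S u) \<le> q * ell2_norm u"
    and q: "0 \<le> q" "q < 1" and v: "v \<in> ell2"
  shows "\<exists>u\<in>ell2. \<forall>n. u n - S u n = v n"
proof -
  define t where "t k = (S ^^ k) v" for k
  define s where "s k = (\<lambda>n. \<Sum>j<k. t j n)" for k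
  have t: "t k \<in> ell2" "ell2_norm (t k) \<le> q ^ k * ell2_norm v" for k
  proof (induction k)
    case (Suc k)
    { case 1 show ?case using S[OF Suc(1)] by (simp add: t_def) }
    { case 2
      have "ell2_norm (t (Suc k)) \<le> q * ell2_norm (t k)" using bound[OF Suc(1)] by (simp add: t_def)
      also have "\<dots> \<le> q * (q ^ k * ell2_norm v)" using Suc(2) q by (intro mult_left_mono)
      finally show ?case by simp }
  qed (use v in \<open>simp_all add: t_def\<close>)
  have s: "s k \<in> ell2" for k
  proof (induction k)
    case (Suc k) then show ?case using ell2_add(1)[OF Suc t(1)[of k]] by (simp add: s_def)
  qed (simp add: s_def ell2_zero)
  have S0: "S (\<lambda>_. 0) n = 0" for n using add[OF ell2_zero(1) ell2_zero(1), of n] by simp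
  have Ss: "S (s k) n = (\<Sum>j<k. t (Suc j) n)" for k n
  proof (induction k)
    case 0 then show ?case by (simp add: s_def S0)
  next
    case (Suc k)
    have "s (Suc k) = (\<lambda>n. s k n + t k n)" by (simp add: s_def)
    then show ?case using add[OF s t(1), of k k n] Suc by (simp add: t_def)
  qed
  have dist_bound: "ell2_norm (\<lambda>n. s (m + k) n - s m n) \<le> q ^ m * ell2_norm v / (1 - q)" for m k
  proof -
    have "ell2_norm (\<lambda>n. s (m + k) n - s m n) \<le> (\<Sum>j<k. q ^ (m + j) * ell2_norm v)
        \<and> (\<lambda>n. s (m + k) n - s m n) \<in> ell2"
    proof (induction k)
      case (Suc k)
      have "(\<lambda>n. s (m + Suc k) n - s m n) = (\<lambda>n. (s (m + k) n - s m n) + t (m + k) n)"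
        by (auto simp: s_def)
      then show ?case
        using ell2_add[OF Suc[THEN conjunct2] t(1)[of "m + k"]] t(2)[of "m + k"] Suc by simp
    qed (simp add: ell2_zero)
    then have "ell2_norm (\<lambda>n. s (m + k) n - s m n) \<le> q ^ m * ell2_norm v * (\<Sum>j<k. q ^ j)"
      by (simp add: sum_distrib_left power_add mult_ac)
    also have "(\<Sum>j<k. q ^ j) \<le> 1 / (1 - q)"
      using q by (simp add: sum_gp_strict divide_right_mono)
    finally show ?thesis using q by (simp add: mult_left_mono)
  qed
  have lim0: "(\<lambda>m. q ^ m * ell2_norm v / (1 - q)) \<longlonglongrightarrow> 0"
    using q by (auto intro!: tendsto_eq_intros LIMSEQ_realpow_zero)
  have sdiff: "(\<lambda>n. s k n - s m n) \<in> ell2" for k m by (intro ell2_diff s)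
  have "Cauchy (\<lambda>k. s k n)" for n
  proof (rule metric_CauchyI)
    fix e :: real assume "e > 0"
    then have "eventually (\<lambda>m. q ^ m * ell2_norm v / (1 - q) < e / 2) sequentially"
      using lim0 by (intro order_tendstoD(2)[OF lim0]) auto
    then obtain M where M: "q ^ M * ell2_norm v / (1 - q) < e / 2"
      by (auto simp: eventually_sequentially)
    have dd: "dist (s k n) (s M n) < e / 2" if "k \<ge> M" for k
    proof -
      have "cmod (s k n - s M n) \<le> ell2_norm (\<lambda>n. s k n - s M n)"
        by (rule ell2_coordinate_le[OF sdiff])
      also have "\<dots> \<le> q ^ M * ell2_norm v / (1 - q)" using dist_bound[of M "k - M"] that by simp
      finally show ?thesis using M by (simp only: dist_norm)
    qed
    have "dist (s k n) (s l n) < e" if "k \<ge> M" "l \<ge> M" for k l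
      by (rule dist_triangle_half_l[OF dd[OF that(1)] dd[OF that(2)]])
    then show "\<exists>M. \<forall>m\<ge>M. \<forall>k\<ge>M. dist (s m n) (s k n) < e" by blast
  qed
  then obtain u where u: "(\<lambda>k. s k n) \<longlonglongrightarrow> u n" for n
    using that[of "\<lambda>n. lim (\<lambda>k. s k n)"] by (simp add: Cauchy_convergent_iff convergent_LIMSEQ_iff)
  have um: "(\<lambda>n. u n - s m n) \<in> ell2" "ell2_norm (\<lambda>n. u n - s m n) \<le> q ^ m * ell2_norm v / (1 - q)" for m
  proof -
    have *: "L2_set (\<lambda>n. cmod (u n - s m n)) J \<le> q ^ m * ell2_norm v / (1 - q)" for J
    proof (rule tendsto_upperbound)
      show "(\<lambda>k. L2_set (\<lambda>n. cmod (s (m + k) n - s m n)) J) \<longlonglongrightarrow> L2_set (\<lambda>n. cmod (u n - s m n)) J"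
        unfolding L2_set_def
        by (intro tendsto_intros) (use LIMSEQ_ignore_initial_segment[OF u, of m] in \<open>simp add: add.commute\<close>)
      show "\<forall>\<^sub>F k in sequentially. L2_set (\<lambda>n. cmod (s (m + k) n - s m n)) J \<le> q ^ m * ell2_norm v / (1 - q)"
        by (intro always_eventually allI order_trans[OF ell2_L2_set_le dist_bound] sdiff)
    qed simp
    show "(\<lambda>n. u n - s m n) \<in> ell2" "ell2_norm (\<lambda>n. u n - s m n) \<le> q ^ m * ell2_norm v / (1 - q)"
      using ell2_boundI[OF *] by auto
  qed
  have uell: "u \<in> ell2" using um(1)[of 0] by (simp add: s_def)
  have "u n - S u n = v n" for n
  proof -
    have est: "cmod (u n - S u n - v n) \<le> 2 * (q ^ m * ell2_norm v / (1 - q)) + q ^ m * ell2_norm v" for m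
    proof -
      let ?w = "\<lambda>n. u n - s m n"
      have "S u n = S (s m) n + S ?w n" using add[OF s um(1), of m m n] by simp
      moreover have "s m n - S (s m) n = v n - t m n"
        unfolding Ss by (induction m) (simp_all add: s_def t_def algebra_simps)
      ultimately have "u n - S u n - v n = ?w n - S ?w n - t m n" by (simp add: algebra_simps)
      then have "cmod (u n - S u n - v n) \<le> cmod (?w n) + cmod (S ?w n) + cmod (t m n)"
        by (metis (no_types, lifting) norm_triangle_ineq4 add_right_mono order_trans)
      also have "cmod (?w n) \<le> q ^ m * ell2_norm v / (1 - q)"
        using ell2_coordinate_le[OF um(1)] um(2) order_trans by blast
      also have "cmod (S ?w n) \<le> q * ell2_norm ?w"
        using ell2_coordinate_le[OF S[OF um(1)]] bound[OF um(1)] order_trans by blast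
      also have "\<dots> \<le> 1 * (q ^ m * ell2_norm v / (1 - q))"
        using um(2)[of m] q by (intro mult_mono) auto
      also have "cmod (t m n) \<le> q ^ m * ell2_norm v"
        using ell2_coordinate_le[OF t(1)] t(2) order_trans by blast
      finally show ?thesis by (simp add: mult_ac)
    qed
    have "(\<lambda>m. 2 * (q ^ m * ell2_norm v / (1 - q)) + q ^ m * ell2_norm v) \<longlonglongrightarrow> 0"
      using q by (auto intro!: tendsto_eq_intros LIMSEQ_realpow_zero)
    then have "cmod (u n - S u n - v n) \<le> 0"
      by (rule LIMSEQ_le_const) (use est in auto)
    then show ?thesis by simp
  qed
  with uell show ?thesis by blast
qed

section \<open>Fourier coefficients and the identity of Parseval\<close>

lemma fourier_coeff_eq: "fourier_coeff f k = torus_mean (\<lambda>\<theta>. f \<theta> * character (- k) \<theta>)"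
  by (simp add: fourier_coeff_def torus_mean_eq character_def)

definition torus_L2 :: "(real ^ 'd \<Rightarrow> complex) \<Rightarrow> real" where
  "torus_L2 f = sqrt (torus_mean (\<lambda>\<theta>. (cmod (f \<theta>))\<^sup>2))"

lemma torus_L2_nonneg [simp]: "0 \<le> torus_L2 f"
  by (simp add: torus_L2_def torus_mean_def)

lemma torus_L2_power2: "(torus_L2 f)\<^sup>2 = torus_mean (\<lambda>\<theta>. (cmod (f \<theta>))\<^sup>2)"
  by (simp add: torus_L2_def torus_mean_def)

lemma torus_L2_mono:
  assumes "torus_cont f" "torus_cont g" "0 \<le> B" "\<And>\<theta>. cmod (f \<theta>) \<le> B * cmod (g \<theta>)"
  shows "torus_L2 f \<le> B * torus_L2 g"
proof -
  have le: "(cmod (f \<theta>))\<^sup>2 \<le> B\<^sup>2 * (cmod (g \<theta>))\<^sup>2" for \<theta>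
    using power_mono[OF assms(4)[of \<theta>], of 2] by (simp add: power_mult_distrib)
  have "(torus_L2 f)\<^sup>2 \<le> torus_mean (\<lambda>\<theta>. B\<^sup>2 * (cmod (g \<theta>))\<^sup>2)"
    unfolding torus_L2_power2
    by (intro torus_mean_mono torus_cont_power torus_cont_mult torus_cont_norm torus_cont_const le assms(1,2))
  also have "\<dots> = (B * torus_L2 g)\<^sup>2"
    unfolding power_mult_distrib torus_L2_power2 by (rule torus_mean_cmult)
  finally show ?thesis by (rule power2_le_imp_le) (simp add: assms(3))
qed

lemma torus_L2_le_const:
  assumes "torus_cont f" "0 \<le> B" "\<And>\<theta>. cmod (f \<theta>) \<le> B"
  shows "torus_L2 f \<le> B"
  using torus_L2_mono[OF assms(1) torus_cont_const[of 1] assms(2)] assms(3) by (simp add: torus_L2_def)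

lemma fourier_coeff_add:
  "torus_cont f \<Longrightarrow> torus_cont g \<Longrightarrow> fourier_coeff (\<lambda>\<theta>. f \<theta> + g \<theta>) k = fourier_coeff f k + fourier_coeff g k"
  unfolding fourier_coeff_eq
  by (subst torus_mean_add[symmetric]) (auto intro!: torus_cont_intros simp: ring_distribs)

lemma fourier_coeff_cmult: "fourier_coeff (\<lambda>\<theta>. c * f \<theta>) k = c * fourier_coeff f k"
  unfolding fourier_coeff_eq by (subst torus_mean_cmult[symmetric]) (simp add: mult_ac)

lemma fourier_coeff_diff:
  "torus_cont f \<Longrightarrow> torus_cont g \<Longrightarrow> fourier_coeff (\<lambda>\<theta>. f \<theta> - g \<theta>) k = fourier_coeff f k - fourier_coeff g k"
  unfolding fourier_coeff_eq
  by (subst torus_mean_diff[symmetric]) (auto intro!: torus_cont_intros simp: ring_distribs)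

lemma fourier_coeff_sum:
  assumes "\<And>i. i \<in> I \<Longrightarrow> torus_cont (f i)"
  shows "fourier_coeff (\<lambda>\<theta>. \<Sum>i\<in>I. f i \<theta>) k = (\<Sum>i\<in>I. fourier_coeff (f i) k)"
  unfolding fourier_coeff_eq using assms
  by (subst torus_mean_sum[symmetric]) (auto intro!: torus_cont_intros simp: sum_distrib_right)

lemma fourier_coeff_mult_character:
  "fourier_coeff (\<lambda>\<theta>. f \<theta> * character m \<theta>) k = fourier_coeff f (k - m)"
proof -
  have "character m \<theta> * character (- k) \<theta> = character (- (k - m)) \<theta>" for \<theta>
    by (simp flip: character_add)
  then show ?thesis unfolding fourier_coeff_eq by (simp add: mult.assoc)
qed

lemma fourier_coeff_const: "fourier_coeff (\<lambda>_. c) k = (if k = 0 then c else 0)"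
  unfolding fourier_coeff_eq by (simp add: torus_mean_cmult torus_mean_character)

lemma fourier_coeff_character: "fourier_coeff (character m) k = (if k = m then 1 else 0)"
  using fourier_coeff_mult_character[of "\<lambda>_. 1" m k] by (simp add: fourier_coeff_const)

lemma fourier_coeff_translate:
  assumes "torus_cont f"
  shows "fourier_coeff (\<lambda>\<theta>. f (\<theta> + \<alpha>)) k = character k \<alpha> * fourier_coeff f k"
proof -
  have "character k \<alpha> * cnj (character k \<alpha>) = 1"
    by (simp add: character_def cis_cnj cis_mult)
  then have eq: "f (\<theta> + \<alpha>) * character (- k) \<theta> = character k \<alpha> * (f (\<theta> + \<alpha>) * character (- k) (\<theta> + \<alpha>))" for \<theta>
    by (simp add: character_add_right character_minus mult_ac)
  have "fourier_coeff (\<lambda>\<theta>. f (\<theta> + \<alpha>)) k = character k \<alpha> * torus_mean (\<lambda>\<theta>. f (\<theta> + \<alpha>) * character (- k) (\<theta> + \<alpha>))"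
    unfolding fourier_coeff_eq eq by (rule torus_mean_cmult)
  also have "torus_mean (\<lambda>\<theta>. f (\<theta> + \<alpha>) * character (- k) (\<theta> + \<alpha>)) = fourier_coeff f k"
    unfolding fourier_coeff_eq
    using torus_mean_translate_complex[of "\<lambda>\<theta>. f \<theta> * character (- k) \<theta>" \<alpha>] assms
    by (auto intro!: torus_cont_intros)
  finally show ?thesis .
qed

lemma fourier_coeff_trig_sum:
  assumes "finite K"
  shows "fourier_coeff (\<lambda>\<theta>. \<Sum>m\<in>K. c m * character m \<theta>) k = (if k \<in> K then c k else 0)"
  using assms by (subst fourier_coeff_sum)
    (auto intro!: torus_cont_intros simp: fourier_coeff_cmult fourier_coeff_character if_distrib sum.delta' cong: if_cong)

text \<open>Completing the square. If \<open>c\<close> are the Fourier coefficients, this is the inequality of Bessel, and with arbitrary \<open>c\<close> it says that the Fourier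
coefficients give the best approximation, which is used for the identity of Parseval.\<close>

lemma torus_L2_diff_trig_sum:
  assumes F: "torus_cont F" and K: "finite K"
  shows "(torus_L2 (\<lambda>\<theta>. F \<theta> - (\<Sum>k\<in>K. c k * character k \<theta>)))\<^sup>2
    = (torus_L2 F)\<^sup>2 - (\<Sum>k\<in>K. (cmod (fourier_coeff F k))\<^sup>2) + (\<Sum>k\<in>K. (cmod (fourier_coeff F k - c k))\<^sup>2)"
proof -
  define P where "P \<theta> = (\<Sum>k\<in>K. c k * character k \<theta>)" for \<theta>
  have P: "torus_cont P" unfolding P_def[abs_def] by (intro torus_cont_intros torus_cont_character)
  let ?F = "fourier_coeff F"
  have ip: "torus_mean (\<lambda>\<theta>. G \<theta> * cnj (P \<theta>)) = (\<Sum>k\<in>K. cnj (c k) * fourier_coeff G k)" if "torus_cont G" for G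
  proof -
    have "G \<theta> * cnj (P \<theta>) = (\<Sum>k\<in>K. cnj (c k) * (G \<theta> * character (- k) \<theta>))" for \<theta>
      by (simp add: P_def sum_distrib_left character_minus mult_ac)
    then show ?thesis using that
      by (simp add: torus_mean_sum torus_mean_cmult fourier_coeff_eq torus_cont_intros torus_cont_character)
  qed
  have sq: "complex_of_real ((cmod z)\<^sup>2) = z * cnj z" for z by (metis complex_norm_square)
  have L2sq: "complex_of_real ((torus_L2 X)\<^sup>2) = torus_mean (\<lambda>\<theta>. X \<theta> * cnj (X \<theta>))" if "torus_cont X" for X :: "real ^ 'a \<Rightarrow> complex"
    unfolding torus_L2_power2 torus_mean_of_real[OF torus_cont_power[OF torus_cont_norm[OF that]], symmetric]
    by (simp only: sq)
  have "(\<lambda>\<theta>. P \<theta> * cnj (F \<theta>)) = (\<lambda>\<theta>. cnj (F \<theta> * cnj (P \<theta>)))" by (auto simp: mult.commute)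
  then have cn: "torus_mean (\<lambda>\<theta>. P \<theta> * cnj (F \<theta>)) = cnj (torus_mean (\<lambda>\<theta>. F \<theta> * cnj (P \<theta>)))"
    unfolding torus_mean_def by (simp only: Bochner_Integration.integral_cnj)
  have "complex_of_real ((torus_L2 (\<lambda>\<theta>. F \<theta> - P \<theta>))\<^sup>2) = torus_mean (\<lambda>\<theta>. (F \<theta> - P \<theta>) * cnj (F \<theta> - P \<theta>))"
    by (intro L2sq torus_cont_diff F P)
  also have "\<dots> = torus_mean (\<lambda>\<theta>. (F \<theta> * cnj (F \<theta>) - F \<theta> * cnj (P \<theta>)) - (P \<theta> * cnj (F \<theta>) - P \<theta> * cnj (P \<theta>)))"
    by (simp add: algebra_simps)
  also have "\<dots> = (torus_mean (\<lambda>\<theta>. F \<theta> * cnj (F \<theta>)) - torus_mean (\<lambda>\<theta>. F \<theta> * cnj (P \<theta>)))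
      - (torus_mean (\<lambda>\<theta>. P \<theta> * cnj (F \<theta>)) - torus_mean (\<lambda>\<theta>. P \<theta> * cnj (P \<theta>)))"
    by (simp add: torus_mean_diff torus_cont_intros F P)
  also have "torus_mean (\<lambda>\<theta>. F \<theta> * cnj (F \<theta>)) = complex_of_real ((torus_L2 F)\<^sup>2)"
    by (rule L2sq[OF F, symmetric])
  also have "torus_mean (\<lambda>\<theta>. P \<theta> * cnj (P \<theta>)) = (\<Sum>k\<in>K. cnj (c k) * c k)"
    unfolding ip[OF P] unfolding P_def[abs_def] by (intro sum.cong) (auto simp: fourier_coeff_trig_sum K)
  also have "complex_of_real ((torus_L2 F)\<^sup>2) - torus_mean (\<lambda>\<theta>. F \<theta> * cnj (P \<theta>))
      - (torus_mean (\<lambda>\<theta>. P \<theta> * cnj (F \<theta>)) - (\<Sum>k\<in>K. cnj (c k) * c k))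
    = complex_of_real ((torus_L2 F)\<^sup>2) - (\<Sum>k\<in>K. ?F k * cnj (?F k)) + (\<Sum>k\<in>K. (?F k - c k) * cnj (?F k - c k))"
    unfolding cn ip[OF F] by (simp add: algebra_simps sum.distrib sum_subtractf)
  finally show ?thesis
    unfolding P_def sq[symmetric] of_real_sum[symmetric] of_real_diff[symmetric] of_real_add[symmetric] of_real_eq_iff .
qed

lemma torus_L2_trig_sum:
  assumes "finite K"
  shows "torus_L2 (\<lambda>\<theta>. \<Sum>k\<in>K. c k * character k \<theta>) = L2_set (\<lambda>k. cmod (c k)) K"
proof -
  have fc0: "fourier_coeff (\<lambda>_. 0) k = 0" for k :: "int ^ 'a" by (simp add: fourier_coeff_const)
  have L0: "torus_L2 (\<lambda>_ :: real ^ 'a. 0) = 0" by (simp add: torus_L2_def)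
  have "(torus_L2 (\<lambda>\<theta>. 0 - (\<Sum>k\<in>K. c k * character k \<theta>)))\<^sup>2 = (\<Sum>k\<in>K. (cmod (c k))\<^sup>2)"
    unfolding torus_L2_diff_trig_sum[OF torus_cont_const assms] by (simp add: fc0 L0)
  also have "torus_L2 (\<lambda>\<theta>. 0 - (\<Sum>k\<in>K. c k * character k \<theta>)) = torus_L2 (\<lambda>\<theta>. \<Sum>k\<in>K. c k * character k \<theta>)"
    unfolding torus_L2_def by simp
  finally show ?thesis unfolding L2_set_def by (intro real_sqrt_unique[symmetric]) auto
qed

lemma bessel:
  assumes F: "torus_cont F"
  shows "L2_set (\<lambda>k. cmod (fourier_coeff F k)) K \<le> torus_L2 F"
proof (cases "finite K")
  case True
  have "0 \<le> (torus_L2 (\<lambda>\<theta>. F \<theta> - (\<Sum>k\<in>K. fourier_coeff F k * character k \<theta>)))\<^sup>2" by simp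
  then have "(\<Sum>k\<in>K. (cmod (fourier_coeff F k))\<^sup>2) \<le> (torus_L2 F)\<^sup>2"
    unfolding torus_L2_diff_trig_sum[OF F True] by simp
  then show ?thesis unfolding L2_set_def by (intro real_le_lsqrt) (auto intro: sum_nonneg)
qed (simp add: L2_set_def)

lemma fourier_coeff_ell2: "torus_cont F \<Longrightarrow> fourier_coeff F \<in> ell2"
  by (rule ell2_boundI(1)[OF bessel])

theorem parseval:
  assumes F: "torus_cont F"
  shows "ell2_norm (fourier_coeff F) = torus_L2 F"
proof (rule antisym)
  show "ell2_norm (fourier_coeff F) \<le> torus_L2 F" by (rule ell2_boundI(2)[OF bessel[OF F]])
  have "(torus_L2 F)\<^sup>2 \<le> (ell2_norm (fourier_coeff F))\<^sup>2 + \<epsilon>" if "\<epsilon> > 0" for \<epsilon>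
  proof -
    have "sqrt \<epsilon> > 0" using that by simp
    then obtain p where p: "trig_poly p" "\<And>\<theta>. cmod (F \<theta> - p \<theta>) < sqrt \<epsilon>"
      using trig_poly_dense[OF F] by blast
    obtain K c where K: "finite K" "p = (\<lambda>\<theta>. \<Sum>k\<in>K. c k * character k \<theta>)"
      using trig_poly_expansion[OF p(1)] by blast
    have "torus_L2 (\<lambda>\<theta>. F \<theta> - p \<theta>) \<le> sqrt \<epsilon>"
      by (intro torus_L2_le_const torus_cont_diff F trig_poly_torus_cont[OF p(1)] less_imp_le[OF p(2)])
         (use that in simp)
    then have "(torus_L2 (\<lambda>\<theta>. F \<theta> - p \<theta>))\<^sup>2 \<le> \<epsilon>"
      using that power_mono[of _ "sqrt \<epsilon>" 2] by fastforce
    moreover have "0 \<le> (\<Sum>k\<in>K. (cmod (fourier_coeff F k - c k))\<^sup>2)" by (intro sum_nonneg) auto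
    ultimately have "(torus_L2 F)\<^sup>2 \<le> (\<Sum>k\<in>K. (cmod (fourier_coeff F k))\<^sup>2) + \<epsilon>"
      unfolding K(2) torus_L2_diff_trig_sum[OF F K(1)] by linarith
    also have "(\<Sum>k\<in>K. (cmod (fourier_coeff F k))\<^sup>2) \<le> (ell2_norm (fourier_coeff F))\<^sup>2"
      using ell2_L2_set_le[OF fourier_coeff_ell2[OF F], of K] unfolding L2_set_def
      by (intro sqrt_le_D) auto
    finally show ?thesis by simp
  qed
  then have "(torus_L2 F)\<^sup>2 \<le> (ell2_norm (fourier_coeff F))\<^sup>2" by (rule field_le_epsilon)
  then show "torus_L2 F \<le> ell2_norm (fourier_coeff F)" by (rule power2_le_imp_le) simp
qed

lemma torus_L2_triangle:
  assumes "torus_cont f" "torus_cont g"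
  shows "torus_L2 (\<lambda>\<theta>. f \<theta> + g \<theta>) \<le> torus_L2 f + torus_L2 g"
proof -
  have "fourier_coeff (\<lambda>\<theta>. f \<theta> + g \<theta>) = (\<lambda>k. fourier_coeff f k + fourier_coeff g k)"
    using assms by (auto simp: fourier_coeff_add)
  then show ?thesis
    using ell2_add(2)[OF fourier_coeff_ell2[OF assms(1)] fourier_coeff_ell2[OF assms(2)]]
    by (metis parseval assms torus_cont_add)
qed

section \<open>Multiplication operators in Fourier space\<close>

text \<open>Convolution with the Fourier coefficients of \<open>f\<close>, the Fourier picture of multiplication by \<open>f\<close>.\<close>

definition mult_op :: "(real ^ 'd \<Rightarrow> complex) \<Rightarrow> (int ^ 'd \<Rightarrow> complex) \<Rightarrow> int ^ 'd \<Rightarrow> complex" where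
  "mult_op f u n = (\<Sum>\<^sub>\<infinity>k. fourier_coeff f k * u (n - k))"

text \<open>The Fourier picture of the translation \<open>F \<mapsto> F \<circ> T\<close> (see \<open>modulate_fourier_coeff\<close>).\<close>

definition modulate :: "real ^ 'd \<Rightarrow> (int ^ 'd \<Rightarrow> complex) \<Rightarrow> int ^ 'd \<Rightarrow> complex" where
  "modulate \<alpha> u n = character n \<alpha> * u n"

lemma H_op_eq: "H_op V \<alpha> lam \<omega> u n = mult_op V u n + lam * cis (2 * pi * \<omega>) * modulate \<alpha> u n"
  by (simp add: H_op_def mult_op_def modulate_def character_def ring_distribs cis_mult mult.assoc flip: cis_mult)

lemma ell2_reflect:
  fixes u :: "int ^ 'd \<Rightarrow> complex"
  assumes "u \<in> ell2"
  shows "(\<lambda>k. u (n - k)) \<in> ell2" "ell2_norm (\<lambda>k. u (n - k)) = ell2_norm u"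
proof -
  have bij: "bij_betw (\<lambda>k. n - k) UNIV (UNIV :: (int ^ 'd) set)"
    by (rule bij_betwI[of _ _ _ "\<lambda>k. n - k"]) auto
  show "(\<lambda>k. u (n - k)) \<in> ell2"
    using assms summable_on_reindex_bij_betw[OF bij, of "\<lambda>k. (cmod (u k))\<^sup>2"] by (simp add: ell2_def)
  show "ell2_norm (\<lambda>k. u (n - k)) = ell2_norm u"
    using infsum_reindex_bij_betw[OF bij, of "\<lambda>k. (cmod (u k))\<^sup>2"] by (simp add: ell2_norm_def)
qed

lemma ell2_cauchy_schwarz:
  assumes "b \<in> ell2" "u \<in> ell2"
  shows "(\<lambda>k. norm (b k * u k)) summable_on UNIV" "cmod (\<Sum>\<^sub>\<infinity>k. b k * u k) \<le> ell2_norm b * ell2_norm u"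
proof -
  have le: "(\<Sum>k\<in>J. norm (b k * u k)) \<le> ell2_norm b * ell2_norm u" if "finite J" for J
  proof -
    have "(\<Sum>k\<in>J. norm (b k * u k)) = (\<Sum>k\<in>J. \<bar>cmod (b k)\<bar> * \<bar>cmod (u k)\<bar>)" by (simp add: norm_mult)
    also have "\<dots> \<le> L2_set (\<lambda>k. cmod (b k)) J * L2_set (\<lambda>k. cmod (u k)) J" by (rule L2_set_mult_ineq)
    also have "\<dots> \<le> ell2_norm b * ell2_norm u"
      by (intro mult_mono ell2_L2_set_le assms) auto
    finally show ?thesis .
  qed
  show *: "(\<lambda>k. norm (b k * u k)) summable_on UNIV"
    using le by (intro nonneg_bdd_above_summable_on bdd_aboveI[of _ "ell2_norm b * ell2_norm u"]) auto
  have "cmod (\<Sum>\<^sub>\<infinity>k. b k * u k) \<le> (\<Sum>\<^sub>\<infinity>k. norm (b k * u k))" by (rule norm_infsum_bound[OF *])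
  also have "\<dots> \<le> ell2_norm b * ell2_norm u" using le * by (intro infsum_le_finite_sums) auto
  finally show "cmod (\<Sum>\<^sub>\<infinity>k. b k * u k) \<le> ell2_norm b * ell2_norm u" .
qed

lemma mult_op_summable:
  assumes "torus_cont f" "u \<in> ell2"
  shows "(\<lambda>k. fourier_coeff f k * u (n - k)) summable_on UNIV"
  using ell2_cauchy_schwarz(1)[OF fourier_coeff_ell2[OF assms(1)] ell2_reflect(1)[OF assms(2)]]
  by (rule abs_summable_summable)

lemma mult_op_coordinate_bound:
  assumes "torus_cont f" "u \<in> ell2"
  shows "cmod (mult_op f u n) \<le> torus_L2 f * ell2_norm u"
  using ell2_cauchy_schwarz(2)[OF fourier_coeff_ell2[OF assms(1)] ell2_reflect(1)[OF assms(2), of n]]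
  by (simp add: mult_op_def parseval[OF assms(1)] ell2_reflect(2)[OF assms(2)])

lemma mult_op_add:
  assumes "torus_cont f" "u \<in> ell2" "v \<in> ell2"
  shows "mult_op f (\<lambda>n. u n + v n) n = mult_op f u n + mult_op f v n"
  unfolding mult_op_def using assms
  by (subst infsum_add[symmetric]) (auto intro: mult_op_summable simp: ring_distribs)

lemma mult_op_cmult: "mult_op f (\<lambda>n. c * u n) n = c * mult_op f u n"
  unfolding mult_op_def by (subst infsum_cmult_right'[symmetric]) (simp add: mult_ac)

lemma mult_op_diff:
  assumes "torus_cont f" "u \<in> ell2" "v \<in> ell2"
  shows "mult_op f (\<lambda>n. u n - v n) n = mult_op f u n - mult_op f v n"
  using mult_op_add[OF assms(1,2) ell2_cmult(1)[OF assms(3), of "-1"]] mult_op_cmult[of f "-1" v] by simp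

lemma mult_op_add_fun:
  assumes "torus_cont f" "torus_cont g" "u \<in> ell2"
  shows "mult_op (\<lambda>\<theta>. f \<theta> + g \<theta>) u n = mult_op f u n + mult_op g u n"
  unfolding mult_op_def fourier_coeff_add[OF assms(1,2)] using assms
  by (subst infsum_add[symmetric]) (auto intro: mult_op_summable simp: ring_distribs)

lemma mult_op_cmult_fun: "mult_op (\<lambda>\<theta>. c * f \<theta>) u n = c * mult_op f u n"
  unfolding mult_op_def fourier_coeff_cmult
  by (subst infsum_cmult_right'[symmetric]) (simp add: mult_ac)

lemma mult_op_const: "mult_op (\<lambda>_. c) u n = c * u n"
proof -
  have "mult_op (\<lambda>_. c) u n = (\<Sum>\<^sub>\<infinity>k\<in>{0}. c * u (n - k))"
    unfolding mult_op_def by (rule infsum_cong_neutral) (auto simp: fourier_coeff_const)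
  then show ?thesis by simp
qed

text \<open>On finitely supported sequences the operator acts on trigonometric polynomials, so that it is
multiplication by \<open>f\<close> literally.\<close>

lemma mult_op_finite_support:
  assumes f: "torus_cont f" and K: "finite K" "\<And>n. n \<notin> K \<Longrightarrow> u n = 0"
  shows "mult_op f u = fourier_coeff (\<lambda>\<theta>. f \<theta> * (\<Sum>m\<in>K. u m * character m \<theta>))"
proof
  fix n
  have "mult_op f u n = (\<Sum>\<^sub>\<infinity>k\<in>(\<lambda>m. n - m) ` K. fourier_coeff f k * u (n - k))"
    unfolding mult_op_def
  proof (rule infsum_cong_neutral)
    fix k assume k: "k \<in> UNIV - (\<lambda>m. n - m) ` K"
    have "n - k \<notin> K"
    proof
      assume "n - k \<in> K"
      then have "n - (n - k) \<in> (\<lambda>m. n - m) ` K" by blast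
      then show False using k by simp
    qed
    then show "fourier_coeff f k * u (n - k) = 0" using K(2) by simp
  qed auto
  also have "\<dots> = (\<Sum>m\<in>K. fourier_coeff f (n - m) * u m)"
    using K(1) by (simp add: sum.reindex inj_on_def)
  also have "\<dots> = (\<Sum>m\<in>K. fourier_coeff (\<lambda>\<theta>. u m * (f \<theta> * character m \<theta>)) n)"
    unfolding fourier_coeff_cmult fourier_coeff_mult_character by (simp add: mult.commute)
  also have "\<dots> = fourier_coeff (\<lambda>\<theta>. \<Sum>m\<in>K. u m * (f \<theta> * character m \<theta>)) n"
    by (rule fourier_coeff_sum[symmetric]) (intro torus_cont_intros f torus_cont_character)
  also have "(\<lambda>\<theta>. \<Sum>m\<in>K. u m * (f \<theta> * character m \<theta>)) = (\<lambda>\<theta>. f \<theta> * (\<Sum>m\<in>K. u m * character m \<theta>))"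
    by (auto simp: sum_distrib_left mult_ac)
  finally show "mult_op f u n = fourier_coeff (\<lambda>\<theta>. f \<theta> * (\<Sum>m\<in>K. u m * character m \<theta>)) n" .
qed

lemma mult_op_bound_finite_support:
  assumes f: "torus_cont f" and B: "0 \<le> B" "\<And>\<theta>. cmod (f \<theta>) \<le> B" and K: "finite K" "\<And>n. n \<notin> K \<Longrightarrow> u n = 0"
  shows "L2_set (\<lambda>n. cmod (mult_op f u n)) J \<le> B * ell2_norm u"
proof -
  let ?U = "\<lambda>\<theta>. \<Sum>m\<in>K. u m * character m \<theta>"
  have U: "torus_cont ?U" by (intro torus_cont_intros torus_cont_character)
  have eq: "mult_op f u = fourier_coeff (\<lambda>\<theta>. f \<theta> * ?U \<theta>)"
    by (rule mult_op_finite_support[OF f K(1)]) (rule K(2))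
  have "L2_set (\<lambda>n. cmod (mult_op f u n)) J \<le> torus_L2 (\<lambda>\<theta>. f \<theta> * ?U \<theta>)"
    unfolding eq by (intro bessel torus_cont_mult f U)
  also have "\<dots> \<le> B * torus_L2 ?U"
    using B by (intro torus_L2_mono torus_cont_mult f U) (auto simp: norm_mult intro: mult_right_mono)
  also have "torus_L2 ?U \<le> ell2_norm u"
    unfolding torus_L2_trig_sum[OF K(1)] by (rule ell2_L2_set_le[OF ell2_finite_support[OF K(1)]]) (rule K(2))
  finally show ?thesis using B(1) by (simp add: mult_left_mono)
qed

text \<open>The operator norm is at most the supremum norm of the symbol. For finite support this is the
inequality of Bessel for the product of \<open>f\<close> with a trigonometric polynomial. In general the tail of \<open>u\<close>
contributes little to each single coordinate, by the Cauchy-Schwarz inequality, and hence little to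
each finite set of coordinates.\<close>

theorem mult_op_bound:
  assumes f: "torus_cont f" and B: "0 \<le> B" "\<And>\<theta>. cmod (f \<theta>) \<le> B" and u: "u \<in> ell2"
  shows "mult_op f u \<in> ell2" "ell2_norm (mult_op f u) \<le> B * ell2_norm u"
proof -
  have bnd: "L2_set (\<lambda>n. cmod (mult_op f u n)) J \<le> B * ell2_norm u" if J: "finite J" for J
  proof (rule field_le_epsilon)
    fix e :: real assume "e > 0"
    define \<epsilon> where "\<epsilon> = e / (card J * torus_L2 f + 1)"
    have den: "card J * torus_L2 f + 1 > 0" by (intro add_nonneg_pos mult_nonneg_nonneg) auto
    then have "\<epsilon> > 0" using \<open>e > 0\<close> by (simp add: \<epsilon>_def)
    then obtain S where S: "finite S" "ell2_norm (\<lambda>n. if n \<in> S then 0 else u n) \<le> \<epsilon>"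
      using ell2_small_tail[OF u] by blast
    let ?v = "\<lambda>n. if n \<in> S then u n else 0" and ?w = "\<lambda>n. if n \<in> S then 0 else u n"
    have v: "?v \<in> ell2" "ell2_norm ?v \<le> ell2_norm u" using ell2_restrict[OF u] by auto
    have w: "?w \<in> ell2" by (rule ell2_restrict_compl[OF u])
    have uvw: "(\<lambda>n. ?v n + ?w n) = u" by auto
    have eq: "mult_op f u n = mult_op f ?v n + mult_op f ?w n" for n
      using mult_op_add[OF f v(1) w, of n] unfolding uvw .
    have "L2_set (\<lambda>n. cmod (mult_op f u n)) J \<le> L2_set (\<lambda>n. cmod (mult_op f ?v n) + cmod (mult_op f ?w n)) J"
      unfolding eq by (intro L2_set_mono norm_triangle_ineq) auto
    also have "\<dots> \<le> L2_set (\<lambda>n. cmod (mult_op f ?v n)) J + L2_set (\<lambda>n. cmod (mult_op f ?w n)) J"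
      by (rule L2_set_triangle_ineq)
    also have "L2_set (\<lambda>n. cmod (mult_op f ?v n)) J \<le> B * ell2_norm ?v"
      by (rule mult_op_bound_finite_support[OF f B S(1)]) auto
    also have "\<dots> \<le> B * ell2_norm u" using v(2) B(1) by (rule mult_left_mono)
    also have "L2_set (\<lambda>n. cmod (mult_op f ?w n)) J \<le> (\<Sum>n\<in>J. cmod (mult_op f ?w n))"
      by (rule L2_set_le_sum) auto
    also have "\<dots> \<le> (\<Sum>n\<in>J. torus_L2 f * \<epsilon>)"
      by (intro sum_mono order_trans[OF mult_op_coordinate_bound[OF f w]] mult_left_mono S(2) torus_L2_nonneg)
    also have "\<dots> \<le> e" 
    proof -
      have "card J * torus_L2 f \<le> card J * torus_L2 f + 1" by simp
      then have "(card J * torus_L2 f) / (card J * torus_L2 f + 1) * e \<le> 1 * e"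
        using den \<open>e > 0\<close> by (intro mult_right_mono) auto
      then show ?thesis by (simp add: \<epsilon>_def)
    qed
    finally show "L2_set (\<lambda>n. cmod (mult_op f u n)) J \<le> B * ell2_norm u + e" by simp
  qed
  show "mult_op f u \<in> ell2" by (rule ell2_boundI(1)[OF bnd])
  show "ell2_norm (mult_op f u) \<le> B * ell2_norm u" by (rule ell2_boundI(2)[OF bnd])
qed

lemma mult_op_coordinate_le:
  assumes "torus_cont f" "0 < B" "\<And>\<theta>. cmod (f \<theta>) \<le> B" "u \<in> ell2"
  shows "cmod (mult_op f u n) \<le> B * ell2_norm u"
  using ell2_coordinate_le[OF mult_op_bound(1)[OF assms(1) less_imp_le[OF assms(2)] assms(3,4)], of n]
    mult_op_bound(2)[OF assms(1) less_imp_le[OF assms(2)] assms(3,4)] by (rule order_trans)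

lemma mult_op_ell2:
  assumes "torus_cont f" "u \<in> ell2"
  shows "mult_op f u \<in> ell2"
proof -
  obtain B where B: "B > 0" "\<And>\<theta>. cmod (f \<theta>) \<le> B" using torus_cont_bounded[OF assms(1)] by blast
  show ?thesis by (rule mult_op_bound(1)[OF assms(1) less_imp_le[OF B(1)] B(2) assms(2)])
qed

text \<open>The two sides agree for trigonometric polynomials \<open>F\<close>, and both depend continuously on \<open>F\<close> in the
\<open>L\<^sup>2\<close> norm.\<close>

theorem mult_op_fourier_coeff:
  assumes b: "torus_cont b" and F: "torus_cont F"
  shows "mult_op b (fourier_coeff F) = fourier_coeff (\<lambda>\<theta>. b \<theta> * F \<theta>)"
proof
  fix n
  obtain B where B: "B > 0" "\<And>\<theta>. cmod (b \<theta>) \<le> B" using torus_cont_bounded[OF b] by blast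
  have "cmod (mult_op b (fourier_coeff F) n - fourier_coeff (\<lambda>\<theta>. b \<theta> * F \<theta>) n) \<le> 0 + e" if "e > 0" for e
  proof -
    define \<epsilon> where "\<epsilon> = e / (2 * B)"
    have "\<epsilon> > 0" using that B(1) by (simp add: \<epsilon>_def)
    then obtain p where p: "trig_poly p" "\<And>\<theta>. cmod (F \<theta> - p \<theta>) < \<epsilon>"
      using trig_poly_dense[OF F] by blast
    note pc = trig_poly_torus_cont[OF p(1)]
    obtain K c where K: "finite K" "p = (\<lambda>\<theta>. \<Sum>k\<in>K. c k * character k \<theta>)"
      using trig_poly_expansion[OF p(1)] by blast
    have pk: "fourier_coeff p k = (if k \<in> K then c k else 0)" for k
      unfolding K(2) by (rule fourier_coeff_trig_sum[OF K(1)])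
    have eqp: "mult_op b (fourier_coeff p) = fourier_coeff (\<lambda>\<theta>. b \<theta> * p \<theta>)"
    proof -
      have pp: "(\<Sum>m\<in>K. fourier_coeff p m * character m \<theta>) = p \<theta>" for \<theta>
      proof -
        have "(\<Sum>m\<in>K. fourier_coeff p m * character m \<theta>) = (\<Sum>m\<in>K. c m * character m \<theta>)"
          by (intro sum.cong) (simp_all add: pk)
        then show ?thesis by (simp only: K(2))
      qed
      have "mult_op b (fourier_coeff p) = fourier_coeff (\<lambda>\<theta>. b \<theta> * (\<Sum>m\<in>K. fourier_coeff p m * character m \<theta>))"
        by (rule mult_op_finite_support[OF b K(1)]) (simp add: pk)
      then show ?thesis unfolding pp .
    qed
    let ?D = "\<lambda>\<theta>. F \<theta> - p \<theta>"
    have D: "torus_cont ?D" by (intro torus_cont_intros F pc)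
    have L: "torus_L2 ?D \<le> \<epsilon>" using \<open>\<epsilon> > 0\<close> by (intro torus_L2_le_const D less_imp_le[OF p(2)]) simp
    have fd: "fourier_coeff ?D = (\<lambda>k. fourier_coeff F k - fourier_coeff p k)"
      by (auto simp: fourier_coeff_diff F pc)
    have "mult_op b (fourier_coeff F) n - fourier_coeff (\<lambda>\<theta>. b \<theta> * F \<theta>) n
        = mult_op b (fourier_coeff ?D) n - fourier_coeff (\<lambda>\<theta>. b \<theta> * ?D \<theta>) n"
      unfolding fd using mult_op_diff[OF b fourier_coeff_ell2[OF F] fourier_coeff_ell2[OF pc], of n] eqp
        fourier_coeff_diff[of "\<lambda>\<theta>. b \<theta> * F \<theta>" "\<lambda>\<theta>. b \<theta> * p \<theta>" n]
      by (simp add: right_diff_distrib torus_cont_mult b F pc)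
    also have "cmod \<dots> \<le> cmod (mult_op b (fourier_coeff ?D) n) + cmod (fourier_coeff (\<lambda>\<theta>. b \<theta> * ?D \<theta>) n)"
      by (rule norm_triangle_ineq4)
    also have "cmod (mult_op b (fourier_coeff ?D) n) \<le> B * ell2_norm (fourier_coeff ?D)"
      by (rule mult_op_coordinate_le[OF b B fourier_coeff_ell2[OF D]])
    also have "cmod (fourier_coeff (\<lambda>\<theta>. b \<theta> * ?D \<theta>) n) \<le> torus_L2 (\<lambda>\<theta>. b \<theta> * ?D \<theta>)"
      using ell2_coordinate_le[OF fourier_coeff_ell2[OF torus_cont_mult[OF b D]], of n]
      unfolding parseval[OF torus_cont_mult[OF b D]] .
    also have "\<dots> \<le> B * torus_L2 ?D"
      using B by (intro torus_L2_mono torus_cont_mult b D) (auto simp: norm_mult intro: mult_right_mono)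
    also have "B * ell2_norm (fourier_coeff ?D) + B * torus_L2 ?D \<le> B * \<epsilon> + B * \<epsilon>"
      unfolding parseval[OF D] using L B(1) by (intro add_mono mult_left_mono) auto
    also have "\<dots> = e" using B(1) by (simp add: \<epsilon>_def)
    finally show ?thesis by simp
  qed
  then have "cmod (mult_op b (fourier_coeff F) n - fourier_coeff (\<lambda>\<theta>. b \<theta> * F \<theta>) n) \<le> 0"
    by (rule field_le_epsilon)
  then show "mult_op b (fourier_coeff F) n = fourier_coeff (\<lambda>\<theta>. b \<theta> * F \<theta>) n" by simp
qed

text \<open>Approximation of \<open>u\<close> by finitely supported sequences, for which \<open>mult_op c u\<close> is the
sequence of Fourier coefficients of a continuous function.\<close>

theorem mult_op_mult_op:
  assumes b: "torus_cont b" and c: "torus_cont c" and u: "u \<in> ell2"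
  shows "mult_op b (mult_op c u) = mult_op (\<lambda>\<theta>. b \<theta> * c \<theta>) u"
proof
  fix n
  obtain B where B: "B > 0" "\<And>\<theta>. cmod (b \<theta>) \<le> B" using torus_cont_bounded[OF b] by blast
  obtain C where C: "C > 0" "\<And>\<theta>. cmod (c \<theta>) \<le> C" using torus_cont_bounded[OF c] by blast
  have bc: "torus_cont (\<lambda>\<theta>. b \<theta> * c \<theta>)" by (intro torus_cont_mult b c)
  have "cmod (mult_op b (mult_op c u) n - mult_op (\<lambda>\<theta>. b \<theta> * c \<theta>) u n) \<le> 0 + e" if "e > 0" for e
  proof -
    define \<epsilon> where "\<epsilon> = e / (2 * B * C)"
    have "\<epsilon> > 0" using that B(1) C(1) by (simp add: \<epsilon>_def)
    then obtain S where S: "finite S" "ell2_norm (\<lambda>n. if n \<in> S then 0 else u n) \<le> \<epsilon>"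
      using ell2_small_tail[OF u] by blast
    let ?v = "\<lambda>n. if n \<in> S then u n else 0" and ?w = "\<lambda>n. if n \<in> S then 0 else u n"
    have v: "?v \<in> ell2" using ell2_restrict(1)[OF u] by auto
    have w: "?w \<in> ell2" by (rule ell2_restrict_compl[OF u])
    have uvw: "(\<lambda>n. ?v n + ?w n) = u" by auto
    have split: "mult_op f u n = mult_op f ?v n + mult_op f ?w n" if "torus_cont f" for f n
      using mult_op_add[OF that v w, of n] unfolding uvw .
    have cu: "mult_op c u = (\<lambda>n. mult_op c ?v n + mult_op c ?w n)" using split[OF c] by auto
    have fin: "mult_op b (mult_op c ?v) = mult_op (\<lambda>\<theta>. b \<theta> * c \<theta>) ?v"
    proof -
      have "mult_op c ?v = fourier_coeff (\<lambda>\<theta>. c \<theta> * (\<Sum>m\<in>S. ?v m * character m \<theta>))"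
        by (rule mult_op_finite_support[OF c S(1)]) auto
      moreover have "mult_op (\<lambda>\<theta>. b \<theta> * c \<theta>) ?v = fourier_coeff (\<lambda>\<theta>. b \<theta> * c \<theta> * (\<Sum>m\<in>S. ?v m * character m \<theta>))"
        by (rule mult_op_finite_support[OF bc S(1)]) auto
      moreover have "torus_cont (\<lambda>\<theta>. c \<theta> * (\<Sum>m\<in>S. ?v m * character m \<theta>))"
        by (intro torus_cont_intros c torus_cont_character)
      ultimately show ?thesis by (simp add: mult_op_fourier_coeff b mult.assoc)
    qed
    have "mult_op b (mult_op c u) n - mult_op (\<lambda>\<theta>. b \<theta> * c \<theta>) u n
        = mult_op b (mult_op c ?w) n - mult_op (\<lambda>\<theta>. b \<theta> * c \<theta>) ?w n"
      unfolding cu mult_op_add[OF b mult_op_ell2[OF c v] mult_op_ell2[OF c w]] split[OF bc, of n] fin by simp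
    also have "cmod \<dots> \<le> cmod (mult_op b (mult_op c ?w) n) + cmod (mult_op (\<lambda>\<theta>. b \<theta> * c \<theta>) ?w n)"
      by (rule norm_triangle_ineq4)
    also have "cmod (mult_op b (mult_op c ?w) n) \<le> B * ell2_norm (mult_op c ?w)"
      by (rule mult_op_coordinate_le[OF b B mult_op_ell2[OF c w]])
    also have "\<dots> \<le> B * (C * ell2_norm ?w)"
      using mult_op_bound(2)[OF c less_imp_le[OF C(1)] C(2) w] B(1) by (intro mult_left_mono) auto
    also have "cmod (mult_op (\<lambda>\<theta>. b \<theta> * c \<theta>) ?w n) \<le> (B * C) * ell2_norm ?w"
    proof -
      have le: "cmod (b \<theta> * c \<theta>) \<le> B * C" for \<theta>
        unfolding norm_mult using B C(2)[of \<theta>] by (intro mult_mono) (auto simp: less_imp_le)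
      show ?thesis
        by (rule mult_op_coordinate_le[OF bc mult_pos_pos[OF B(1) C(1)] le w])
    qed
    also have "B * (C * ell2_norm ?w) + (B * C) * ell2_norm ?w \<le> B * (C * \<epsilon>) + B * C * \<epsilon>"
      using S(2) B(1) C(1) by (intro add_mono mult_left_mono) auto
    also have "\<dots> = e" using B(1) C(1) by (simp add: \<epsilon>_def)
    finally show ?thesis by simp
  qed
  then have "cmod (mult_op b (mult_op c u) n - mult_op (\<lambda>\<theta>. b \<theta> * c \<theta>) u n) \<le> 0"
    by (rule field_le_epsilon)
  then show "mult_op b (mult_op c u) n = mult_op (\<lambda>\<theta>. b \<theta> * c \<theta>) u n" by simp
qed

lemma modulate_ell2:
  "modulate \<alpha> u \<in> ell2 \<longleftrightarrow> u \<in> ell2" "ell2_norm (modulate \<alpha> u) = ell2_norm u"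
  by (rule ell2_norm_cong_cmod, simp add: modulate_def norm_mult)+

lemma modulate_mult_op:
  assumes f: "torus_cont f"
  shows "modulate \<alpha> (mult_op f u) = mult_op (\<lambda>\<theta>. f (\<theta> + \<alpha>)) (modulate \<alpha> u)"
proof
  fix n
  have eq: "character k \<alpha> * fourier_coeff f k * (character (n - k) \<alpha> * u (n - k))
      = character n \<alpha> * (fourier_coeff f k * u (n - k))" for k
    using character_add[of k "n - k" \<alpha>] by (simp add: mult_ac)
  show "modulate \<alpha> (mult_op f u) n = mult_op (\<lambda>\<theta>. f (\<theta> + \<alpha>)) (modulate \<alpha> u) n"
    unfolding modulate_def mult_op_def fourier_coeff_translate[OF f] eq by (rule infsum_cmult_right'[symmetric])
qed

lemma modulate_fourier_coeff:
  "torus_cont F \<Longrightarrow> modulate \<alpha> (fourier_coeff F) = fourier_coeff (\<lambda>\<theta>. F (\<theta> + \<alpha>))"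
  by (auto simp: modulate_def fourier_coeff_translate)

section \<open>The cohomological equation over an irrational translation\<close>

text \<open>No resonances: the denominators in the solution of the cohomological equation do not vanish.\<close>

lemma rationally_independent_character:
  assumes "rationally_independent \<alpha>" "k \<noteq> 0"
  shows "character k \<alpha> \<noteq> 1"
proof
  assume "character k \<alpha> = 1"
  then have "cos (2 * pi * (real_vec k \<bullet> \<alpha>)) = 1"
    by (simp add: character_def complex_eq_iff)
  then obtain m :: int where "2 * pi * (real_vec k \<bullet> \<alpha>) = of_int m * 2 * pi"
    unfolding cos_one_2pi_int by blast
  then have m: "real_vec k \<bullet> \<alpha> = of_int m"
    by simp
  have "of_rat (of_int (- m)) * 1 + (\<Sum>i\<in>UNIV. of_rat ((\<chi> i. of_int (k $ i)) $ i) * \<alpha> $ i) = 0"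
    using m by (simp add: inner_vec_def real_vec_def of_rat_minus)
  then have "\<forall>i. (\<chi> i. rat_of_int (k $ i)) $ i = 0"
    using assms(1) unfolding rationally_independent_def by blast
  then have "k = 0" by (simp add: vec_eq_iff)
  with assms(2) show False by simp
qed

lemma rationally_independent_irrational:
  fixes \<alpha> :: "real ^ 'd"
  assumes "rationally_independent \<alpha>"
  shows "\<alpha> $ i \<notin> \<rat>"
proof
  assume "\<alpha> $ i \<in> \<rat>"
  then obtain r where r: "\<alpha> $ i = of_rat r" by (auto simp: Rats_def)
  have "of_rat (- r) * 1 + (\<Sum>j\<in>UNIV. of_rat ((axis i 1 :: rat ^ 'd) $ j) * \<alpha> $ j) = 0"
    by (simp add: axis_def if_distrib if_distribR r of_rat_minus cong: if_cong)
  then have "\<forall>j. (axis i 1 :: rat ^ 'd) $ j = 0"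
    using assms unfolding rationally_independent_def by blast
  then show False by (metis axis_nth zero_neq_one)
qed

text \<open>Already the multiples of a single coordinate of \<open>\<alpha>\<close> are dense modulo one, by the theorem of Kronecker.\<close>

lemma characters_dense_on_circle:
  assumes "rationally_independent \<alpha>" "cmod \<zeta> = 1" "\<epsilon> > 0"
  shows "\<exists>k. cmod (character k \<alpha> - \<zeta>) < \<epsilon>"
proof -
  obtain i :: 'a where True by simp
  obtain t where t: "\<zeta> = cis t"
    using assms(2) by (metis complex_norm_eq_1_exp cis_conv_exp mult.commute)
  define s where "s = t / (2 * pi)"
  have "isCont (\<lambda>x. cis (2 * pi * x)) s"
    unfolding cis_conv_exp by (intro continuous_intros)
  then obtain \<delta> where \<delta>: "\<delta> > 0" "\<And>x. \<bar>x - s\<bar> < \<delta> \<Longrightarrow> cmod (cis (2 * pi * x) - cis (2 * pi * s)) < \<epsilon>"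
    using \<open>\<epsilon> > 0\<close> unfolding continuous_at_eps_delta dist_norm real_norm_def by metis
  obtain h k :: int where hk: "\<bar>of_int k * \<alpha> $ i - of_int h - s\<bar> < \<delta>"
    using sequence_of_fractional_parts_is_dense[OF rationally_independent_irrational[OF assms(1)] \<delta>(1)] by metis
  have "character (axis i k) \<alpha> = cis (2 * pi * (of_int k * \<alpha> $ i - of_int h))"
    using cis_multiple_2pi[of "of_int h"]
    by (simp add: character_def real_vec_def inner_vec_def axis_def if_distrib if_distribR right_diff_distrib
        flip: cis_divide cong: if_cong)
  then show ?thesis
    using \<delta>(2)[OF hk] t by (intro exI[of _ "axis i k"]) (simp add: s_def)
qed

text \<open>For a nontrivial character \<open>\<chi>\<close> the solution is \<open>\<chi> / (\<chi>(\<alpha>) - 1)\<close>.\<close>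

lemma trig_poly_coboundary:
  assumes "rationally_independent \<alpha>" "trig_poly p"
  shows "\<exists>w. torus_cont w \<and> (\<forall>\<theta>. p \<theta> - torus_mean p = w (\<theta> + \<alpha>) - w \<theta>)"
  using assms(2)
proof (induction rule: trig_poly.induct)
  case (monomial c k)
  show ?case
  proof (cases "k = 0")
    case True
    then show ?thesis by (intro exI[of _ "\<lambda>_. 0"]) (simp add: torus_cont_const)
  next
    case False
    then have nz: "character k \<alpha> - 1 \<noteq> 0" using rationally_independent_character[OF assms(1)] by simp
    define w where "w \<theta> = c / (character k \<alpha> - 1) * character k \<theta>" for \<theta>
    have "torus_cont w" unfolding w_def[abs_def] by (intro torus_cont_mult torus_cont_const torus_cont_character)
    moreover have "w (\<theta> + \<alpha>) - w \<theta> = c * character k \<theta>" for \<theta>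
    proof -
      have "w (\<theta> + \<alpha>) - w \<theta> = c / (character k \<alpha> - 1) * (character k \<alpha> - 1) * character k \<theta>"
        unfolding w_def character_add_right by (simp only: left_diff_distrib right_diff_distrib mult_ac mult_1_left mult_1_right)
      then show ?thesis using nz by simp
    qed
    moreover have "torus_mean (\<lambda>\<theta>. c * character k \<theta>) = 0"
      using False by (simp add: torus_mean_cmult torus_mean_character)
    ultimately show ?thesis by auto
  qed
next
  case (add f g)
  then obtain v w where v: "torus_cont v" "\<And>\<theta>. f \<theta> - torus_mean f = v (\<theta> + \<alpha>) - v \<theta>"
    and w: "torus_cont w" "\<And>\<theta>. g \<theta> - torus_mean g = w (\<theta> + \<alpha>) - w \<theta>" by blast
  have "f \<theta> + g \<theta> - torus_mean (\<lambda>\<theta>. f \<theta> + g \<theta>) = v (\<theta> + \<alpha>) + w (\<theta> + \<alpha>) - (v \<theta> + w \<theta>)" for \<theta>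
    using v(2)[of \<theta>] w(2)[of \<theta>] torus_mean_add[OF trig_poly_torus_cont[OF add(1)] trig_poly_torus_cont[OF add(2)]]
    by (simp add: algebra_simps)
  then show ?case by (intro exI[of _ "\<lambda>\<theta>. v \<theta> + w \<theta>"]) (simp add: torus_cont_add v(1) w(1))
qed

text \<open>A quantitative form of unique ergodicity: summation along an orbit telescopes the coboundary, so
that all Birkhoff averages of \<open>\<psi>\<close> are uniformly close to its mean.\<close>

theorem approximate_coboundary_complex:
  assumes "rationally_independent \<alpha>" and \<psi>: "torus_cont \<psi>" and "\<epsilon> > 0"
  obtains w where "torus_cont w" "\<And>\<theta>. cmod (\<psi> \<theta> - torus_mean \<psi> - (w (\<theta> + \<alpha>) - w \<theta>)) < \<epsilon>"
proof -
  obtain p where p: "trig_poly p" "\<And>\<theta>. cmod (\<psi> \<theta> - p \<theta>) < \<epsilon> / 2"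
    using trig_poly_dense[OF \<psi>, of "\<epsilon> / 2"] \<open>\<epsilon> > 0\<close> by auto
  note pc = trig_poly_torus_cont[OF p(1)]
  obtain w where w: "torus_cont w" "\<And>\<theta>. p \<theta> - torus_mean p = w (\<theta> + \<alpha>) - w \<theta>"
    using trig_poly_coboundary[OF assms(1) p(1)] by blast
  have "cmod (torus_mean (\<lambda>\<theta>. \<psi> \<theta> - p \<theta>)) \<le> \<epsilon> / 2"
    by (intro torus_mean_norm_le torus_cont_diff \<psi> pc less_imp_le[OF p(2)])
  then have m: "cmod (torus_mean \<psi> - torus_mean p) \<le> \<epsilon> / 2"
    by (simp add: torus_mean_diff \<psi> pc)
  have "cmod (\<psi> \<theta> - torus_mean \<psi> - (w (\<theta> + \<alpha>) - w \<theta>)) < \<epsilon>" for \<theta>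
  proof -
    have "\<psi> \<theta> - torus_mean \<psi> - (w (\<theta> + \<alpha>) - w \<theta>) = (\<psi> \<theta> - p \<theta>) - (torus_mean \<psi> - torus_mean p)"
      by (simp flip: w(2))
    also have "cmod \<dots> \<le> cmod (\<psi> \<theta> - p \<theta>) + cmod (torus_mean \<psi> - torus_mean p)" by (rule norm_triangle_ineq4)
    also have "\<dots> < \<epsilon>" using p(2)[of \<theta>] m by linarith
    finally show ?thesis .
  qed
  then show ?thesis by (rule that[OF w(1)])
qed

theorem approximate_coboundary:
  fixes \<psi> :: "real ^ 'd \<Rightarrow> real"
  assumes "rationally_independent \<alpha>" and \<psi>: "torus_cont \<psi>" and "\<epsilon> > 0"
  obtains w :: "real ^ 'd \<Rightarrow> real"
  where "torus_cont w" "\<And>\<theta>. \<bar>\<psi> \<theta> - torus_mean \<psi> - (w (\<theta> + \<alpha>) - w \<theta>)\<bar> < \<epsilon>"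
proof -
  obtain w where w: "torus_cont w"
      "\<And>\<theta>. cmod (complex_of_real (\<psi> \<theta>) - torus_mean (\<lambda>\<theta>. complex_of_real (\<psi> \<theta>)) - (w (\<theta> + \<alpha>) - w \<theta>)) < \<epsilon>"
    using approximate_coboundary_complex[OF assms(1) torus_cont_of_real[OF \<psi>] \<open>\<epsilon> > 0\<close>] by blast
  have "\<bar>\<psi> \<theta> - torus_mean \<psi> - (Re (w (\<theta> + \<alpha>)) - Re (w \<theta>))\<bar> < \<epsilon>" for \<theta>
    using le_less_trans[OF abs_Re_le_cmod w(2)[of \<theta>]] by (simp add: torus_mean_of_real[OF \<psi>])
  then show ?thesis by (rule that[OF torus_cont_Re[OF w(1)]])
qed

section \<open>Invertibility of weighted translations\<close>

definition ell2_invertible :: "(('i \<Rightarrow> complex) \<Rightarrow> 'i \<Rightarrow> complex) \<Rightarrow> bool" where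
  "ell2_invertible A \<longleftrightarrow> bij_betw A ell2 ell2 \<and> (\<exists>C. \<forall>u\<in>ell2. ell2_norm u \<le> C * ell2_norm (A u))"

text \<open>The Fourier picture of the weighted translation \<open>F \<mapsto> a F - \<mu> (F \<circ> T)\<close>.\<close>

definition cocycle_op :: "real ^ 'd \<Rightarrow> (real ^ 'd \<Rightarrow> complex) \<Rightarrow> complex \<Rightarrow> (int ^ 'd \<Rightarrow> complex) \<Rightarrow> int ^ 'd \<Rightarrow> complex" where
  "cocycle_op \<alpha> a \<mu> u n = mult_op a u n - \<mu> * modulate \<alpha> u n"

lemma ell2_invertibleI:
  assumes "\<And>u. u \<in> ell2 \<Longrightarrow> A u \<in> ell2"
    and "\<And>u v. u \<in> ell2 \<Longrightarrow> v \<in> ell2 \<Longrightarrow> A (\<lambda>n. u n - v n) = (\<lambda>n. A u n - A v n)"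
    and below: "\<And>u. u \<in> ell2 \<Longrightarrow> ell2_norm u \<le> C * ell2_norm (A u)"
    and surj: "\<And>v. v \<in> ell2 \<Longrightarrow> \<exists>u\<in>ell2. A u = v"
  shows "ell2_invertible A"
proof -
  have "u = v" if "u \<in> ell2" "v \<in> ell2" "A u = A v" for u v
  proof -
    have "ell2_norm (\<lambda>n. u n - v n) \<le> C * ell2_norm (A (\<lambda>n. u n - v n))"
      by (rule below[OF ell2_diff(1)[OF that(1,2)]])
    also have "A (\<lambda>n. u n - v n) = (\<lambda>_. 0)" unfolding assms(2)[OF that(1,2)] that(3) by simp
    finally have "ell2_norm (\<lambda>n. u n - v n) \<le> 0" by (simp add: ell2_zero)
    then have "(\<lambda>n. u n - v n) = (\<lambda>_. 0)" by (rule ell2_norm_eq_0_imp[OF ell2_diff(1)[OF that(1,2)]])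
    then show ?thesis by (auto simp: fun_eq_iff)
  qed
  moreover have "A ` ell2 = ell2" using assms(1) surj by (auto simp: image_iff)
  ultimately show ?thesis
    unfolding ell2_invertible_def bij_betw_def inj_on_def using below by blast
qed

lemma ell2_invertible_comp:
  assumes "ell2_invertible A" "ell2_invertible B"
  shows "ell2_invertible (\<lambda>u. A (B u))"
proof -
  obtain C where C: "\<And>u. u \<in> ell2 \<Longrightarrow> ell2_norm u \<le> C * ell2_norm (A u)"
    using assms(1) unfolding ell2_invertible_def by blast
  obtain D where D: "\<And>u. u \<in> ell2 \<Longrightarrow> ell2_norm u \<le> D * ell2_norm (B u)"
    using assms(2) unfolding ell2_invertible_def by blast
  have bij: "bij_betw A ell2 ell2" "bij_betw B ell2 ell2" using assms by (auto simp: ell2_invertible_def)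
  have "bij_betw (A \<circ> B) ell2 ell2" by (rule bij_betw_trans[OF bij(2,1)])
  moreover have "ell2_norm u \<le> (\<bar>D\<bar> * C) * ell2_norm (A (B u))" if "u \<in> ell2" for u
  proof -
    have Bu: "B u \<in> ell2" using bij(2) that by (auto simp: bij_betw_def)
    have "ell2_norm u \<le> D * ell2_norm (B u)" by (rule D[OF that])
    also have "\<dots> \<le> \<bar>D\<bar> * ell2_norm (B u)" by (intro mult_right_mono) auto
    also have "\<dots> \<le> \<bar>D\<bar> * (C * ell2_norm (A (B u)))" by (intro mult_left_mono C Bu) auto
    finally show ?thesis by (simp add: mult_ac)
  qed
  ultimately show ?thesis unfolding ell2_invertible_def by (auto simp: comp_def)
qed

lemma ell2_invertible_cong:
  assumes "\<And>u. u \<in> ell2 \<Longrightarrow> A u = B u"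
  shows "ell2_invertible A \<longleftrightarrow> ell2_invertible B"
  unfolding ell2_invertible_def using bij_betw_cong[of ell2 A B ell2] assms by auto

lemma cocycle_op_ell2:
  assumes "torus_cont a" "u \<in> ell2"
  shows "cocycle_op \<alpha> a \<mu> u \<in> ell2"
  unfolding cocycle_op_def[abs_def]
  by (intro ell2_diff(1) mult_op_ell2 assms ell2_cmult(1)) (simp add: modulate_ell2 assms)

lemma cocycle_op_diff:
  assumes "torus_cont a" "u \<in> ell2" "v \<in> ell2"
  shows "cocycle_op \<alpha> a \<mu> (\<lambda>n. u n - v n) = (\<lambda>n. cocycle_op \<alpha> a \<mu> u n - cocycle_op \<alpha> a \<mu> v n)"
  by (auto simp: cocycle_op_def mult_op_diff assms modulate_def algebra_simps)

lemma modulate_cancel: "modulate \<alpha> (modulate (- \<alpha>) u) = u"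
proof -
  have "character n \<alpha> * character n (- \<alpha>) = 1" for n
    by (simp flip: character_add_right)
  then show ?thesis by (auto simp: modulate_def simp flip: mult.assoc)
qed

text \<open>The term \<open>\<mu> T\<close> dominates and is a multiple of a unitary operator; a Neumann series in \<open>\<mu>\<^sup>-\<^sup>1 T\<^sup>-\<^sup>1 a\<close> inverts
the sum.\<close>

lemma cocycle_op_invertible_small:
  assumes a: "torus_cont a" and q: "0 \<le> q" "\<And>\<theta>. cmod (a \<theta>) \<le> q" "q < cmod \<mu>"
  shows "ell2_invertible (cocycle_op \<alpha> a \<mu>)"
proof (rule ell2_invertibleI)
  have \<mu>: "\<mu> \<noteq> 0" using q by auto
  fix u assume u: "u \<in> (ell2 :: (int ^ 'a \<Rightarrow> complex) set)"
  have Mu: "(\<lambda>n. \<mu> * modulate \<alpha> u n) \<in> ell2" "ell2_norm (\<lambda>n. \<mu> * modulate \<alpha> u n) = cmod \<mu> * ell2_norm u"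
    using ell2_cmult[of "modulate \<alpha> u" \<mu>] u by (simp_all add: modulate_ell2)
  have "ell2_norm (\<lambda>n. mult_op a u n - cocycle_op \<alpha> a \<mu> u n) \<le> ell2_norm (mult_op a u) + ell2_norm (cocycle_op \<alpha> a \<mu> u)"
    by (intro ell2_diff(2) mult_op_ell2 cocycle_op_ell2 a u)
  also have "(\<lambda>n. mult_op a u n - cocycle_op \<alpha> a \<mu> u n) = (\<lambda>n. \<mu> * modulate \<alpha> u n)"
    by (simp add: cocycle_op_def)
  finally have "(cmod \<mu> - q) * ell2_norm u \<le> ell2_norm (cocycle_op \<alpha> a \<mu> u)"
    using mult_op_bound(2)[OF a q(1,2) u] by (simp add: Mu(2) left_diff_distrib)
  then show "ell2_norm u \<le> 1 / (cmod \<mu> - q) * ell2_norm (cocycle_op \<alpha> a \<mu> u)"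
    using q(3) by (simp add: field_simps)
next
  fix v assume v: "v \<in> (ell2 :: (int ^ 'a \<Rightarrow> complex) set)"
  have \<mu>: "\<mu> \<noteq> 0" using q by auto
  define S where "S u = (\<lambda>n. inverse \<mu> * modulate (- \<alpha>) (mult_op a u) n)" for u
  have "\<exists>u\<in>ell2. \<forall>n. u n - S u n = - inverse \<mu> * modulate (- \<alpha>) v n"
  proof (rule ell2_contraction_surj)
    show "S u \<in> ell2" if "u \<in> ell2" for u
      unfolding S_def using that by (intro ell2_cmult(1)) (simp add: modulate_ell2 mult_op_ell2 a)
    show "S (\<lambda>n. u n + w n) n = S u n + S w n" if "u \<in> ell2" "w \<in> ell2" for u w n
      using that by (simp add: S_def modulate_def mult_op_add a algebra_simps)
    show "ell2_norm (S u) \<le> (q / cmod \<mu>) * ell2_norm u" if "u \<in> ell2" for u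
    proof -
      have "modulate (- \<alpha>) (mult_op a u) \<in> ell2" using that by (simp add: modulate_ell2 mult_op_ell2 a)
      then have "ell2_norm (S u) = ell2_norm (mult_op a u) / cmod \<mu>"
        unfolding S_def ell2_cmult(2)[OF \<open>modulate (- \<alpha>) (mult_op a u) \<in> ell2\<close>] modulate_ell2(2)
        by (simp add: norm_inverse norm_divide field_simps)
      then show ?thesis
        using mult_op_bound(2)[OF a q(1,2) that] \<mu> by (simp add: divide_right_mono)
    qed
    show "0 \<le> q / cmod \<mu>" "q / cmod \<mu> < 1" using q \<mu> by (auto simp: divide_less_eq)
    show "(\<lambda>n. - inverse \<mu> * modulate (- \<alpha>) v n) \<in> ell2"
      using v by (intro ell2_cmult(1)) (simp add: modulate_ell2)
  qed
  then obtain u where u: "u \<in> ell2" "\<And>n. u n - S u n = - inverse \<mu> * modulate (- \<alpha>) v n" by blast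
  have "cocycle_op \<alpha> a \<mu> u n = v n" for n
  proof -
    have "u m = inverse \<mu> * modulate (- \<alpha>) (\<lambda>n. mult_op a u n - v n) m" for m
      using u(2)[of m] by (simp add: S_def modulate_def algebra_simps)
    then have "\<mu> * modulate \<alpha> u n = modulate \<alpha> (modulate (- \<alpha>) (\<lambda>n. mult_op a u n - v n)) n"
      using \<mu> by (simp add: modulate_def[of \<alpha>])
    then show ?thesis unfolding modulate_cancel by (simp add: cocycle_op_def)
  qed
  then show "\<exists>u\<in>ell2. cocycle_op \<alpha> a \<mu> u = v" using u(1) by blast
qed (auto intro: cocycle_op_ell2 cocycle_op_diff a)

text \<open>The multiplication by \<open>a\<close> dominates and is invertible; a Neumann series in \<open>\<mu> a\<^sup>-\<^sup>1 T\<close> inverts the sum.\<close>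

lemma cocycle_op_invertible_large:
  assumes a: "torus_cont a" and q: "\<And>\<theta>. q \<le> cmod (a \<theta>)" "cmod \<mu> < q"
  shows "ell2_invertible (cocycle_op \<alpha> a \<mu>)"
proof -
  have q0: "q > 0" using q(2) by (meson norm_ge_zero le_less_trans)
  have nz: "a \<theta> \<noteq> 0" for \<theta> using q(1)[of \<theta>] q0 by auto
  define b where "b \<theta> = 1 / a \<theta>" for \<theta>
  have b: "torus_cont b" unfolding b_def[abs_def] by (intro torus_cont_divide torus_cont_const a nz)
  have bq: "cmod (b \<theta>) \<le> 1 / q" for \<theta>
    unfolding b_def norm_divide using q(1)[of \<theta>] q0 nz[of \<theta>] by (auto intro!: divide_left_mono mult_pos_pos)
  have ab: "(\<lambda>\<theta>. a \<theta> * b \<theta>) = (\<lambda>_. 1)" "(\<lambda>\<theta>. b \<theta> * a \<theta>) = (\<lambda>_. 1)" using nz by (auto simp: b_def)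
  have inv: "mult_op a (mult_op b u) = u" "mult_op b (mult_op a u) = u" if "u \<in> ell2" for u
    using that by (auto simp: mult_op_mult_op a b ab mult_op_const)
  have q1: "0 \<le> 1 / q" using q0 by simp
  show ?thesis
  proof (rule ell2_invertibleI)
    fix u assume u: "u \<in> (ell2 :: (int ^ 'a \<Rightarrow> complex) set)"
    have Mu: "(\<lambda>n. \<mu> * modulate \<alpha> u n) \<in> ell2" "ell2_norm (\<lambda>n. \<mu> * modulate \<alpha> u n) = cmod \<mu> * ell2_norm u"
      using ell2_cmult[of "modulate \<alpha> u" \<mu>] u by (simp_all add: modulate_ell2)
    have "ell2_norm (mult_op b (mult_op a u)) \<le> 1 / q * ell2_norm (mult_op a u)"
      by (rule mult_op_bound(2)[OF b q1 bq mult_op_ell2[OF a u]])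
    then have 1: "q * ell2_norm u \<le> ell2_norm (mult_op a u)"
      using q0 by (simp add: inv u field_simps)
    have "ell2_norm (\<lambda>n. cocycle_op \<alpha> a \<mu> u n + \<mu> * modulate \<alpha> u n)
        \<le> ell2_norm (cocycle_op \<alpha> a \<mu> u) + ell2_norm (\<lambda>n. \<mu> * modulate \<alpha> u n)"
      by (intro ell2_add(2) cocycle_op_ell2 a u Mu)
    also have "(\<lambda>n. cocycle_op \<alpha> a \<mu> u n + \<mu> * modulate \<alpha> u n) = mult_op a u"
      by (simp add: cocycle_op_def)
    finally have "(q - cmod \<mu>) * ell2_norm u \<le> ell2_norm (cocycle_op \<alpha> a \<mu> u)"
      using 1 by (simp add: Mu(2) left_diff_distrib)
    then show "ell2_norm u \<le> 1 / (q - cmod \<mu>) * ell2_norm (cocycle_op \<alpha> a \<mu> u)"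
      using q(2) by (simp add: field_simps)
  next
    fix v assume v: "v \<in> (ell2 :: (int ^ 'a \<Rightarrow> complex) set)"
    define S where "S u = (\<lambda>n. \<mu> * mult_op b (modulate \<alpha> u) n)" for u
    have Du: "modulate \<alpha> u \<in> ell2" if "u \<in> ell2" for u using that by (simp add: modulate_ell2)
    have "\<exists>u\<in>ell2. \<forall>n. u n - S u n = mult_op b v n"
    proof (rule ell2_contraction_surj)
      show "S u \<in> ell2" if "u \<in> ell2" for u
        unfolding S_def using that by (intro ell2_cmult(1) mult_op_ell2 b Du)
      show "S (\<lambda>n. u n + w n) n = S u n + S w n" if "u \<in> ell2" "w \<in> ell2" for u w n
      proof -
        have "modulate \<alpha> (\<lambda>n. u n + w n) = (\<lambda>n. modulate \<alpha> u n + modulate \<alpha> w n)"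
          by (auto simp: modulate_def algebra_simps)
        then show ?thesis using mult_op_add[OF b Du[OF that(1)] Du[OF that(2)], of n] by (simp add: S_def algebra_simps)
      qed
      show "ell2_norm (S u) \<le> (cmod \<mu> / q) * ell2_norm u" if "u \<in> ell2" for u
      proof -
        have "ell2_norm (S u) = cmod \<mu> * ell2_norm (mult_op b (modulate \<alpha> u))"
          unfolding S_def using that by (intro ell2_cmult(2) mult_op_ell2 b Du)
        also have "\<dots> \<le> cmod \<mu> * (1 / q * ell2_norm (modulate \<alpha> u))"
          by (intro mult_left_mono mult_op_bound(2)[OF b q1 bq Du[OF that]]) auto
        finally show ?thesis by (simp add: modulate_ell2)
      qed
      show "0 \<le> cmod \<mu> / q" "cmod \<mu> / q < 1" using q(2) q0 by (auto simp: divide_less_eq)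
      show "mult_op b v \<in> ell2" by (rule mult_op_ell2[OF b v])
    qed
    then obtain u where u: "u \<in> ell2" "\<And>n. u n - S u n = mult_op b v n" by blast
    have w: "(\<lambda>n. \<mu> * modulate \<alpha> u n) \<in> ell2" by (intro ell2_cmult(1) Du u)
    have "u = (\<lambda>n. mult_op b v n + mult_op b (\<lambda>n. \<mu> * modulate \<alpha> u n) n)"
      using u(2) by (auto simp: S_def mult_op_cmult diff_eq_eq)
    also have "\<dots> = mult_op b (\<lambda>n. v n + \<mu> * modulate \<alpha> u n)"
      by (rule ext) (rule mult_op_add[OF b v w, symmetric])
    finally have "mult_op a u = mult_op a (mult_op b (\<lambda>n. v n + \<mu> * modulate \<alpha> u n))" by (rule arg_cong)
    also have "\<dots> = (\<lambda>n. v n + \<mu> * modulate \<alpha> u n)" by (rule inv(1)[OF ell2_add(1)[OF v w]])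
    finally have "cocycle_op \<alpha> a \<mu> u = v" by (auto simp: cocycle_op_def)
    then show "\<exists>u\<in>ell2. cocycle_op \<alpha> a \<mu> u = v" using u(1) by blast
  qed (auto intro: cocycle_op_ell2 cocycle_op_diff a)
qed

lemma mult_op_invertible:
  assumes a: "torus_cont a" and nz: "\<And>\<theta>. a \<theta> \<noteq> 0"
  shows "ell2_invertible (mult_op a)"
proof -
  have i: "torus_cont (\<lambda>\<theta>. 1 / a \<theta>)" by (intro torus_cont_divide torus_cont_const a nz)
  obtain B where B: "B > 0" "\<And>\<theta>. cmod (1 / a \<theta>) \<le> B" using torus_cont_bounded[OF i] by blast
  have "1 / B \<le> cmod (a \<theta>)" for \<theta>
    using B(2)[of \<theta>] B(1) nz[of \<theta>] by (simp add: norm_divide field_simps)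
  then have "ell2_invertible (cocycle_op 0 a 0)"
    using B(1) by (intro cocycle_op_invertible_large[of a "1 / B"] a) auto
  moreover have "cocycle_op 0 a 0 = mult_op a" by (auto simp: cocycle_op_def fun_eq_iff)
  ultimately show ?thesis by simp
qed

text \<open>The identity is \<open>a - \<mu> T = e\<^sup>w\<^sup>\<circ>\<^sup>T (a e\<^sup>w\<^sup>-\<^sup>w\<^sup>\<circ>\<^sup>T - \<mu> T) e\<^sup>-\<^sup>w\<close>, where the outer factors are invertible multiplications.
A coboundary added to \<open>log \<bar>a\<bar>\<close> therefore does not affect invertibility.\<close>

lemma cocycle_op_conjugate:
  assumes a: "torus_cont a" and w: "torus_cont w"
    and inv: "ell2_invertible (cocycle_op \<alpha> (\<lambda>\<theta>. a \<theta> * exp (w \<theta> - w (\<theta> + \<alpha>))) \<mu>)"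
  shows "ell2_invertible (cocycle_op \<alpha> a \<mu>)"
proof -
  let ?a' = "\<lambda>\<theta>. a \<theta> * exp (w \<theta> - w (\<theta> + \<alpha>))"
  let ?e = "\<lambda>\<theta>. exp (0 - w \<theta>)" and ?f = "\<lambda>\<theta>. exp (w (\<theta> + \<alpha>))"
  note wT = torus_cont_translate[OF w, of \<alpha>]
  have a': "torus_cont ?a'" by (intro torus_cont_mult torus_cont_exp torus_cont_diff a w wT)
  have e: "torus_cont ?e" by (intro torus_cont_exp torus_cont_diff torus_cont_const w)
  have f: "torus_cont ?f" by (intro torus_cont_exp wT)
  have "cocycle_op \<alpha> a \<mu> u = mult_op ?f (cocycle_op \<alpha> ?a' \<mu> (mult_op ?e u))" if u: "u \<in> ell2" for u
  proof
    fix n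
    have eu: "mult_op ?e u \<in> ell2" by (rule mult_op_ell2[OF e u])
    have mu: "modulate \<alpha> u \<in> ell2" using u by (simp add: modulate_ell2)
    have meu: "modulate \<alpha> (mult_op ?e u) \<in> ell2" using eu by (simp only: modulate_ell2)
    have c: "cocycle_op \<alpha> ?a' \<mu> (mult_op ?e u) = (\<lambda>n. mult_op ?a' (mult_op ?e u) n - \<mu> * modulate \<alpha> (mult_op ?e u) n)"
      by (auto simp: cocycle_op_def)
    have "mult_op ?f (mult_op ?a' (mult_op ?e u)) = mult_op (\<lambda>\<theta>. ?f \<theta> * (?a' \<theta> * ?e \<theta>)) u"
      by (simp only: mult_op_mult_op[OF a' e u] mult_op_mult_op[OF f torus_cont_mult[OF a' e] u])
    also have "(\<lambda>\<theta>. ?f \<theta> * (?a' \<theta> * ?e \<theta>)) = a"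
      by (auto simp: exp_diff exp_minus)
    finally have 1: "mult_op ?f (mult_op ?a' (mult_op ?e u)) = mult_op a u" .
    have "mult_op ?f (modulate \<alpha> (mult_op ?e u)) = mult_op (\<lambda>\<theta>. ?f \<theta> * ?e (\<theta> + \<alpha>)) (modulate \<alpha> u)"
      by (simp only: modulate_mult_op[OF e] mult_op_mult_op[OF f torus_cont_translate[OF e] mu])
    also have "(\<lambda>\<theta>. ?f \<theta> * ?e (\<theta> + \<alpha>)) = (\<lambda>_. 1)" by (auto simp flip: exp_add)
    finally have 2: "mult_op ?f (modulate \<alpha> (mult_op ?e u)) n = modulate \<alpha> u n" by (simp add: mult_op_const)
    have "mult_op ?f (cocycle_op \<alpha> ?a' \<mu> (mult_op ?e u)) n
        = mult_op ?f (mult_op ?a' (mult_op ?e u)) n - \<mu> * mult_op ?f (modulate \<alpha> (mult_op ?e u)) n"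
      unfolding c mult_op_cmult[symmetric]
      by (rule mult_op_diff[OF f mult_op_ell2[OF a' eu] ell2_cmult(1)[OF meu]])
    then show "cocycle_op \<alpha> a \<mu> u n = mult_op ?f (cocycle_op \<alpha> ?a' \<mu> (mult_op ?e u)) n"
      unfolding 1 2 by (simp add: cocycle_op_def)
  qed
  then have "ell2_invertible (cocycle_op \<alpha> a \<mu>) \<longleftrightarrow>
      ell2_invertible (\<lambda>u. mult_op ?f (cocycle_op \<alpha> ?a' \<mu> (mult_op ?e u)))"
    by (rule ell2_invertible_cong)
  moreover have "ell2_invertible (mult_op ?f)" "ell2_invertible (mult_op ?e)"
    by (rule mult_op_invertible[OF f] mult_op_invertible[OF e], simp)+
  ultimately show ?thesis
    by (simp only: ell2_invertible_comp[OF _ ell2_invertible_comp[OF inv]])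
qed

lemma norm_mult_exp_of_real: "cmod (z * exp (complex_of_real s - complex_of_real t)) = cmod z * exp (s - t)"
  by (simp add: norm_mult)

text \<open>After the conjugation with an approximate solution of the cohomological equation for \<open>\<psi>\<close>, the new
weight is bounded by a constant close to the exponential of the mean of \<open>\<psi>\<close>. A majorant is enough, so
\<open>a\<close> may vanish.\<close>

theorem cocycle_op_invertible_majorant:
  assumes \<alpha>: "rationally_independent \<alpha>" and a: "torus_cont a" and \<psi>: "torus_cont \<psi>"
    and le: "\<And>\<theta>. cmod (a \<theta>) \<le> exp (\<psi> \<theta>)" and less: "exp (torus_mean \<psi>) < cmod \<mu>"
  shows "ell2_invertible (cocycle_op \<alpha> a \<mu>)"
proof -
  define r where "r = (ln (cmod \<mu>) - torus_mean \<psi>) / 2"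
  have \<mu>: "cmod \<mu> > 0" using less by (meson exp_gt_zero less_trans)
  have "torus_mean \<psi> < ln (cmod \<mu>)" using less \<mu> by (metis exp_less_cancel_iff exp_ln)
  then have r: "r > 0" "torus_mean \<psi> + r < ln (cmod \<mu>)" by (simp_all add: r_def field_simps)
  obtain w :: "real ^ 'a \<Rightarrow> real" where w: "torus_cont w" "\<And>\<theta>. \<bar>\<psi> \<theta> - torus_mean \<psi> - (w (\<theta> + \<alpha>) - w \<theta>)\<bar> < r"
    using approximate_coboundary[OF \<alpha> \<psi> r(1)] by blast
  let ?w = "\<lambda>\<theta>. complex_of_real (w \<theta>)"
  let ?b = "\<lambda>\<theta>. a \<theta> * exp (?w \<theta> - ?w (\<theta> + \<alpha>))"
  have wc: "torus_cont ?w" by (rule torus_cont_of_real[OF w(1)])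
  have "ell2_invertible (cocycle_op \<alpha> ?b \<mu>)"
  proof (rule cocycle_op_invertible_small)
    show "torus_cont ?b" by (intro torus_cont_mult torus_cont_exp torus_cont_diff a wc torus_cont_translate[OF wc])
    show "0 \<le> exp (torus_mean \<psi> + r)" by simp
    show "cmod (?b \<theta>) \<le> exp (torus_mean \<psi> + r)" for \<theta>
    proof -
      have "cmod (?b \<theta>) = cmod (a \<theta>) * exp (w \<theta> - w (\<theta> + \<alpha>))" by (rule norm_mult_exp_of_real)
      also have "\<dots> \<le> exp (\<psi> \<theta>) * exp (w \<theta> - w (\<theta> + \<alpha>))" by (intro mult_right_mono le) auto
      also have "\<dots> = exp (\<psi> \<theta> + (w \<theta> - w (\<theta> + \<alpha>)))" by (simp only: exp_add)
      also have "\<dots> \<le> exp (torus_mean \<psi> + r)" using w(2)[of \<theta>] by simp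
      finally show ?thesis .
    qed
    show "exp (torus_mean \<psi> + r) < cmod \<mu>" using r(2) \<mu> by (metis exp_less_cancel_iff exp_ln)
  qed
  then show ?thesis by (rule cocycle_op_conjugate[OF a wc])
qed

theorem cocycle_op_invertible_minorant:
  assumes \<alpha>: "rationally_independent \<alpha>" and a: "torus_cont a" and \<psi>: "torus_cont \<psi>"
    and le: "\<And>\<theta>. exp (\<psi> \<theta>) \<le> cmod (a \<theta>)" and less: "cmod \<mu> < exp (torus_mean \<psi>)"
  shows "ell2_invertible (cocycle_op \<alpha> a \<mu>)"
proof -
  have "isCont (\<lambda>r. exp (torus_mean \<psi> - r)) 0" by (intro continuous_intros)
  then have "((\<lambda>r. exp (torus_mean \<psi> - r)) \<longlongrightarrow> exp (torus_mean \<psi> - 0)) (at_right 0)"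
    by (rule tendsto_within_subset[OF isContD]) auto
  then have "eventually (\<lambda>r. cmod \<mu> < exp (torus_mean \<psi> - r)) (at_right 0)"
    using less by (intro order_tendstoD(1)) auto
  then have "eventually (\<lambda>r. cmod \<mu> < exp (torus_mean \<psi> - r) \<and> r > 0) (at_right 0)"
    by (intro eventually_conj eventually_at_right_less)
  then obtain r where r: "r > 0" "cmod \<mu> < exp (torus_mean \<psi> - r)"
    using eventually_happens[of _ "at_right (0::real)"] by force
  obtain w :: "real ^ 'a \<Rightarrow> real" where w: "torus_cont w" "\<And>\<theta>. \<bar>\<psi> \<theta> - torus_mean \<psi> - (w (\<theta> + \<alpha>) - w \<theta>)\<bar> < r"
    using approximate_coboundary[OF \<alpha> \<psi> r(1)] by blast
  let ?w = "\<lambda>\<theta>. complex_of_real (w \<theta>)"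
  let ?b = "\<lambda>\<theta>. a \<theta> * exp (?w \<theta> - ?w (\<theta> + \<alpha>))"
  have wc: "torus_cont ?w" by (rule torus_cont_of_real[OF w(1)])
  have "ell2_invertible (cocycle_op \<alpha> ?b \<mu>)"
  proof (rule cocycle_op_invertible_large)
    show "torus_cont ?b" by (intro torus_cont_mult torus_cont_exp torus_cont_diff a wc torus_cont_translate[OF wc])
    show "exp (torus_mean \<psi> - r) \<le> cmod (?b \<theta>)" for \<theta>
    proof -
      have "exp (torus_mean \<psi> - r) \<le> exp (\<psi> \<theta> + (w \<theta> - w (\<theta> + \<alpha>)))" using w(2)[of \<theta>] by simp
      also have "\<dots> = exp (\<psi> \<theta>) * exp (w \<theta> - w (\<theta> + \<alpha>))" by (simp only: exp_add)
      also have "\<dots> \<le> cmod (a \<theta>) * exp (w \<theta> - w (\<theta> + \<alpha>))" by (intro mult_right_mono le) auto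
      also have "\<dots> = cmod (?b \<theta>)" by (rule norm_mult_exp_of_real[symmetric])
      finally show ?thesis .
    qed
  qed (rule r(2))
  then show ?thesis by (rule cocycle_op_conjugate[OF a wc])
qed

section \<open>Obstructions to invertibility\<close>

lemma torus_L2_cmult:
  "torus_L2 (\<lambda>\<theta>. c * F \<theta>) = cmod c * torus_L2 F"
  unfolding torus_L2_def
  by (simp add: norm_mult power_mult_distrib torus_mean_cmult real_sqrt_mult)

lemma torus_L2_translate:
  assumes "torus_cont F"
  shows "torus_L2 (\<lambda>\<theta>. F (\<theta> + v)) = torus_L2 F"
  unfolding torus_L2_def
  using torus_mean_translate[OF torus_cont_power[OF torus_cont_norm[OF assms], where n = 2], of v] by simp

lemma torus_L2_cong_norm:
  assumes "\<And>\<theta>. cmod (F \<theta>) = cmod (G \<theta>)"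
  shows "torus_L2 F = torus_L2 G"
  unfolding torus_L2_def by (simp add: assms)

lemma torus_L2_pos:
  assumes F: "torus_cont F" and "F \<theta> \<noteq> 0"
  shows "torus_L2 F > 0"
proof -
  have "torus_mean (\<lambda>\<theta>. (cmod (F \<theta>))\<^sup>2) \<noteq> 0"
  proof
    assume "torus_mean (\<lambda>\<theta>. (cmod (F \<theta>))\<^sup>2) = 0"
    then have "(cmod (F \<theta>))\<^sup>2 = 0"
      by (intro torus_mean_eq_0_imp[OF torus_cont_power[OF torus_cont_norm[OF F]]]) auto
    then show False using assms(2) by simp
  qed
  then have "torus_L2 F \<noteq> 0" by (simp add: torus_L2_def)
  then show ?thesis by (metis torus_L2_nonneg less_eq_real_def)
qed

lemma torus_L2_sum:
  assumes "finite I" "\<And>i. i \<in> I \<Longrightarrow> torus_cont (F i)"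
  shows "torus_L2 (\<lambda>\<theta>. \<Sum>i\<in>I. F i \<theta>) \<le> (\<Sum>i\<in>I. torus_L2 (F i))"
  using assms
proof (induction I rule: finite_induct)
  case empty
  then show ?case by (simp add: torus_L2_def)
next
  case (insert i I)
  have "torus_L2 (\<lambda>\<theta>. F i \<theta> + (\<Sum>i\<in>I. F i \<theta>)) \<le> torus_L2 (F i) + torus_L2 (\<lambda>\<theta>. \<Sum>i\<in>I. F i \<theta>)"
    using insert.prems by (intro torus_L2_triangle torus_cont_sum) auto
  also have "torus_L2 (\<lambda>\<theta>. \<Sum>i\<in>I. F i \<theta>) \<le> (\<Sum>i\<in>I. torus_L2 (F i))"
    using insert by auto
  finally show ?case using insert.hyps by simp
qed

lemma torus_L2_triangle_diff:
  assumes "torus_cont f" "torus_cont g"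
  shows "torus_L2 f \<le> torus_L2 g + torus_L2 (\<lambda>\<theta>. f \<theta> - g \<theta>)"
  using torus_L2_triangle[OF assms(2) torus_cont_diff[OF assms]] by simp

text \<open>Multiplication by the character \<open>k\<close> is an isometry that conjugates \<open>a - \<mu> T\<close> into
\<open>a - \<mu> \<chi>\<^sub>k(\<alpha>) T\<close>. The numbers \<open>\<chi>\<^sub>k(\<alpha>)\<close> are dense in the unit circle, and for fixed \<open>F\<close> the estimate is
continuous in \<open>\<mu>\<close>.\<close>

theorem cocycle_op_invertible_lower_bound:
  assumes \<alpha>: "rationally_independent \<alpha>" and a: "torus_cont a"
    and inv: "ell2_invertible (cocycle_op \<alpha> a \<mu>)"
  obtains C where "C > 0"
    "\<And>\<mu>' F. cmod \<mu>' = cmod \<mu> \<Longrightarrow> torus_cont F \<Longrightarrow> torus_L2 F \<le> C * torus_L2 (\<lambda>\<theta>. a \<theta> * F \<theta> - \<mu>' * F (\<theta> + \<alpha>))"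
proof -
  obtain C0 where C0: "\<And>u. u \<in> ell2 \<Longrightarrow> ell2_norm u \<le> C0 * ell2_norm (cocycle_op \<alpha> a \<mu> u)"
    using inv unfolding ell2_invertible_def by blast
  define C where "C = max C0 1"
  have C: "C > 0" by (simp add: C_def)
  let ?A = "\<lambda>\<mu>' F \<theta>. a \<theta> * F \<theta> - \<mu>' * F (\<theta> + \<alpha>)"
  have Ac: "torus_cont (?A \<mu>' F)" if "torus_cont F" for \<mu>' F
    by (intro torus_cont_diff torus_cont_mult torus_cont_const a that torus_cont_translate)
  have base: "torus_L2 F \<le> C * torus_L2 (?A \<mu> F)" if F: "torus_cont F" for F
  proof -
    have "cocycle_op \<alpha> a \<mu> (fourier_coeff F) = fourier_coeff (?A \<mu> F)"
      by (rule ext, subst fourier_coeff_diff)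
         (auto intro!: torus_cont_mult torus_cont_const a F torus_cont_translate
           simp: cocycle_op_def mult_op_fourier_coeff a F modulate_fourier_coeff fourier_coeff_cmult)
    then have "torus_L2 F \<le> C0 * torus_L2 (?A \<mu> F)"
      using C0[OF fourier_coeff_ell2[OF F]] by (simp add: parseval F Ac)
    also have "\<dots> \<le> C * torus_L2 (?A \<mu> F)" by (intro mult_right_mono) (auto simp: C_def)
    finally show ?thesis .
  qed
  have chr: "torus_L2 F \<le> C * torus_L2 (?A (\<mu> * character k \<alpha>) F)" if F: "torus_cont F" for F k
  proof -
    have "torus_L2 F = torus_L2 (\<lambda>\<theta>. character k \<theta> * F \<theta>)"
      by (rule torus_L2_cong_norm) (simp add: norm_mult)
    also have "\<dots> \<le> C * torus_L2 (?A \<mu> (\<lambda>\<theta>. character k \<theta> * F \<theta>))"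
      by (intro base torus_cont_mult torus_cont_character F)
    also have "torus_L2 (?A \<mu> (\<lambda>\<theta>. character k \<theta> * F \<theta>)) = torus_L2 (?A (\<mu> * character k \<alpha>) F)"
    proof (rule torus_L2_cong_norm)
      fix \<theta>
      have "?A \<mu> (\<lambda>\<theta>. character k \<theta> * F \<theta>) \<theta> = character k \<theta> * ?A (\<mu> * character k \<alpha>) F \<theta>"
        by (simp add: character_add_right algebra_simps)
      then show "cmod (?A \<mu> (\<lambda>\<theta>. character k \<theta> * F \<theta>) \<theta>) = cmod (?A (\<mu> * character k \<alpha>) F \<theta>)"
        by (simp add: norm_mult)
    qed
    finally show ?thesis .
  qed
  have gen: "torus_L2 F \<le> C * torus_L2 (?A \<mu>' F)" if \<mu>': "cmod \<mu>' = cmod \<mu>" and F: "torus_cont F" for \<mu>' F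
  proof (cases "\<mu> = 0")
    case True
    then show ?thesis using base[OF F] \<mu>' by simp
  next
    case False
    show ?thesis
    proof (rule field_le_epsilon)
      fix e :: real assume e: "e > 0"
      \<comment> \<open>Chosen so that moving \<open>\<mu>'\<close> to the nearby \<open>\<mu> \<chi>\<^sub>k(\<alpha>)\<close> changes the right-hand side by at most \<open>e\<close>.\<close>
      define \<delta> where "\<delta> = e / (C * cmod \<mu> * (torus_L2 F + 1))"
      have pos: "C * cmod \<mu> > 0" "torus_L2 F + 1 > 0" using C False by (auto intro: add_nonneg_pos)
      have \<delta>: "\<delta> > 0" unfolding \<delta>_def by (intro divide_pos_pos mult_pos_pos pos e)
      have "cmod (\<mu>' / \<mu>) = 1" using \<mu>' False by (simp add: norm_divide)
      then obtain k where k: "cmod (character k \<alpha> - \<mu>' / \<mu>) < \<delta>"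
        using characters_dense_on_circle[OF \<alpha> _ \<delta>] by blast
      let ?\<nu> = "\<mu> * character k \<alpha>"
      have "?\<nu> - \<mu>' = \<mu> * (character k \<alpha> - \<mu>' / \<mu>)" using False by (simp add: algebra_simps)
      then have \<nu>: "cmod (?\<nu> - \<mu>') \<le> cmod \<mu> * \<delta>" using k by (simp add: norm_mult mult_left_mono)
      have FT: "torus_cont (\<lambda>\<theta>. F (\<theta> + \<alpha>))" by (rule torus_cont_translate[OF F])
      have "torus_L2 (?A ?\<nu> F) \<le> torus_L2 (?A \<mu>' F) + torus_L2 (\<lambda>\<theta>. ?A ?\<nu> F \<theta> - ?A \<mu>' F \<theta>)"
        by (intro torus_L2_triangle_diff Ac F)
      also have "(\<lambda>\<theta>. ?A ?\<nu> F \<theta> - ?A \<mu>' F \<theta>) = (\<lambda>\<theta>. (\<mu>' - ?\<nu>) * F (\<theta> + \<alpha>))"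
        by (auto simp: algebra_simps)
      also have "torus_L2 (\<lambda>\<theta>. (\<mu>' - ?\<nu>) * F (\<theta> + \<alpha>)) = cmod (?\<nu> - \<mu>') * torus_L2 F"
        unfolding torus_L2_cmult torus_L2_translate[OF F] by (simp add: norm_minus_commute)
      also have "\<dots> \<le> cmod \<mu> * \<delta> * (torus_L2 F + 1)"
        using \<nu> \<delta> by (intro mult_mono) auto
      finally have "C * torus_L2 (?A ?\<nu> F) \<le> C * (torus_L2 (?A \<mu>' F) + cmod \<mu> * \<delta> * (torus_L2 F + 1))"
        using C by (simp add: mult_left_mono)
      also have "\<dots> = C * torus_L2 (?A \<mu>' F) + \<delta> * (C * cmod \<mu> * (torus_L2 F + 1))"
        by (simp add: algebra_simps)
      also have "\<delta> * (C * cmod \<mu> * (torus_L2 F + 1)) = e"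
          unfolding \<delta>_def by (rule nonzero_eq_divide_eq[THEN iffD1, OF _ refl]) (rule less_imp_neq[OF mult_pos_pos[OF pos], symmetric])
      finally show "torus_L2 F \<le> C * torus_L2 (?A \<mu>' F) + e" using chr[OF F, of k] by linarith
    qed
  qed
  show ?thesis by (rule that[OF C gen])
qed

text \<open>If \<open>b - m\<close> were a coboundary \<open>w \<circ> T - w\<close>, with \<open>m\<close> the mean of \<open>b\<close>, then \<open>exp w\<close> would satisfy
\<open>exp b \<cdot> exp w = exp m \<cdot> exp (w \<circ> T)\<close>. With an approximate solution it is an approximate
eigenfunction, which contradicts the lower bound for \<open>\<mu>' = exp m\<close>.\<close>

theorem cocycle_op_not_invertible_log:
  assumes \<alpha>: "rationally_independent \<alpha>" and b: "torus_cont b" and \<mu>: "cmod \<mu> = exp (Re (torus_mean b))"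
  shows "\<not> ell2_invertible (cocycle_op \<alpha> (\<lambda>\<theta>. exp (b \<theta>)) \<mu>)"
proof
  assume "ell2_invertible (cocycle_op \<alpha> (\<lambda>\<theta>. exp (b \<theta>)) \<mu>)"
  then obtain C where C: "C > 0" "\<And>\<mu>' F. cmod \<mu>' = cmod \<mu> \<Longrightarrow> torus_cont F \<Longrightarrow>
      torus_L2 F \<le> C * torus_L2 (\<lambda>\<theta>. exp (b \<theta>) * F \<theta> - \<mu>' * F (\<theta> + \<alpha>))"
    using cocycle_op_invertible_lower_bound[OF \<alpha> torus_cont_exp[OF b]] by blast
  define m where "m = exp (torus_mean b)"
  have m: "cmod m = cmod \<mu>" "cmod m > 0" by (simp_all add: m_def \<mu>)
  define \<eta> where "\<eta> = 1 / (2 * C * cmod m)"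
  have \<eta>: "\<eta> > 0" using C(1) m(2) by (simp add: \<eta>_def)
  have "isCont (\<lambda>z::complex. exp z) 0" by (intro continuous_intros)
  then obtain \<epsilon> where \<epsilon>: "\<epsilon> > 0" "\<And>z::complex. cmod z < \<epsilon> \<Longrightarrow> cmod (exp z - 1) < \<eta>"
    using \<eta> unfolding continuous_at_eps_delta dist_norm by (metis diff_zero exp_zero)
  obtain w where w: "torus_cont w" "\<And>\<theta>. cmod (b \<theta> - torus_mean b - (w (\<theta> + \<alpha>) - w \<theta>)) < \<epsilon>"
    using approximate_coboundary_complex[OF \<alpha> b \<epsilon>(1)] by blast
  let ?F = "\<lambda>\<theta>. exp (w \<theta>)"
  have F: "torus_cont ?F" by (intro torus_cont_exp w(1))
  have FT: "torus_cont (\<lambda>\<theta>. ?F (\<theta> + \<alpha>))" by (rule torus_cont_translate[OF F])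
  let ?A = "\<lambda>\<theta>. exp (b \<theta>) * ?F \<theta> - m * ?F (\<theta> + \<alpha>)"
  have A: "torus_cont ?A" by (intro torus_cont_diff torus_cont_mult torus_cont_exp b F FT torus_cont_const)
  have "torus_L2 ?A \<le> (cmod m * \<eta>) * torus_L2 (\<lambda>\<theta>. ?F (\<theta> + \<alpha>))"
  proof (rule torus_L2_mono[OF A FT])
    show "0 \<le> cmod m * \<eta>" using \<eta> by simp
    fix \<theta>
    let ?d = "b \<theta> - torus_mean b - (w (\<theta> + \<alpha>) - w \<theta>)"
    have "b \<theta> + w \<theta> = torus_mean b + w (\<theta> + \<alpha>) + ?d" by simp
    then have "exp (b \<theta>) * ?F \<theta> = m * ?F (\<theta> + \<alpha>) * exp ?d"
      unfolding m_def by (simp only: exp_add[symmetric])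
    then have "?A \<theta> = m * ?F (\<theta> + \<alpha>) * (exp ?d - 1)" by (simp only: right_diff_distrib mult_1_right)
    then have "cmod (?A \<theta>) = cmod m * cmod (exp ?d - 1) * cmod (?F (\<theta> + \<alpha>))" by (simp only: norm_mult mult_ac)
    also have "\<dots> \<le> cmod m * \<eta> * cmod (?F (\<theta> + \<alpha>))"
      by (intro mult_right_mono mult_left_mono less_imp_le[OF \<epsilon>(2)] w(2)) auto
    finally show "cmod (?A \<theta>) \<le> cmod m * \<eta> * cmod (?F (\<theta> + \<alpha>))" .
  qed
  then have "torus_L2 ?F \<le> C * ((cmod m * \<eta>) * torus_L2 ?F)"
    using C(2)[OF m(1) F] C(1) unfolding torus_L2_translate[OF F]
    by (meson mult_left_mono less_imp_le order_trans)
  also have "\<dots> = torus_L2 ?F / 2" using C(1) m(2) by (simp add: \<eta>_def)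
  finally have "torus_L2 ?F \<le> 0" by simp
  moreover have "torus_L2 ?F > 0" by (rule torus_L2_pos[OF F, of 0]) simp
  ultimately show False by simp
qed

lemma sum_roots_of_unity:
  assumes "0 < n" "n < K"
  shows "(\<Sum>j<K. cis (2 * pi / K) ^ (j * n)) = 0"
proof -
  let ?z = "cis (2 * pi / K) ^ n"
  have "?z = exp (2 * of_real pi * \<i> * of_nat n / of_nat K)"
    by (simp add: cis_conv_exp exp_of_nat_mult[symmetric] mult_ac)
  moreover have "exp (2 * of_real pi * \<i> * of_nat n / of_nat K) \<noteq> (1::complex)"
    using complex_root_unity_eq_1[of K n] assms by (auto dest: dvd_imp_le)
  ultimately have nz: "?z \<noteq> 1" by simp
  have "?z ^ K = (cis (2 * pi / K) ^ K) ^ n" by (simp add: mult.commute flip: power_mult)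
  also have "cis (2 * pi / K) ^ K = 1" using assms by (simp only: Complex.DeMoivre) simp
  finally have "?z ^ K = 1" by simp
  then have "(\<Sum>j<K. ?z ^ j) = 0" using nz by (simp add: geometric_sum)
  then show ?thesis by (simp add: power_mult mult.commute flip: power_mult)
qed

text \<open>The functions \<open>g n = (a\<^sup>-\<^sup>1 T)\<^sup>n F\<close> are the terms of the Neumann series that solves \<open>(a - \<mu> T) H = a F\<close>.
For \<open>\<mu> = \<zeta>\<^sup>j \<rho>\<close> with a root of unity \<open>\<zeta>\<close> of order \<open>K\<close>, the partial sum \<open>H j\<close> of length \<open>K\<close> solves this
equation up to an error that tends to zero with \<open>K\<close>, because the solution \<open>w\<close> of the cohomological
equation for \<open>log \<bar>a\<bar>\<close> shows that \<open>\<rho>\<^sup>n g n\<close> decays exponentially. Averaging the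
solutions over \<open>j\<close> leaves only the first term, \<open>g 0 = F\<close>.\<close>

theorem lower_bound_imp_multiplier_lower_bound:
  assumes \<alpha>: "rationally_independent \<alpha>" and a: "torus_cont a" and nz: "\<And>\<theta>. a \<theta> \<noteq> 0"
    and \<rho>: "0 \<le> \<rho>" "\<rho> < exp (torus_mean (\<lambda>\<theta>. ln (cmod (a \<theta>))))" and D: "D \<ge> 0"
    and low: "\<And>\<mu> F. cmod \<mu> = \<rho> \<Longrightarrow> torus_cont F \<Longrightarrow> torus_L2 F \<le> D * torus_L2 (\<lambda>\<theta>. a \<theta> * F \<theta> - \<mu> * F (\<theta> + \<alpha>))"
    and F: "torus_cont F"
  shows "torus_L2 F \<le> D * torus_L2 (\<lambda>\<theta>. a \<theta> * F \<theta>)"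
proof -
  let ?\<psi> = "\<lambda>\<theta>. ln (cmod (a \<theta>))"
  have \<psi>: "torus_cont ?\<psi>" by (intro torus_cont_ln torus_cont_norm a) (simp add: nz)
  have "isCont (\<lambda>r. exp (torus_mean ?\<psi> - r)) 0" by (intro continuous_intros)
  then have "((\<lambda>r. exp (torus_mean ?\<psi> - r)) \<longlongrightarrow> exp (torus_mean ?\<psi> - 0)) (at_right 0)"
    by (rule tendsto_within_subset[OF isContD]) auto
  then have "eventually (\<lambda>r. \<rho> < exp (torus_mean ?\<psi> - r)) (at_right 0)"
    using \<rho>(2) by (intro order_tendstoD(1)) auto
  then have "eventually (\<lambda>r. \<rho> < exp (torus_mean ?\<psi> - r) \<and> r > 0) (at_right 0)"
    by (intro eventually_conj eventually_at_right_less)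
  then obtain r where r: "r > 0" "\<rho> < exp (torus_mean ?\<psi> - r)"
    using eventually_happens[of _ "at_right (0::real)"] by force
  define q where "q = exp (torus_mean ?\<psi> - r)"
  have q: "q > 0" "\<rho> < q" using r(2) by (simp_all add: q_def)
  obtain w :: "real ^ 'a \<Rightarrow> real" where w: "torus_cont w" "\<And>\<theta>. \<bar>?\<psi> \<theta> - torus_mean ?\<psi> - (w (\<theta> + \<alpha>) - w \<theta>)\<bar> < r"
    using approximate_coboundary[OF \<alpha> \<psi> r(1)] by blast
  have aq: "q * exp (w (\<theta> + \<alpha>)) \<le> cmod (a \<theta>) * exp (w \<theta>)" for \<theta>
  proof -
    have "q * exp (w (\<theta> + \<alpha>)) = exp (torus_mean ?\<psi> - r + w (\<theta> + \<alpha>))" by (simp only: q_def exp_add)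
    also have "\<dots> \<le> exp (?\<psi> \<theta> + w \<theta>)" using w(2)[of \<theta>] by simp
    also have "\<dots> = cmod (a \<theta>) * exp (w \<theta>)" using nz by (simp add: exp_add)
    finally show ?thesis .
  qed
  define g where "g = rec_nat F (\<lambda>_ h \<theta>. h (\<theta> + \<alpha>) / a \<theta>)"
  have g0: "g 0 = F" and gS: "g (Suc n) \<theta> = g n (\<theta> + \<alpha>) / a \<theta>" for n \<theta> by (simp_all add: g_def)
  have gc: "torus_cont (g n)" for n
  proof (induction n)
    case (Suc n)
    have "torus_cont (\<lambda>\<theta>. g n (\<theta> + \<alpha>) / a \<theta>)" by (intro torus_cont_divide torus_cont_translate Suc a nz)
    then show ?case by (simp add: gS[abs_def])
  qed (simp add: g0 F)
  have "torus_cont (\<lambda>\<theta>. F \<theta> / complex_of_real (exp (w \<theta>)))"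
    by (intro torus_cont_divide torus_cont_of_real torus_cont_exp F w(1)) simp
  then obtain M where M: "M > 0" "\<And>\<theta>. cmod (F \<theta> / complex_of_real (exp (w \<theta>))) \<le> M"
    using torus_cont_bounded by blast
  obtain W where W: "W > 0" "\<And>\<theta>. norm (exp (w \<theta>)) \<le> W"
    using torus_cont_bounded[OF torus_cont_exp[OF w(1)]] by blast
  have gb: "cmod (g n \<theta>) \<le> M * exp (w \<theta>) / q ^ n" for n \<theta>
  proof (induction n arbitrary: \<theta>)
    case 0
    show ?case using M(2)[of \<theta>] by (simp add: g0 norm_divide divide_le_eq)
  next
    case (Suc n)
    have "cmod (g (Suc n) \<theta>) = cmod (g n (\<theta> + \<alpha>)) / cmod (a \<theta>)" by (simp add: gS norm_divide)
    also have "\<dots> \<le> M * exp (w (\<theta> + \<alpha>)) / q ^ n / cmod (a \<theta>)" by (intro divide_right_mono Suc) auto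
    also have "\<dots> = M / q ^ Suc n * (q * exp (w (\<theta> + \<alpha>)) / cmod (a \<theta>))" using q by simp
    also have "\<dots> \<le> M / q ^ Suc n * exp (w \<theta>)"
      using aq[of \<theta>] nz[of \<theta>] M(1) q by (intro mult_left_mono) (auto simp: divide_le_eq mult.commute)
    finally show ?case by simp
  qed
  obtain B where B: "B > 0" "\<And>\<theta>. cmod (a \<theta>) \<le> B" using torus_cont_bounded[OF a] by blast
  have main: "torus_L2 F \<le> D * (torus_L2 (\<lambda>\<theta>. a \<theta> * F \<theta>) + (\<rho> / q) ^ K * (B * M * W))" if K: "K > 0" for K :: nat
  proof -
    let ?\<zeta> = "cis (2 * pi / K)"
    have \<zeta>K: "?\<zeta> ^ K = 1" using K by (simp only: Complex.DeMoivre) simp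
    define H where "H j \<theta> = (\<Sum>n<K. ?\<zeta> ^ (j * n) * of_real \<rho> ^ n * g n \<theta>)" for j \<theta>
    have Hc: "torus_cont (H j)" for j
      unfolding H_def[abs_def] by (intro torus_cont_sum torus_cont_mult torus_cont_const gc)
    \<comment> \<open>The sum telescopes, as \<open>g n \<circ> T = a g (n + 1)\<close>; the phase of the last term is \<open>\<zeta>\<^sup>j\<^sup>K = 1\<close>.\<close>
    have AH: "a \<theta> * H j \<theta> - ?\<zeta> ^ j * of_real \<rho> * H j (\<theta> + \<alpha>) = a \<theta> * F \<theta> - of_real \<rho> ^ K * a \<theta> * g K \<theta>" for j \<theta>
    proof -
      let ?t = "\<lambda>n. ?\<zeta> ^ (j * n) * of_real \<rho> ^ n * (a \<theta> * g n \<theta>)"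
      have 1: "a \<theta> * H j \<theta> = (\<Sum>n<K. ?t n)" by (simp add: H_def sum_distrib_left mult_ac)
      have gT: "g n (\<theta> + \<alpha>) = a \<theta> * g (Suc n) \<theta>" for n using nz by (simp add: gS)
      have 2: "?\<zeta> ^ j * of_real \<rho> * H j (\<theta> + \<alpha>) = (\<Sum>n<K. ?t (Suc n))"
        unfolding H_def gT sum_distrib_left by (intro sum.cong) (simp_all add: power_add mult_ac)
      have "?\<zeta> ^ (j * K) = 1" using \<zeta>K by (metis mult.commute power_mult power_one)
      then have "?t 0 - ?t K = a \<theta> * F \<theta> - of_real \<rho> ^ K * a \<theta> * g K \<theta>" by (simp add: g0 mult_ac)
      moreover have "(\<Sum>n<K. ?t n) - (\<Sum>n<K. ?t (Suc n)) = ?t 0 - ?t K"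
        unfolding sum_subtractf[symmetric] by (rule sum_lessThan_telescope'[of ?t])
      ultimately show ?thesis unfolding 1 2 by simp
    qed
    have aF: "torus_cont (\<lambda>\<theta>. a \<theta> * F \<theta>)" by (intro torus_cont_mult a F)
    let ?R = "\<lambda>\<theta>. - (of_real \<rho> ^ K) * a \<theta> * g K \<theta>"
    have R: "torus_cont ?R" by (intro torus_cont_mult torus_cont_const a gc)
    have Rle: "torus_L2 ?R \<le> (\<rho> / q) ^ K * (B * M * W)"
    proof (rule torus_L2_le_const[OF R])
      show "0 \<le> (\<rho> / q) ^ K * (B * M * W)" using \<rho> q B M W by simp
      fix \<theta>
      have "cmod (?R \<theta>) = \<rho> ^ K * (cmod (a \<theta>) * cmod (g K \<theta>))"
        using \<rho>(1) by (simp add: norm_mult norm_power)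
      also have "\<dots> \<le> \<rho> ^ K * (B * (M * exp (w \<theta>) / q ^ K))"
        using \<rho>(1) B M by (intro mult_left_mono mult_mono gb B(2)) auto
      also have "\<dots> \<le> \<rho> ^ K * (B * (M * W / q ^ K))"
        using \<rho>(1) B M q W(2)[of \<theta>] by (intro mult_left_mono divide_right_mono) auto
      also have "\<dots> = (\<rho> / q) ^ K * (B * M * W)" by (simp add: power_divide)
      finally show "cmod (?R \<theta>) \<le> (\<rho> / q) ^ K * (B * M * W)" .
    qed
    have HL: "torus_L2 (H j) \<le> D * (torus_L2 (\<lambda>\<theta>. a \<theta> * F \<theta>) + (\<rho> / q) ^ K * (B * M * W))" for j
    proof -
      have "cmod (?\<zeta> ^ j * of_real \<rho>) = \<rho>" using \<rho>(1) by (simp add: norm_mult norm_power)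
      then have "torus_L2 (H j) \<le> D * torus_L2 (\<lambda>\<theta>. a \<theta> * H j \<theta> - ?\<zeta> ^ j * of_real \<rho> * H j (\<theta> + \<alpha>))"
        by (rule low[OF _ Hc])
      also have "(\<lambda>\<theta>. a \<theta> * H j \<theta> - ?\<zeta> ^ j * of_real \<rho> * H j (\<theta> + \<alpha>)) = (\<lambda>\<theta>. a \<theta> * F \<theta> + ?R \<theta>)"
        unfolding AH by simp
      also have "torus_L2 (\<lambda>\<theta>. a \<theta> * F \<theta> + ?R \<theta>) \<le> torus_L2 (\<lambda>\<theta>. a \<theta> * F \<theta>) + torus_L2 ?R"
        by (rule torus_L2_triangle[OF aF R])
      finally show ?thesis using Rle D by (meson add_left_mono mult_left_mono order_trans)
    qed
    have avg: "(\<Sum>j<K. H j \<theta>) = of_nat K * F \<theta>" for \<theta>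
    proof -
      have "(\<Sum>j<K. H j \<theta>) = (\<Sum>n<K. (\<Sum>j<K. ?\<zeta> ^ (j * n)) * (of_real \<rho> ^ n * g n \<theta>))"
        unfolding H_def by (subst sum.swap) (simp add: sum_distrib_right mult.assoc)
      also have "\<dots> = (\<Sum>n<K. if n = 0 then of_nat K * F \<theta> else 0)"
        by (intro sum.cong) (auto simp: sum_roots_of_unity g0)
      finally show ?thesis using K by simp
    qed
    have "real K * torus_L2 F = torus_L2 (\<lambda>\<theta>. \<Sum>j<K. H j \<theta>)" unfolding avg by (simp add: torus_L2_cmult)
    also have "\<dots> \<le> (\<Sum>j<K. torus_L2 (H j))" by (intro torus_L2_sum Hc) auto
    also have "\<dots> \<le> (\<Sum>j<K. D * (torus_L2 (\<lambda>\<theta>. a \<theta> * F \<theta>) + (\<rho> / q) ^ K * (B * M * W)))" by (intro sum_mono HL)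
    finally show ?thesis using K by simp
  qed
  have "(\<lambda>K. D * (torus_L2 (\<lambda>\<theta>. a \<theta> * F \<theta>) + (\<rho> / q) ^ K * (B * M * W))) \<longlonglongrightarrow>
      D * (torus_L2 (\<lambda>\<theta>. a \<theta> * F \<theta>) + 0 * (B * M * W))"
    using \<rho> q by (intro tendsto_intros LIMSEQ_realpow_zero) (auto simp: divide_less_eq)
  then have "torus_L2 F \<le> D * (torus_L2 (\<lambda>\<theta>. a \<theta> * F \<theta>) + 0 * (B * M * W))"
    by (rule LIMSEQ_le_const) (use main in \<open>auto intro!: exI[of _ 1]\<close>)
  then show ?thesis by simp
qed

text \<open>A lower bound at the real point \<open>x = V \<theta>0\<close> persists, with half the quality, for \<open>z = x + i y\<close> and a
slightly smaller modulus \<open>\<rho>\<close> of the coupling, for which the preceding lemma bounds the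
multiplication by \<open>z - V\<close> below. That is absurd for a function concentrated where \<open>\<bar>x - V\<bar> < y\<close>.\<close>

theorem cocycle_op_not_invertible_in_range:
  fixes V :: "real ^ 'd \<Rightarrow> real"
  assumes \<alpha>: "rationally_independent \<alpha>" and V: "torus_cont V"
    and G: "\<And>y. y > 0 \<Longrightarrow> cmod \<mu> \<le> exp (torus_mean (\<lambda>\<theta>. ln (cmod (Complex (V \<theta>0) y - of_real (V \<theta>)))))"
  shows "\<not> ell2_invertible (cocycle_op \<alpha> (\<lambda>\<theta>. of_real (V \<theta>0) - of_real (V \<theta>)) \<mu>)"
proof
  let ?x = "complex_of_real (V \<theta>0)"
  assume inv: "ell2_invertible (cocycle_op \<alpha> (\<lambda>\<theta>. ?x - of_real (V \<theta>)) \<mu>)"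
  have ac: "torus_cont (\<lambda>\<theta>. z - complex_of_real (V \<theta>))" for z
    by (intro torus_cont_diff torus_cont_const torus_cont_of_real V)
  obtain C where C: "C > 0" "\<And>\<mu>' F. cmod \<mu>' = cmod \<mu> \<Longrightarrow> torus_cont F \<Longrightarrow>
      torus_L2 F \<le> C * torus_L2 (\<lambda>\<theta>. (?x - of_real (V \<theta>)) * F \<theta> - \<mu>' * F (\<theta> + \<alpha>))"
    using cocycle_op_invertible_lower_bound[OF \<alpha> ac inv] by blast
  \<comment> \<open>The height \<open>y\<close> and the loss \<open>\<bar>\<mu>\<bar> - \<rho>\<close> are so small that together they cost at most half of the
    lower bound: \<open>C (y + 1 / (4 C)) = 5/16\<close>.\<close>
  define y where "y = 1 / (16 * C)"
  define \<rho> where "\<rho> = max 0 (cmod \<mu> - 1 / (4 * C))"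
  have y: "y > 0" using C(1) by (simp add: y_def)
  have \<rho>0: "0 \<le> \<rho>" by (simp add: \<rho>_def)
  have \<rho>\<mu>: "cmod \<mu> - \<rho> \<le> 1 / (4 * C)" "\<rho> \<le> cmod \<mu>" using C(1) by (auto simp: \<rho>_def)
  have \<rho>lt: "\<rho> < exp (torus_mean (\<lambda>\<theta>. ln (cmod (Complex (V \<theta>0) y - of_real (V \<theta>)))))"
  proof (cases "\<mu> = 0")
    case False
    have "\<rho> < cmod \<mu>" using False C(1) by (auto simp: \<rho>_def)
    then show ?thesis using G[OF y] by (rule less_le_trans)
  qed (use C(1) in \<open>simp add: \<rho>_def\<close>)
  let ?z = "Complex (V \<theta>0) y"
  let ?a = "\<lambda>\<theta>. ?z - complex_of_real (V \<theta>)"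
  have low: "torus_L2 F \<le> (2 * C) * torus_L2 (\<lambda>\<theta>. ?a \<theta> * F \<theta> - \<nu> * F (\<theta> + \<alpha>))"
    if \<nu>: "cmod \<nu> = \<rho>" and F: "torus_cont F" for \<nu> F
  proof -
    \<comment> \<open>The number of modulus \<open>\<bar>\<mu>\<bar>\<close> with the argument of \<open>\<nu>\<close>.\<close>
    obtain \<mu>' where \<mu>': "cmod \<mu>' = cmod \<mu>" "cmod (\<nu> - \<mu>') = cmod \<mu> - \<rho>"
    proof (cases "\<nu> = 0")
      case True
      then show ?thesis using \<nu> by (intro that[of \<mu>]) auto
    next
      case False
      then have "\<rho> > 0" using \<nu> by auto
      let ?m = "of_real (cmod \<mu> / \<rho>) * \<nu>"
      have "cmod ?m = cmod \<mu>" using \<open>\<rho> > 0\<close> by (simp add: norm_mult norm_divide \<nu>)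
      moreover have "\<nu> - ?m = of_real (1 - cmod \<mu> / \<rho>) * \<nu>" by (simp add: algebra_simps)
      then have "cmod (\<nu> - ?m) = \<bar>1 - cmod \<mu> / \<rho>\<bar> * \<rho>" by (simp only: norm_mult norm_of_real \<nu>)
      then have "cmod (\<nu> - ?m) = cmod \<mu> - \<rho>" using \<open>\<rho> > 0\<close> \<rho>\<mu>(2) by (simp add: abs_if field_simps)
      ultimately show ?thesis by (rule that)
    qed
    let ?A = "\<lambda>\<theta>. ?a \<theta> * F \<theta> - \<nu> * F (\<theta> + \<alpha>)" and ?B = "\<lambda>\<theta>. (?x - of_real (V \<theta>)) * F \<theta> - \<mu>' * F (\<theta> + \<alpha>)"
    have FT: "torus_cont (\<lambda>\<theta>. F (\<theta> + \<alpha>))" by (rule torus_cont_translate[OF F])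
    have Ac: "torus_cont ?A" and Bc: "torus_cont ?B"
      by (intro torus_cont_diff[OF torus_cont_mult[OF ac F]] torus_cont_mult torus_cont_const FT)+
    have diff: "?B \<theta> - ?A \<theta> = (- \<i> * y) * F \<theta> + (\<nu> - \<mu>') * F (\<theta> + \<alpha>)" for \<theta>
      by (simp add: Complex_eq algebra_simps)
    have "torus_L2 ?B \<le> torus_L2 ?A + torus_L2 (\<lambda>\<theta>. ?B \<theta> - ?A \<theta>)" by (rule torus_L2_triangle_diff[OF Bc Ac])
    also have "torus_L2 (\<lambda>\<theta>. ?B \<theta> - ?A \<theta>) \<le> torus_L2 (\<lambda>\<theta>. (- \<i> * y) * F \<theta>) + torus_L2 (\<lambda>\<theta>. (\<nu> - \<mu>') * F (\<theta> + \<alpha>))"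
      unfolding diff by (intro torus_L2_triangle torus_cont_mult torus_cont_const F FT)
    also have "\<dots> = y * torus_L2 F + (cmod \<mu> - \<rho>) * torus_L2 F"
      unfolding torus_L2_cmult torus_L2_translate[OF F] \<mu>'(2) using y by (simp add: norm_mult)
    also have "\<dots> \<le> 1 / (16 * C) * torus_L2 F + 1 / (4 * C) * torus_L2 F"
      unfolding y_def by (intro add_mono mult_right_mono \<rho>\<mu>) auto
    finally have "C * torus_L2 ?B \<le> C * (torus_L2 ?A + (1 / (16 * C) * torus_L2 F + 1 / (4 * C) * torus_L2 F))"
      using C(1) by (simp add: mult_left_mono)
    also have "\<dots> = C * torus_L2 ?A + 5 / 16 * torus_L2 F" using C(1) by (simp add: field_simps)
    finally have "torus_L2 F \<le> C * torus_L2 ?A + 5 / 16 * torus_L2 F"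
      using C(2)[OF \<mu>'(1) F] by linarith
    then show ?thesis using torus_L2_nonneg[of F] by linarith
  qed
  \<comment> \<open>A continuous function supported where \<open>\<bar>z - V\<bar> \<le> 2 y\<close>.\<close>
  let ?f = "\<lambda>\<theta>. max 0 (y - \<bar>V \<theta>0 - V \<theta>\<bar>)"
  let ?F = "\<lambda>\<theta>. complex_of_real (?f \<theta>)"
  have "torus_cont (\<lambda>\<theta>. max 0 (y - norm (V \<theta>0 - V \<theta>)))"
    by (intro torus_cont_max torus_cont_diff torus_cont_norm torus_cont_const V)
  then have F: "torus_cont ?F" by (intro torus_cont_of_real) simp
  have nz: "?a \<theta> \<noteq> 0" for \<theta> using y by (simp add: complex_eq_iff)
  have "torus_L2 ?F \<le> (2 * C) * torus_L2 (\<lambda>\<theta>. ?a \<theta> * ?F \<theta>)"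
    by (rule lower_bound_imp_multiplier_lower_bound[OF \<alpha> ac nz \<rho>0 \<rho>lt _ low F]) (use C(1) in auto)
  also have "torus_L2 (\<lambda>\<theta>. ?a \<theta> * ?F \<theta>) \<le> (2 * y) * torus_L2 ?F"
  proof (rule torus_L2_mono[OF torus_cont_mult[OF ac F] F])
    fix \<theta>
    show "cmod (?a \<theta> * ?F \<theta>) \<le> 2 * y * cmod (?F \<theta>)"
    proof (cases "\<bar>V \<theta>0 - V \<theta>\<bar> < y")
      case True
      have "cmod (?a \<theta>) \<le> \<bar>V \<theta>0 - V \<theta>\<bar> + \<bar>y\<bar>"
        using cmod_le[of "?a \<theta>"] by simp
      also have "\<dots> \<le> 2 * y" using True y by simp
      finally show ?thesis unfolding norm_mult by (intro mult_right_mono) auto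
    qed simp
  qed (use y in simp)
  finally have "torus_L2 ?F \<le> (2 * C) * ((2 * y) * torus_L2 ?F)" using C(1) by (simp add: mult_left_mono)
  also have "\<dots> = torus_L2 ?F / 4" using C(1) by (simp add: y_def)
  finally have "torus_L2 ?F \<le> 0" by simp
  moreover have "torus_L2 ?F > 0" by (rule torus_L2_pos[OF F, of \<theta>0]) (use y in simp)
  ultimately show False by simp
qed

section \<open>Sublevel sets and logarithmic integrals\<close>

text \<open>The constant in the sublevel set estimate for the derivative of order \<open>k\<close>: two intervals from
the induction hypothesis, and one exceptional interval.\<close>

primrec sublevel_const :: "nat \<Rightarrow> real" where
  "sublevel_const 0 = 0"
| "sublevel_const (Suc k) = 2 * sublevel_const k + 4"

lemma sublevel_const_nonneg: "0 \<le> sublevel_const k"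
  by (induction k) auto

lemma constant_sign_on_interval:
  fixes g :: "real \<Rightarrow> real"
  assumes "is_interval I" "continuous_on I g" "c > 0" "\<And>t. t \<in> I \<Longrightarrow> c \<le> \<bar>g t\<bar>"
  obtains s where "s = 1 \<or> s = -1" "\<And>t. t \<in> I \<Longrightarrow> c \<le> s * g t"
proof (cases "\<forall>t\<in>I. c \<le> g t")
  case True
  then show ?thesis using that[of 1] by auto
next
  case False
  then obtain a where a: "a \<in> I" "g a < c" by auto
  then have a': "g a \<le> - c" using assms(4)[of a] by linarith
  have "c \<le> - 1 * g t" if t: "t \<in> I" for t
  proof (rule ccontr)
    assume "\<not> ?thesis"
    then have "c \<le> g t" using assms(4)[OF t] by linarith
    moreover have "connected (g ` I)"
      using assms(1,2) by (intro connected_continuous_image is_interval_connected)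
    ultimately have "0 \<in> g ` I"
      using a' assms(3) connectedD_interval[of "g ` I" "g a" "g t" 0] a(1) t by auto
    then show False using assms(3,4) by force
  qed
  then show ?thesis using that[of "-1"] by blast
qed

text \<open>An estimate of van der Corput type, by induction on the order of the derivative. The derivative of order \<open>k + 1\<close> bounds
the slope of \<open>g k\<close> below, so that \<open>\<bar>g k\<bar> < c \<surd>r\<close> only on a set of measure \<open>4 \<surd>r\<close>; its complement consists of
two intervals, where the induction hypothesis applies with \<open>c \<surd>r\<close> and \<open>\<surd>r\<close> in place of \<open>c\<close> and \<open>r\<close>.
Only the exponent being positive matters later, and taking square roots in each step gives
the exponent \<open>2\<^sup>-\<^sup>k\<close>.\<close>

lemma emeasure_sublevel_le:
  fixes g :: "nat \<Rightarrow> real \<Rightarrow> real"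
  assumes "\<And>i t. i < k \<Longrightarrow> (g i has_real_derivative g (Suc i) t) (at t)"
    and "continuous_on UNIV (g k)"
    and "compact I" "is_interval I"
    and "c > 0" "\<And>t. t \<in> I \<Longrightarrow> c \<le> \<bar>g k t\<bar>"
    and "0 < r" "r < 1"
  shows "emeasure lborel {t\<in>I. \<bar>g 0 t\<bar> \<le> c * r} \<le> ennreal (sublevel_const k * r powr (1 / 2 ^ k))"
  using assms
proof (induction k arbitrary: I c r)
  case 0
  have "{t\<in>I. \<bar>g 0 t\<bar> \<le> c * r} = {}"
  proof -
    have "c * r < c" using 0 by simp
    then show ?thesis using 0(6) by force
  qed
  then show ?case by (simp only: emeasure_empty) simp
next
  case (Suc k)
  have der: "(g k has_real_derivative g (Suc k) t) (at t)" for t using Suc.prems(1) by blast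
  have contk: "continuous_on A (g k)" for A
    using der by (meson DERIV_isCont continuous_at_imp_continuous_on)
  have cont0: "continuous_on A (g 0)" for A
    using Suc.prems(1)[of 0] by (meson DERIV_isCont continuous_at_imp_continuous_on zero_less_Suc)
  obtain s where s: "s = 1 \<or> s = -1" "\<And>t. t \<in> I \<Longrightarrow> c \<le> s * g (Suc k) t"
    using constant_sign_on_interval[OF Suc.prems(4) continuous_on_subset[OF Suc.prems(2) subset_UNIV] Suc.prems(5,6)] by blast
  have mono: "c * (v - u) \<le> s * (g k v - g k u)" if "u \<in> I" "v \<in> I" "u \<le> v" for u v
  proof (cases "u = v")
    case False
    then have "u < v" using that by simp
    then obtain \<xi> where \<xi>: "u < \<xi>" "\<xi> < v" "g k v - g k u = (v - u) * g (Suc k) \<xi>"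
      using MVT2[of u v "g k" "g (Suc k)"] der by blast
    have "\<xi> \<in> I" using Suc.prems(4) that \<xi> by (meson is_interval_1 less_imp_le)
    then have "c * (v - u) \<le> s * g (Suc k) \<xi> * (v - u)" using s(2) \<open>u < v\<close> by (intro mult_right_mono) auto
    then show ?thesis unfolding \<xi>(3) by (simp add: mult_ac)
  qed simp
  \<comment> \<open>The threshold \<open>\<eta>\<close> balances the two contributions: \<open>\<eta> / c\<close> and \<open>c r / \<eta>\<close> are both \<open>\<surd>r\<close>.\<close>
  define \<eta> where "\<eta> = c * sqrt r"
  have sq: "sqrt r > 0" "sqrt r < 1" using Suc.prems(7,8) by auto
  have \<eta>: "\<eta> > 0" "\<eta> * sqrt r = c * r" using Suc.prems(5,7) by (simp_all add: \<eta>_def mult.assoc)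
  have pw: "sqrt r powr (1 / 2 ^ k) = r powr (1 / 2 ^ Suc k)"
    using Suc.prems(7) by (simp add: powr_half_sqrt[symmetric] powr_powr)
  let ?E = "\<lambda>J. {t\<in>J. \<bar>g 0 t\<bar> \<le> c * r}"
  have sub: "emeasure lborel (?E J) \<le> ennreal (sublevel_const k * r powr (1 / 2 ^ Suc k))"
    if "compact J" "is_interval J" "\<And>t. t \<in> J \<Longrightarrow> \<eta> \<le> \<bar>g k t\<bar>" for J
    using Suc.IH[OF _ contk that(1,2) \<eta>(1) that(3) sq] Suc.prems(1) unfolding pw \<eta>(2) by simp
  have closedE: "closed {t. P (g k t)}" if "closed {y. P y}" for P
    using continuous_closed_vimage[OF that, of "g k"] der DERIV_isCont by (simp add: vimage_def) blast
  \<comment> \<open>Monotonicity of \<open>g k\<close> makes both sets intervals.\<close>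
  define J1 where "J1 = {t\<in>I. g k t \<le> - \<eta>}"
  define J2 where "J2 = {t\<in>I. \<eta> \<le> g k t}"
  define N where "N = {t\<in>I. \<bar>g k t\<bar> < \<eta>}"
  have J1: "compact J1" "is_interval J1"
  proof -
    have "J1 = I \<inter> {t. g k t \<le> - \<eta>}" by (auto simp: J1_def)
    moreover have "closed {t. g k t \<le> - \<eta>}" by (rule closedE) (simp add: closed_Collect_le)
    ultimately show "compact J1" using Suc.prems(3) by (simp add: compact_Int_closed)
    show "is_interval J1"
      unfolding is_interval_1
    proof (intro ballI allI impI)
      fix a b x assume ab: "a \<in> J1" "b \<in> J1" "a \<le> x \<and> x \<le> b"
      then have x: "x \<in> I" using Suc.prems(4) by (auto simp: J1_def is_interval_1)
      then show "x \<in> J1" using mono[of a x] mono[of x b] ab s(1) Suc.prems(5)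
        by (auto simp: J1_def) (smt (verit) mult_nonneg_nonneg)+
    qed
  qed
  have J2: "compact J2" "is_interval J2"
  proof -
    have "J2 = I \<inter> {t. \<eta> \<le> g k t}" by (auto simp: J2_def)
    moreover have "closed {t. \<eta> \<le> g k t}" by (rule closedE) (simp add: closed_Collect_le)
    ultimately show "compact J2" using Suc.prems(3) by (simp add: compact_Int_closed)
    show "is_interval J2"
      unfolding is_interval_1
    proof (intro ballI allI impI)
      fix a b x assume ab: "a \<in> J2" "b \<in> J2" "a \<le> x \<and> x \<le> b"
      then have x: "x \<in> I" using Suc.prems(4) by (auto simp: J2_def is_interval_1)
      then show "x \<in> J2" using mono[of a x] mono[of x b] ab s(1) Suc.prems(5)
        by (auto simp: J2_def) (smt (verit) mult_nonneg_nonneg)+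
    qed
  qed
  have N: "emeasure lborel N \<le> ennreal (4 * r powr (1 / 2 ^ Suc k))"
  proof (cases "N = {}")
    case False
    then obtain u where u: "u \<in> N" by blast
    have "N \<subseteq> {u - 2 * sqrt r .. u + 2 * sqrt r}"
    proof
      fix v assume v: "v \<in> N"
      have "c * \<bar>v - u\<bar> \<le> \<bar>g k v - g k u\<bar>"
        using mono[of u v] mono[of v u] u v s(1) by (cases "u \<le> v") (auto simp: N_def)
      also have "\<dots> \<le> c * (2 * sqrt r)" using u v by (auto simp: N_def \<eta>_def)
      finally have "\<bar>v - u\<bar> \<le> 2 * sqrt r" using Suc.prems(5) by simp
      then show "v \<in> {u - 2 * sqrt r .. u + 2 * sqrt r}" by auto
    qed
    then have "emeasure lborel N \<le> emeasure lborel {u - 2 * sqrt r .. u + 2 * sqrt r}"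
      by (intro emeasure_mono) auto
    also have "\<dots> = ennreal (4 * sqrt r)" using sq by simp
    also have "\<dots> \<le> ennreal (4 * r powr (1 / 2 ^ Suc k))"
    proof -
      have "r powr (1 / 2) \<le> r powr (1 / 2 ^ Suc k)"
        using Suc.prems(7,8) by (intro powr_mono') (auto simp: divide_simps)
      then show ?thesis using Suc.prems(7) by (intro ennreal_leI) (simp add: powr_half_sqrt)
    qed
    finally show ?thesis .
  qed simp
  have E: "?E J \<in> sets lborel" if "compact J" for J
  proof -
    have "closed {t. \<bar>g 0 t\<bar> \<le> c * r}"
      by (intro closed_Collect_le continuous_on_rabs cont0 continuous_on_const)
    moreover have "?E J = J \<inter> {t. \<bar>g 0 t\<bar> \<le> c * r}" by auto
    ultimately show ?thesis using that by (simp add: borel_closed compact_imp_closed closed_Int)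
  qed
  have Nm: "N \<in> sets lborel"
  proof -
    have "open {t. \<bar>g k t\<bar> < \<eta>}"
      by (intro open_Collect_less continuous_on_rabs contk continuous_on_const)
    moreover have "N = I \<inter> {t. \<bar>g k t\<bar> < \<eta>}" by (auto simp: N_def)
    moreover have "closed I" using Suc.prems(3) by (rule compact_imp_closed)
    ultimately show ?thesis by (metis borel_closed borel_open sets.Int sets_lborel)
  qed
  have "emeasure lborel (?E I) \<le> emeasure lborel (?E J1 \<union> (?E J2 \<union> N))"
    using E[OF J1(1)] E[OF J2(1)] Nm by (intro emeasure_mono) (auto simp: J1_def J2_def N_def)
  also have "\<dots> \<le> emeasure lborel (?E J1) + emeasure lborel (?E J2 \<union> N)"
    using E[OF J1(1)] E[OF J2(1)] Nm by (intro emeasure_subadditive) auto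
  also have "emeasure lborel (?E J2 \<union> N) \<le> emeasure lborel (?E J2) + emeasure lborel N"
    using E[OF J2(1)] Nm by (intro emeasure_subadditive) auto
  also have "emeasure lborel (?E J1) + (emeasure lborel (?E J2) + emeasure lborel N)
      \<le> ennreal (sublevel_const k * r powr (1 / 2 ^ Suc k)) + (ennreal (sublevel_const k * r powr (1 / 2 ^ Suc k))
        + ennreal (4 * r powr (1 / 2 ^ Suc k)))"
    using \<eta>(1) by (intro add_mono sub J1 J2 N) (auto simp: J1_def J2_def)
  also have "\<dots> = ennreal (sublevel_const (Suc k) * r powr (1 / 2 ^ Suc k))"
    using sublevel_const_nonneg[of k] by (simp flip: ennreal_plus add: algebra_simps)
  finally show ?case by (simp add: add_left_mono)
qed

text \<open>Up to a constant, \<open>- ln h\<close> is at most the number of thresholds \<open>c e\<^sup>-\<^sup>n\<close> that lie above \<open>h\<close>. Integration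
turns this into a sum of measures of sublevel sets.\<close>

lemma neg_ln_le_count:
  fixes c h \<tau> :: real
  assumes "c > 0" "\<tau> > 0"
  shows "ennreal (- ln (max \<tau> h)) \<le> ennreal (1 + \<bar>ln c\<bar>) + (\<Sum>n. indicator {y. y \<le> c * exp (- real (Suc n))} h)"
proof -
  define y where "y = max \<tau> h"
  have y: "y > 0" "h \<le> y" using assms by (auto simp: y_def)
  define N where "N = nat \<lfloor>ln c - ln y\<rfloor>"
  have "ln c - ln y - 1 \<le> real N" unfolding N_def by linarith
  then have "- ln y \<le> (1 + \<bar>ln c\<bar>) + real N" by linarith
  then have "ennreal (- ln y) \<le> ennreal (1 + \<bar>ln c\<bar>) + of_nat N"
    by (metis ennreal_leI ennreal_of_nat_eq_real_of_nat ennreal_plus abs_ge_zero add_nonneg_nonneg of_nat_0_le_iff zero_le_one)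
  also have "of_nat N = (\<Sum>n<N. indicator {y. y \<le> c * exp (- real (Suc n))} h :: ennreal)"
  proof -
    have "h \<le> c * exp (- real (Suc n))" if "n < N" for n
    proof -
      have "real (Suc n) \<le> ln c - ln y" using that unfolding N_def by linarith
      then have "ln y \<le> ln c - real (Suc n)" by linarith
      then have "exp (ln y) \<le> exp (ln c + - real (Suc n))" by simp
      then have "y \<le> c * exp (- real (Suc n))" unfolding exp_add using y assms by simp
      then show ?thesis using y by simp
    qed
    then show ?thesis by simp
  qed
  also have "\<dots> \<le> (\<Sum>n. indicator {y. y \<le> c * exp (- real (Suc n))} h)"
    by (rule sum_le_suminf) auto
  finally show ?thesis by (simp add: y_def add_left_mono)
qed

text \<open>The bound does not depend on the function nor on the truncation \<open>\<tau>\<close>, only on the sublevel estimate.\<close>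

lemma nn_integral_neg_ln_le:
  fixes c C p \<delta> :: real
  assumes "c > 0" "C \<ge> 0" "p > 0" "\<delta> > 0"
  shows "\<exists>L. \<forall>h \<tau>. continuous_on UNIV h \<longrightarrow>
     (\<forall>r. 0 < r \<longrightarrow> r < 1 \<longrightarrow> emeasure lborel {t\<in>{0..\<delta>}. \<bar>h t\<bar> \<le> c * r} \<le> ennreal (C * r powr p)) \<longrightarrow> \<tau> > 0 \<longrightarrow>
     (\<integral>\<^sup>+t. ennreal (- ln (max \<tau> \<bar>h t\<bar>)) * indicator {0..\<delta>} t \<partial>lborel) \<le> ennreal L"
proof -
  define q where "q = exp (- p)"
  have q: "0 < q" "q < 1" using assms by (simp_all add: q_def)
  define L where "L = (1 + \<bar>ln c\<bar>) * \<delta> + C * (q / (1 - q))"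
  have sums: "(\<lambda>n. C * q ^ Suc n) sums (C * (q / (1 - q)))"
    using geometric_sums[of q] q by (intro sums_mult) (auto simp: sums_mult_iff dest: sums_mult[of _ _ q])
  have "(\<integral>\<^sup>+t. ennreal (- ln (max \<tau> \<bar>h t\<bar>)) * indicator {0..\<delta>} t \<partial>lborel) \<le> ennreal L"
    if h: "continuous_on UNIV h" and \<tau>: "\<tau> > 0"
      and sub: "\<And>r. 0 < r \<Longrightarrow> r < 1 \<Longrightarrow> emeasure lborel {t\<in>{0..\<delta>}. \<bar>h t\<bar> \<le> c * r} \<le> ennreal (C * r powr p)" for h \<tau>
  proof -
    let ?S = "\<lambda>n. {t\<in>{0..\<delta>}. \<bar>h t\<bar> \<le> c * exp (- real (Suc n))}"
    have Sm: "?S n \<in> sets lborel" for n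
    proof -
      have "closed {t. \<bar>h t\<bar> \<le> c * exp (- real (Suc n))}"
        by (intro closed_Collect_le continuous_on_rabs h continuous_on_const)
      moreover have "?S n = {0..\<delta>} \<inter> {t. \<bar>h t\<bar> \<le> c * exp (- real (Suc n))}" by auto
      ultimately show ?thesis by (auto intro!: sets.Int borel_closed)
    qed
    have "(\<integral>\<^sup>+t. ennreal (- ln (max \<tau> \<bar>h t\<bar>)) * indicator {0..\<delta>} t \<partial>lborel)
        \<le> (\<integral>\<^sup>+t. ennreal (1 + \<bar>ln c\<bar>) * indicator {0..\<delta>} t + (\<Sum>n. indicator (?S n) t) \<partial>lborel)"
    proof (rule nn_integral_mono)
      fix t
      show "ennreal (- ln (max \<tau> \<bar>h t\<bar>)) * indicator {0..\<delta>} t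
          \<le> ennreal (1 + \<bar>ln c\<bar>) * indicator {0..\<delta>} t + (\<Sum>n. indicator (?S n) t)"
      proof (cases "t \<in> {0..\<delta>}")
        case True
        then have "indicator (?S n) t = (indicator {y. y \<le> c * exp (- real (Suc n))} \<bar>h t\<bar> :: ennreal)" for n
          by (auto simp: indicator_def)
        then show ?thesis using neg_ln_le_count[OF assms(1) \<tau>, of "\<bar>h t\<bar>"] True by simp
      qed simp
    qed
    also have "\<dots> = (\<integral>\<^sup>+t. ennreal (1 + \<bar>ln c\<bar>) * indicator {0..\<delta>} t \<partial>lborel) + (\<integral>\<^sup>+t. (\<Sum>n. indicator (?S n) t) \<partial>lborel)"
      using Sm by (intro nn_integral_add) auto
    also have "(\<integral>\<^sup>+t. (\<Sum>n. indicator (?S n) t) \<partial>lborel) = (\<Sum>n. emeasure lborel (?S n))"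
      using Sm by (subst nn_integral_suminf) (auto simp: nn_integral_indicator)
    also have "\<dots> \<le> (\<Sum>n. ennreal (C * q ^ Suc n))"
    proof (intro suminf_le)
      fix n
      have "emeasure lborel (?S n) \<le> ennreal (C * exp (- real (Suc n)) powr p)" by (rule sub) auto
      also have "exp (- real (Suc n)) powr p = q ^ Suc n"
        unfolding q_def exp_of_nat_mult[symmetric] by (simp add: powr_def algebra_simps)
      finally show "emeasure lborel (?S n) \<le> ennreal (C * q ^ Suc n)" .
    qed auto
    also have "\<dots> = ennreal (C * (q / (1 - q)))"
      using sums q assms by (intro suminf_ennreal_eq) auto
    also have "(\<integral>\<^sup>+t. ennreal (1 + \<bar>ln c\<bar>) * indicator {0..\<delta>} t \<partial>lborel) = ennreal ((1 + \<bar>ln c\<bar>) * \<delta>)"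
      using assms ennreal_mult[of "1 + \<bar>ln c\<bar>" \<delta>] by (subst nn_integral_cmult_indicator) (simp_all del: ennreal_plus)
    also have "ennreal ((1 + \<bar>ln c\<bar>) * \<delta>) + ennreal (C * (q / (1 - q))) = ennreal L"
      unfolding L_def using q assms by (intro ennreal_plus[symmetric]) auto
    finally show ?thesis by (simp add: add_left_mono)
  qed
  then show ?thesis by blast
qed

section \<open>Means along orbits of the flow\<close>

text \<open>The average of \<open>(V - c)\<^sup>2\<close> along the orbit is zero, and it converges to the mean, since the
coboundary in \<open>approximate_coboundary\<close> telescopes.\<close>

lemma constant_on_orbit_imp_constant:
  fixes V :: "real ^ 'd \<Rightarrow> real"
  assumes \<alpha>: "rationally_independent \<alpha>" and V: "torus_cont V"
    and orbit: "\<And>j::nat. V (\<theta>0 + real j *\<^sub>R \<alpha>) = c"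
  shows "V \<theta> = c"
proof -
  define \<psi> where "\<psi> \<theta> = (V \<theta> - c)\<^sup>2" for \<theta>
  have \<psi>: "torus_cont \<psi>" unfolding \<psi>_def[abs_def] by (intro torus_cont_power torus_cont_diff torus_cont_const V)
  have "torus_mean (\<lambda>_::real ^ 'd. 0) \<le> torus_mean \<psi>"
    by (intro torus_mean_mono torus_cont_const \<psi>) (simp add: \<psi>_def)
  then have m0: "0 \<le> torus_mean \<psi>" by simp
  have "torus_mean \<psi> = 0"
  proof (rule ccontr)
    assume "torus_mean \<psi> \<noteq> 0"
    then have m: "torus_mean \<psi> / 2 > 0" using m0 by simp
    obtain w :: "real ^ 'd \<Rightarrow> real"
      where w: "torus_cont w" "\<And>\<theta>. \<bar>\<psi> \<theta> - torus_mean \<psi> - (w (\<theta> + \<alpha>) - w \<theta>)\<bar> < torus_mean \<psi> / 2"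
      using approximate_coboundary[OF \<alpha> \<psi> m] by blast
    obtain B where B: "B > 0" "\<And>\<theta>. norm (w \<theta>) \<le> B" using torus_cont_bounded[OF w(1)] by blast
    have step: "w (\<theta>0 + real j *\<^sub>R \<alpha>) \<le> w \<theta>0 - real j * (torus_mean \<psi> / 2)" for j :: nat
    proof (induction j)
      case (Suc j)
      have e1: "\<psi> (\<theta>0 + real j *\<^sub>R \<alpha>) = 0" by (simp add: \<psi>_def orbit)
      have e2: "\<theta>0 + real j *\<^sub>R \<alpha> + \<alpha> = \<theta>0 + real (Suc j) *\<^sub>R \<alpha>" by (simp add: algebra_simps)
      have "w (\<theta>0 + real (Suc j) *\<^sub>R \<alpha>) \<le> w (\<theta>0 + real j *\<^sub>R \<alpha>) - torus_mean \<psi> / 2"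
        using w(2)[of "\<theta>0 + real j *\<^sub>R \<alpha>"] unfolding e1 e2 abs_less_iff by linarith
      also have "\<dots> \<le> w \<theta>0 - real j * (torus_mean \<psi> / 2) - torus_mean \<psi> / 2" using Suc by linarith
      also have "\<dots> = w \<theta>0 - real (Suc j) * (torus_mean \<psi> / 2)" by (simp add: field_simps)
      finally show ?case .
    qed simp
    obtain j :: nat where j: "2 * B / (torus_mean \<psi> / 2) < real j" using reals_Archimedean2 by blast
    then have "2 * B < real j * (torus_mean \<psi> / 2)" using m by (simp add: divide_less_eq)
    moreover have "- B \<le> w (\<theta>0 + real j *\<^sub>R \<alpha>)" "w \<theta>0 \<le> B"
      using B(2)[of "\<theta>0 + real j *\<^sub>R \<alpha>"] B(2)[of \<theta>0] by auto
    ultimately show False using step[of j] by linarith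
  qed
  then have "\<psi> \<theta> = 0" by (intro torus_mean_eq_0_imp[OF \<psi>]) (auto simp: \<psi>_def)
  then show ?thesis by (simp add: \<psi>_def)
qed

text \<open>By translation invariance, the mean of \<open>f\<close> equals the mean of its averages over the orbit segments
\<open>\<theta> + [0, \<delta>] \<alpha>\<close>.\<close>

lemma torus_mean_le_of_segments:
  fixes f :: "real ^ 'd \<Rightarrow> real"
  assumes f: "torus_cont f" "\<And>\<theta>. 0 \<le> f \<theta>" and "\<delta> > 0" "L \<ge> 0"
    and seg: "\<And>\<theta>. \<theta> \<in> cbox 0 1 \<Longrightarrow> (\<integral>\<^sup>+t. ennreal (f (\<theta> + t *\<^sub>R \<alpha>)) * indicator {0..\<delta>} t \<partial>lborel) \<le> ennreal L"
  shows "torus_mean f \<le> L / \<delta>"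
proof -
  let ?Q = "cbox 0 1 :: (real ^ 'd) set"
  let ?g = "\<lambda>t \<theta>. ennreal (f (\<theta> + t *\<^sub>R \<alpha>)) * indicator {0..\<delta>} t * indicator ?Q \<theta>"
  have mean: "(\<integral>\<^sup>+\<theta>. ennreal (f (\<theta> + v)) * indicator ?Q \<theta> \<partial>lborel) = ennreal (torus_mean f)" for v
  proof -
    have fv: "torus_cont (\<lambda>\<theta>. f (\<theta> + v))" by (rule torus_cont_translate[OF f(1)])
    have "(\<integral>\<^sup>+\<theta>. ennreal (f (\<theta> + v)) * indicator ?Q \<theta> \<partial>lborel) = (\<integral>\<^sup>+\<theta>. ennreal (f (\<theta> + v)) \<partial>cube)"
      unfolding cube_def by (subst nn_integral_restrict_space) auto
    also have "\<dots> = ennreal (torus_mean (\<lambda>\<theta>. f (\<theta> + v)))"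
      unfolding torus_mean_def by (intro nn_integral_eq_integral torus_cont_integrable fv) (simp add: f(2))
    finally show ?thesis by (simp add: torus_mean_translate[OF f(1)])
  qed
  have cont: "continuous_on UNIV (\<lambda>p::real \<times> (real ^ 'd). f (snd p + fst p *\<^sub>R \<alpha>))"
    using f(1) by (auto simp: torus_cont_def intro!: continuous_on_compose2[of UNIV f] continuous_intros)
  have meas: "(\<lambda>p. ?g (fst p) (snd p)) \<in> borel_measurable (lborel \<Otimes>\<^sub>M lborel)"
  proof -
    have "(\<lambda>p::real \<times> (real ^ 'd). f (snd p + fst p *\<^sub>R \<alpha>)) \<in> borel_measurable (borel \<Otimes>\<^sub>M borel)"
      unfolding borel_prod by (rule borel_measurable_continuous_onI[OF cont])
    then have [measurable]: "(\<lambda>p::real \<times> (real ^ 'd). f (snd p + fst p *\<^sub>R \<alpha>)) \<in> borel_measurable (lborel \<Otimes>\<^sub>M lborel)"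
      by (simp cong: measurable_cong_sets)
    show ?thesis by measurable
  qed
  have "ennreal \<delta> * ennreal (torus_mean f) = (\<integral>\<^sup>+t. ennreal (torus_mean f) * indicator {0..\<delta>} t \<partial>lborel)"
    using \<open>\<delta> > 0\<close> by (subst nn_integral_cmult_indicator) (auto simp: mult.commute)
  also have "\<dots> = (\<integral>\<^sup>+t. (\<integral>\<^sup>+\<theta>. ?g t \<theta> \<partial>lborel) \<partial>lborel)"
  proof (rule nn_integral_cong)
    fix t
    have "(\<integral>\<^sup>+\<theta>. ?g t \<theta> \<partial>lborel) = (\<integral>\<^sup>+\<theta>. indicator {0..\<delta>} t * (ennreal (f (\<theta> + t *\<^sub>R \<alpha>)) * indicator ?Q \<theta>) \<partial>lborel)"
      by (simp add: mult_ac)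
    also have "\<dots> = indicator {0..\<delta>} t * (\<integral>\<^sup>+\<theta>. ennreal (f (\<theta> + t *\<^sub>R \<alpha>)) * indicator ?Q \<theta> \<partial>lborel)"
    proof -
      have [measurable]: "(\<lambda>\<theta>. f (\<theta> + t *\<^sub>R \<alpha>)) \<in> borel_measurable borel"
        using torus_cont_translate[OF f(1), of "t *\<^sub>R \<alpha>"]
        by (intro borel_measurable_continuous_onI) (simp add: torus_cont_def)
      show ?thesis by (rule nn_integral_cmult) measurable
    qed
    finally show "ennreal (torus_mean f) * indicator {0..\<delta>} t = (\<integral>\<^sup>+\<theta>. ?g t \<theta> \<partial>lborel)"
      unfolding mean by (simp add: mult.commute)
  qed
  also have "\<dots> = (\<integral>\<^sup>+\<theta>. (\<integral>\<^sup>+t. ?g t \<theta> \<partial>lborel) \<partial>lborel)"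
    using meas by (intro lborel_pair.Fubini'[symmetric]) (simp add: split_beta')
  also have "\<dots> \<le> (\<integral>\<^sup>+\<theta>. ennreal L * indicator ?Q \<theta> \<partial>lborel)"
  proof (rule nn_integral_mono)
    fix \<theta> :: "real ^ 'd"
    show "(\<integral>\<^sup>+t. ?g t \<theta> \<partial>lborel) \<le> ennreal L * indicator ?Q \<theta>"
      using seg[of \<theta>] by (cases "\<theta> \<in> ?Q") auto
  qed
  also have "\<dots> = ennreal L * emeasure lborel ?Q" by (rule nn_integral_cmult_indicator) simp
  also have "emeasure lborel ?Q = 1"
    using emeasure_cube[where 'd = 'd] by (simp add: cube_def emeasure_restrict_space space_restrict_space)
  finally have "ennreal (\<delta> * torus_mean f) \<le> ennreal L"
    using \<open>\<delta> > 0\<close> by (simp add: ennreal_mult')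
  then have "\<delta> * torus_mean f \<le> L" using \<open>L \<ge> 0\<close> by (simp add: ennreal_le_iff)
  then show ?thesis using \<open>\<delta> > 0\<close> by (simp add: field_simps)
qed

section \<open>Derivatives along the flow\<close>

text \<open>The power series at \<open>\<theta>0\<close> converges absolutely at a point with equal positive coordinates, and
hence uniformly for complex arguments of at most that size. Substituting \<open>\<theta> + s \<alpha>\<close> with complex \<open>s\<close> gives
a function that is holomorphic in \<open>s\<close> and jointly continuous.\<close>

lemma real_analytic_holomorphic_along_line:
  fixes V :: "real ^ 'd \<Rightarrow> real" and \<alpha> :: "real ^ 'd"
  assumes "real_analytic_on V UNIV"
  obtains \<rho> F where "\<rho> > 0"
    "\<And>\<theta>. \<theta> \<in> ball \<theta>0 \<rho> \<Longrightarrow> F \<theta> holomorphic_on ball 0 \<rho>"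
    "\<And>\<theta>. \<theta> \<in> ball \<theta>0 \<rho> \<Longrightarrow> continuous_on (cball 0 \<rho>) (F \<theta>)"
    "continuous_on (ball \<theta>0 \<rho> \<times> cball 0 \<rho>) (\<lambda>(\<theta>, s). F \<theta> s)"
    "\<And>\<theta> t. \<theta> \<in> ball \<theta>0 \<rho> \<Longrightarrow> \<bar>t\<bar> < \<rho> \<Longrightarrow> F \<theta> (complex_of_real t) = complex_of_real (V (\<theta> + t *\<^sub>R \<alpha>))"
proof -
  obtain c r where r: "r > 0" and V: "\<And>y. y \<in> ball \<theta>0 r \<Longrightarrow>
      ((\<lambda>m :: real ^ 'd \<Rightarrow> nat. (\<Prod>b\<in>Basis. ((y - \<theta>0) \<bullet> b) ^ m b) *\<^sub>R c m) has_sum V y) (Basis \<rightarrow>\<^sub>E UNIV)"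
    using assms[unfolded real_analytic_on_def, rule_format, OF UNIV_I, of \<theta>0] by blast
  let ?I = "Basis \<rightarrow>\<^sub>E UNIV :: (real ^ 'd \<Rightarrow> nat) set"
  define n where "n = real CARD('d)"
  have n: "n \<ge> 1" by (simp add: n_def Suc_leI)
  \<comment> \<open>The point with all coordinates \<open>\<sigma>\<close> has norm at most \<open>n \<sigma> = r / 2\<close>, so it lies in the ball of convergence.\<close>
  define \<sigma> where "\<sigma> = r / (2 * n)"
  have \<sigma>: "\<sigma> > 0" "\<sigma> \<le> r / 2" using r n by (simp_all add: \<sigma>_def field_simps)
  define M where "M m = \<bar>(\<Prod>b\<in>Basis. \<sigma> ^ m b) * c m\<bar>" for m :: "real ^ 'd \<Rightarrow> nat"
  have M: "M summable_on ?I"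
  proof -
    let ?y = "\<theta>0 + (\<Sum>b\<in>Basis. \<sigma> *\<^sub>R b)"
    have "norm (\<Sum>b\<in>Basis. \<sigma> *\<^sub>R (b :: real ^ 'd)) \<le> (\<Sum>b\<in>(Basis :: (real ^ 'd) set). \<sigma>)"
      using \<sigma> by (intro sum_norm_le) auto
    also have "\<dots> = r / 2" using n by (simp add: n_def \<sigma>_def)
    finally have "?y \<in> ball \<theta>0 r" using r by (simp add: dist_norm)
    then have "(\<lambda>m. (\<Prod>b\<in>Basis. ((?y - \<theta>0) \<bullet> b) ^ m b) *\<^sub>R c m) summable_on ?I"
      using V has_sum_imp_summable by blast
    moreover have "(\<Prod>b\<in>Basis. ((?y - \<theta>0) \<bullet> b) ^ m b) = (\<Prod>b\<in>Basis. \<sigma> ^ m b)" for m :: "real ^ 'd \<Rightarrow> nat"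
      by (intro prod.cong) (simp_all add: inner_sum_left inner_Basis if_distrib cong: if_cong)
    ultimately have "(\<lambda>m. (\<Prod>b\<in>Basis. \<sigma> ^ m b) * c m) summable_on ?I" by simp
    then show ?thesis
      by (subst (asm) summable_on_iff_abs_summable_on_real) (simp add: M_def[abs_def])
  qed
  define T where "T m = (\<lambda>(\<theta>::real ^ 'd, s). (\<Prod>b\<in>Basis. (complex_of_real ((\<theta> - \<theta>0) \<bullet> b) + s * complex_of_real (\<alpha> \<bullet> b)) ^ m b) * complex_of_real (c m))" for m
  \<comment> \<open>For \<open>\<bar>\<theta> - \<theta>0\<bar>\<close> and \<open>\<bar>s\<bar>\<close> below this radius, all coordinates of \<open>\<theta> - \<theta>0 + s \<alpha>\<close> are at most \<open>\<sigma>\<close>.\<close>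
  define \<rho> where "\<rho> = \<sigma> / (2 * (norm \<alpha> + 1))"
  have \<rho>: "\<rho> > 0" "\<rho> * norm \<alpha> \<le> \<sigma> / 2" "\<rho> \<le> \<sigma> / 2"
  proof -
    have p: "norm \<alpha> + 1 > 0" by (simp add: add_nonneg_pos)
    show "\<rho> > 0" unfolding \<rho>_def using \<sigma> p by (intro divide_pos_pos) auto
    have "\<rho> * norm \<alpha> = \<sigma> / 2 * (norm \<alpha> / (norm \<alpha> + 1))" by (simp add: \<rho>_def)
    also have "\<dots> \<le> \<sigma> / 2 * 1" using \<sigma> p by (intro mult_left_mono) (auto simp: divide_le_eq)
    finally show "\<rho> * norm \<alpha> \<le> \<sigma> / 2" by simp
    have "\<rho> = \<sigma> / 2 * (1 / (norm \<alpha> + 1))" by (simp add: \<rho>_def)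
    also have "\<dots> \<le> \<sigma> / 2 * 1" using \<sigma> p by (intro mult_left_mono) (auto simp: divide_le_eq)
    finally show "\<rho> \<le> \<sigma> / 2" by simp
  qed
  let ?Y = "ball \<theta>0 \<rho> \<times> cball (0::complex) \<rho>"
  have Tle: "norm (T m y) \<le> M m" if "y \<in> ?Y" for m y
  proof -
    obtain \<theta> s where y: "y = (\<theta>, s)" by fastforce
    have \<theta>: "norm (\<theta> - \<theta>0) \<le> \<sigma> / 2" and s: "cmod s \<le> \<rho>"
      using that \<rho>(3) unfolding y by (auto simp: dist_norm norm_minus_commute)
    have b: "cmod (complex_of_real ((\<theta> - \<theta>0) \<bullet> b) + s * complex_of_real (\<alpha> \<bullet> b)) \<le> \<sigma>" if "b \<in> Basis" for b
    proof -
      have "cmod (complex_of_real ((\<theta> - \<theta>0) \<bullet> b) + s * complex_of_real (\<alpha> \<bullet> b)) \<le> \<bar>(\<theta> - \<theta>0) \<bullet> b\<bar> + cmod s * \<bar>\<alpha> \<bullet> b\<bar>"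
        by (metis norm_triangle_ineq norm_mult norm_of_real)
      also have "\<dots> \<le> norm (\<theta> - \<theta>0) + \<rho> * norm \<alpha>"
        using s \<rho>(1) that by (intro add_mono mult_mono Basis_le_norm) auto
      finally show ?thesis using \<theta> \<rho>(2) by linarith
    qed
    have "norm (T m y) = (\<Prod>b\<in>Basis. cmod (complex_of_real ((\<theta> - \<theta>0) \<bullet> b) + s * complex_of_real (\<alpha> \<bullet> b)) ^ m b) * \<bar>c m\<bar>"
      by (simp add: T_def y norm_mult norm_power prod_norm[symmetric])
    also have "\<dots> \<le> (\<Prod>b\<in>Basis. \<sigma> ^ m b) * \<bar>c m\<bar>"
      using b by (intro mult_right_mono prod_mono) (auto intro: power_mono)
    also have "\<dots> = M m" using \<sigma> by (simp add: M_def abs_mult abs_prod)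
    finally show ?thesis .
  qed
  define F where "F \<theta> s = (\<Sum>\<^sub>\<infinity>m\<in>?I. T m (\<theta>, s))" for \<theta> s
  have unif: "uniform_limit ?Y (\<lambda>X y. \<Sum>m\<in>X. T m y) (\<lambda>y. \<Sum>\<^sub>\<infinity>m\<in>?I. T m y) (finite_subsets_at_top ?I)"
    by (rule Weierstrass_m_test_general[OF Tle M])
  have contT: "continuous_on A (\<lambda>y. \<Sum>m\<in>X. T m y)" for A X
    unfolding T_def split_beta' by (intro continuous_intros)
  have nt: "finite_subsets_at_top ?I \<noteq> bot" by (rule finite_subsets_at_top_neq_bot)
  have cont: "continuous_on ?Y (\<lambda>y. \<Sum>\<^sub>\<infinity>m\<in>?I. T m y)"
    by (rule uniform_limit_theorem[OF always_eventually unif nt]) (simp add: contT)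
  then have cont': "continuous_on ?Y (\<lambda>(\<theta>, s). F \<theta> s)"
    by (simp add: F_def split_beta')
  have hol: "F \<theta> holomorphic_on ball 0 \<rho> \<and> continuous_on (cball 0 \<rho>) (F \<theta>)" if \<theta>: "\<theta> \<in> ball \<theta>0 \<rho>" for \<theta>
  proof -
    have u: "uniform_limit (cball 0 \<rho>) (\<lambda>X s. \<Sum>m\<in>X. T m (\<theta>, s)) (F \<theta>) (finite_subsets_at_top ?I)"
      unfolding F_def
      by (rule Weierstrass_m_test_general[OF Tle M]) (use \<theta> in auto)
    have "\<forall>\<^sub>F X in finite_subsets_at_top ?I. continuous_on (cball 0 \<rho>) (\<lambda>s. \<Sum>m\<in>X. T m (\<theta>, s))
        \<and> (\<lambda>s. \<Sum>m\<in>X. T m (\<theta>, s)) holomorphic_on ball 0 \<rho>"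
      unfolding T_def by (intro always_eventually allI conjI) (auto intro!: continuous_intros holomorphic_intros)
    from holomorphic_uniform_limit[OF this u] nt show ?thesis by auto
  qed
  have real: "F \<theta> (complex_of_real t) = complex_of_real (V (\<theta> + t *\<^sub>R \<alpha>))" if \<theta>: "\<theta> \<in> ball \<theta>0 \<rho>" and t: "\<bar>t\<bar> < \<rho>" for \<theta> t
  proof -
    have "norm (\<theta> + t *\<^sub>R \<alpha> - \<theta>0) \<le> norm (\<theta> - \<theta>0) + \<bar>t\<bar> * norm \<alpha>"
      using norm_triangle_ineq[of "\<theta> - \<theta>0" "t *\<^sub>R \<alpha>"] by (simp add: algebra_simps)
    also have "\<dots> \<le> \<rho> + \<rho> * norm \<alpha>"
      using \<theta> t by (intro add_mono mult_right_mono) (auto simp: dist_norm norm_minus_commute)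
    also have "\<dots> < r" using \<rho> \<sigma> r by linarith
    finally have "\<theta> + t *\<^sub>R \<alpha> \<in> ball \<theta>0 r" by (simp add: dist_norm norm_minus_commute)
    from has_sum_of_real[OF V[OF this]]
    have "((\<lambda>m. complex_of_real ((\<Prod>b\<in>Basis. ((\<theta> + t *\<^sub>R \<alpha> - \<theta>0) \<bullet> b) ^ m b) *\<^sub>R c m)) has_sum complex_of_real (V (\<theta> + t *\<^sub>R \<alpha>))) ?I" .
    moreover have "complex_of_real ((\<Prod>b\<in>Basis. ((\<theta> + t *\<^sub>R \<alpha> - \<theta>0) \<bullet> b) ^ m b) *\<^sub>R c m) = T m (\<theta>, complex_of_real t)" for m
      by (simp add: T_def inner_diff_left inner_add_left algebra_simps)
    ultimately show ?thesis unfolding F_def by (simp add: infsumI)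
  qed
  show ?thesis by (rule that[OF \<rho>(1) _ _ cont' real]) (use hol in auto)
qed

lemma real_derivs_of_holomorphic:
  fixes f :: "real \<Rightarrow> real"
  assumes F: "F holomorphic_on ball 0 \<rho>" and ext: "\<And>t. \<bar>t\<bar> < \<rho> \<Longrightarrow> F (complex_of_real t) = complex_of_real (f t)"
    and t: "\<bar>t\<bar> < \<rho>"
  shows "((deriv ^^ k) f has_real_derivative (deriv ^^ Suc k) f t) (at t)
    \<and> (deriv ^^ k) F (complex_of_real t) = complex_of_real ((deriv ^^ k) f t)"
proof -
  define g where "g j = (deriv ^^ j) f" for j
  define G where "G j = (deriv ^^ j) F" for j
  have GS: "G (Suc j) = deriv (G j)" and gS: "g (Suc j) = deriv (g j)" for j by (simp_all add: G_def g_def)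
  have step: "(g j has_real_derivative g (Suc j) t) (at t) \<and> G (Suc j) (complex_of_real t) = complex_of_real (g (Suc j) t)"
    if IH: "\<And>t. \<bar>t\<bar> < \<rho> \<Longrightarrow> G j (complex_of_real t) = complex_of_real (g j t)" and t: "\<bar>t\<bar> < \<rho>" for j t
  proof -
    have "G j holomorphic_on ball 0 \<rho>" unfolding G_def by (intro holomorphic_higher_deriv F open_ball)
    then have "(G j has_field_derivative deriv (G j) (of_real t)) (at (of_real t))"
      using t by (intro holomorphic_derivI[of _ "ball 0 \<rho>"]) auto
    then have "((\<lambda>s. G j (of_real s)) has_vector_derivative deriv (G j) (of_real t)) (at t)"
      by (rule has_vector_derivative_real_field)
    moreover have "open {s::real. \<bar>s\<bar> < \<rho>}" by (intro open_Collect_less continuous_intros)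
    ultimately have v: "((\<lambda>s. complex_of_real (g j s)) has_vector_derivative deriv (G j) (of_real t)) (at t)"
      by (rule has_vector_derivative_transform_within_open) (use t IH in auto)
    have re: "(g j has_vector_derivative Re (deriv (G j) (of_real t))) (at t)"
      using bounded_linear.has_vector_derivative[OF bounded_linear_Re v] by simp
    have "((\<lambda>_. 0) has_vector_derivative Im (deriv (G j) (of_real t))) (at t)"
      using bounded_linear.has_vector_derivative[OF bounded_linear_Im v] by simp
    then have im: "Im (deriv (G j) (of_real t)) = 0"
      using vector_derivative_unique_at has_vector_derivative_const by blast
    have "(g j has_real_derivative Re (deriv (G j) (of_real t))) (at t)"
      using re by (simp add: has_real_derivative_iff_has_vector_derivative)
    moreover have "g (Suc j) t = Re (deriv (G j) (of_real t))"
      unfolding gS using calculation by (rule DERIV_imp_deriv)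
    ultimately show ?thesis using im by (simp add: GS complex_eq_iff)
  qed
  have ext': "G j (complex_of_real t) = complex_of_real (g j t)" if "\<bar>t\<bar> < \<rho>" for j t
    using that
  proof (induction j arbitrary: t)
    case 0 then show ?case by (simp add: G_def g_def ext)
  next
    case (Suc j)
    show ?case by (rule step[THEN conjunct2, OF Suc.IH Suc.prems])
  qed
  show ?thesis using step[OF ext', of t k] ext'[OF t, of k] t by (simp add: G_def g_def)
qed

lemma higher_deriv_shift: "(deriv ^^ k) (\<lambda>s. f (s + t)) x = (deriv ^^ k) f (x + t)" for f :: "real \<Rightarrow> real"
proof (induction k arbitrary: x)
  case (Suc k)
  have "(deriv ^^ k) (\<lambda>s. f (s + t)) = (\<lambda>x. (deriv ^^ k) f (x + t))" using Suc.IH by blast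
  then show ?case unfolding funpow.simps comp_def deriv_def by (simp add: DERIV_shift)
qed simp

text \<open>The \<open>k\<close>-th derivative of \<open>V\<close> in the direction \<open>\<alpha>\<close>.\<close>

definition flow_deriv :: "real ^ 'd \<Rightarrow> (real ^ 'd \<Rightarrow> real) \<Rightarrow> nat \<Rightarrow> real ^ 'd \<Rightarrow> real" where
  "flow_deriv \<alpha> V k \<theta> = (deriv ^^ k) (\<lambda>t. V (\<theta> + t *\<^sub>R \<alpha>)) 0"

lemma flow_deriv_0: "flow_deriv \<alpha> V 0 \<theta> = V \<theta>"
  by (simp add: flow_deriv_def)

lemma flow_deriv_along: "flow_deriv \<alpha> V k (\<theta> + t *\<^sub>R \<alpha>) = (deriv ^^ k) (\<lambda>s. V (\<theta> + s *\<^sub>R \<alpha>)) t"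
proof -
  have "(\<lambda>s. V (\<theta> + t *\<^sub>R \<alpha> + s *\<^sub>R \<alpha>)) = (\<lambda>s. V (\<theta> + (s + t) *\<^sub>R \<alpha>))"
    by (simp add: algebra_simps)
  then show ?thesis
    unfolding flow_deriv_def using higher_deriv_shift[of k "\<lambda>s. V (\<theta> + s *\<^sub>R \<alpha>)" t 0] by simp
qed

lemma flow_deriv_has_derivative:
  assumes V: "real_analytic_on V UNIV"
  shows "((\<lambda>t. flow_deriv \<alpha> V k (\<theta> + t *\<^sub>R \<alpha>)) has_real_derivative flow_deriv \<alpha> V (Suc k) (\<theta> + t *\<^sub>R \<alpha>)) (at t)"
proof -
  let ?\<theta> = "\<theta> + t *\<^sub>R \<alpha>"
  obtain \<rho> F where F: "\<rho> > 0" "\<And>\<eta>. \<eta> \<in> ball ?\<theta> \<rho> \<Longrightarrow> F \<eta> holomorphic_on ball 0 \<rho>"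
    "\<And>\<eta>. \<eta> \<in> ball ?\<theta> \<rho> \<Longrightarrow> continuous_on (cball 0 \<rho>) (F \<eta>)"
    "continuous_on (ball ?\<theta> \<rho> \<times> cball 0 \<rho>) (\<lambda>(\<theta>, s). F \<theta> s)"
    "\<And>\<eta> s. \<eta> \<in> ball ?\<theta> \<rho> \<Longrightarrow> \<bar>s\<bar> < \<rho> \<Longrightarrow> F \<eta> (complex_of_real s) = complex_of_real (V (\<eta> + s *\<^sub>R \<alpha>))"
    using that by (rule real_analytic_holomorphic_along_line[OF V, of ?\<theta> \<alpha>])
  have "((deriv ^^ k) (\<lambda>s. V (?\<theta> + s *\<^sub>R \<alpha>)) has_real_derivative (deriv ^^ Suc k) (\<lambda>s. V (?\<theta> + s *\<^sub>R \<alpha>)) 0) (at 0)"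
    using real_derivs_of_holomorphic[of "F ?\<theta>" \<rho> "\<lambda>s. V (?\<theta> + s *\<^sub>R \<alpha>)" 0 k] F by simp
  moreover have "(deriv ^^ k) (\<lambda>s. V (?\<theta> + s *\<^sub>R \<alpha>)) = (\<lambda>s. flow_deriv \<alpha> V k (?\<theta> + s *\<^sub>R \<alpha>))"
    by (rule ext) (rule flow_deriv_along[symmetric])
  ultimately have "((\<lambda>s. flow_deriv \<alpha> V k (?\<theta> + s *\<^sub>R \<alpha>)) has_real_derivative flow_deriv \<alpha> V (Suc k) ?\<theta>) (at 0)"
    by (simp only: flow_deriv_def[of \<alpha> V "Suc k", symmetric])
  moreover have "(\<lambda>s. flow_deriv \<alpha> V k (?\<theta> + s *\<^sub>R \<alpha>)) = (\<lambda>s. flow_deriv \<alpha> V k (\<theta> + (s + t) *\<^sub>R \<alpha>))"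
    by (simp add: algebra_simps)
  ultimately show ?thesis
    using DERIV_shift[of "\<lambda>t. flow_deriv \<alpha> V k (\<theta> + t *\<^sub>R \<alpha>)" _ 0 t] by simp
qed

text \<open>The Cauchy estimates bound the difference of two derivatives by the distance of the holomorphic
extensions, which depend continuously on the base point.\<close>

lemma flow_deriv_isCont:
  assumes V: "real_analytic_on V UNIV"
  shows "isCont (flow_deriv \<alpha> V k) \<theta>0"
proof -
  obtain \<rho> F where \<rho>: "\<rho> > 0" and hol: "\<And>\<eta>. \<eta> \<in> ball \<theta>0 \<rho> \<Longrightarrow> F \<eta> holomorphic_on ball 0 \<rho>"
    and cb: "\<And>\<eta>. \<eta> \<in> ball \<theta>0 \<rho> \<Longrightarrow> continuous_on (cball 0 \<rho>) (F \<eta>)"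
    and cont: "continuous_on (ball \<theta>0 \<rho> \<times> cball 0 \<rho>) (\<lambda>(\<theta>, s). F \<theta> s)"
    and real: "\<And>\<eta> s. \<eta> \<in> ball \<theta>0 \<rho> \<Longrightarrow> \<bar>s\<bar> < \<rho> \<Longrightarrow> F \<eta> (complex_of_real s) = complex_of_real (V (\<eta> + s *\<^sub>R \<alpha>))"
    using that by (rule real_analytic_holomorphic_along_line[OF V, of \<theta>0 \<alpha>])
  have fd: "(deriv ^^ k) (F \<eta>) 0 = complex_of_real (flow_deriv \<alpha> V k \<eta>)" if "\<eta> \<in> ball \<theta>0 \<rho>" for \<eta>
    using real_derivs_of_holomorphic[of "F \<eta>" \<rho> "\<lambda>s. V (\<eta> + s *\<^sub>R \<alpha>)" 0 k] hol real that \<rho>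
    by (simp add: flow_deriv_def)
  have uc: "uniformly_continuous_on (cball \<theta>0 (\<rho> / 2) \<times> cball 0 \<rho>) (\<lambda>(\<theta>, s). F \<theta> s)"
    using \<rho> by (intro compact_uniformly_continuous continuous_on_subset[OF cont] compact_Times) auto
  have \<theta>0: "\<theta>0 \<in> ball \<theta>0 \<rho>" using \<rho> by simp
  have "\<exists>d>0. \<forall>\<eta>. dist \<eta> \<theta>0 < d \<longrightarrow> dist (flow_deriv \<alpha> V k \<eta>) (flow_deriv \<alpha> V k \<theta>0) < e" if "e > 0" for e
  proof -
    define e' where "e' = e * \<rho> ^ k / (2 * fact k)"
    have e': "e' > 0" using that \<rho> by (simp add: e'_def)
    from uc[unfolded uniformly_continuous_on_def, rule_format, OF e']
    obtain d where d: "d > 0" "\<And>p q. p \<in> cball \<theta>0 (\<rho> / 2) \<times> cball 0 \<rho> \<Longrightarrow> q \<in> cball \<theta>0 (\<rho> / 2) \<times> cball 0 \<rho> \<Longrightarrow>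
        dist q p < d \<Longrightarrow> dist (case q of (\<theta>, s) \<Rightarrow> F \<theta> s) (case p of (\<theta>, s) \<Rightarrow> F \<theta> s) < e'" by blast
    have "dist (flow_deriv \<alpha> V k \<eta>) (flow_deriv \<alpha> V k \<theta>0) < e" if \<eta>: "dist \<eta> \<theta>0 < min d (\<rho> / 2)" for \<eta>
    proof -
      have \<eta>b: "\<eta> \<in> ball \<theta>0 \<rho>" using \<eta> \<rho> by (simp add: dist_commute)
      have close: "cmod (F \<eta> s - F \<theta>0 s) \<le> e'" if "cmod s \<le> \<rho>" for s
        using d(2)[of "(\<theta>0, s)" "(\<eta>, s)"] \<eta> that \<rho> by (simp add: dist_Pair_Pair dist_norm dist_commute norm_minus_commute)
      have "cmod ((deriv ^^ k) (\<lambda>s. F \<eta> s - F \<theta>0 s) 0) \<le> fact k * e' / \<rho> ^ k"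
        by (rule Cauchy_inequality) (auto intro!: holomorphic_intros continuous_intros hol cb \<eta>b \<theta>0 \<rho> close)
      also have "(deriv ^^ k) (\<lambda>s. F \<eta> s - F \<theta>0 s) 0 = (deriv ^^ k) (F \<eta>) 0 - (deriv ^^ k) (F \<theta>0) 0"
        using \<rho> by (intro higher_deriv_diff[of _ "ball 0 \<rho>"] hol \<eta>b \<theta>0) auto
      also have "\<dots> = complex_of_real (flow_deriv \<alpha> V k \<eta> - flow_deriv \<alpha> V k \<theta>0)"
        unfolding fd[OF \<eta>b] fd[OF \<theta>0] by simp
      finally have "\<bar>flow_deriv \<alpha> V k \<eta> - flow_deriv \<alpha> V k \<theta>0\<bar> \<le> fact k * e' / \<rho> ^ k" by (simp only: norm_of_real)
      also have "\<dots> = e / 2" using \<rho> by (simp add: e'_def)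
      finally show ?thesis using \<open>e > 0\<close> by (simp add: dist_real_def)
    qed
    then show ?thesis using d(1) \<rho> by (intro exI[of _ "min d (\<rho> / 2)"]) auto
  qed
  then show ?thesis unfolding continuous_at_eps_delta by blast
qed

lemma real_analytic_continuous:
  fixes V :: "real ^ 'd \<Rightarrow> real"
  assumes "real_analytic_on V UNIV"
  shows "continuous_on UNIV V"
proof -
  have "flow_deriv 0 V 0 = V" by (auto simp: flow_deriv_0)
  then show ?thesis
    using flow_deriv_isCont[OF assms, where \<alpha> = 0 and k = 0] by (simp add: continuous_at_imp_continuous_on)
qed

lemma flow_deriv_locally_zero:
  assumes V: "real_analytic_on V UNIV" and zero: "\<And>k. k \<ge> 1 \<Longrightarrow> flow_deriv \<alpha> V k \<theta> = 0"
  obtains \<rho> where "\<rho> > 0" "\<And>k t. k \<ge> 1 \<Longrightarrow> \<bar>t\<bar> < \<rho> \<Longrightarrow> flow_deriv \<alpha> V k (\<theta> + t *\<^sub>R \<alpha>) = 0"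
proof -
  obtain \<rho> F where \<rho>: "\<rho> > 0" and "\<And>\<eta>. \<eta> \<in> ball \<theta> \<rho> \<Longrightarrow> F \<eta> holomorphic_on ball 0 \<rho>"
    and "\<And>\<eta>. \<eta> \<in> ball \<theta> \<rho> \<Longrightarrow> continuous_on (cball 0 \<rho>) (F \<eta>)"
    and "continuous_on (ball \<theta> \<rho> \<times> cball 0 \<rho>) (\<lambda>(\<theta>, s). F \<theta> s)"
    and "\<And>\<eta> s. \<eta> \<in> ball \<theta> \<rho> \<Longrightarrow> \<bar>s\<bar> < \<rho> \<Longrightarrow> F \<eta> (complex_of_real s) = complex_of_real (V (\<eta> + s *\<^sub>R \<alpha>))"
    using that by (rule real_analytic_holomorphic_along_line[OF V, of \<theta> \<alpha>])
  then have hol: "F \<theta> holomorphic_on ball 0 \<rho>"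
    and real: "\<And>s. \<bar>s\<bar> < \<rho> \<Longrightarrow> F \<theta> (complex_of_real s) = complex_of_real (V (\<theta> + s *\<^sub>R \<alpha>))" by auto
  have der: "(deriv ^^ k) (F \<theta>) (complex_of_real t) = complex_of_real (flow_deriv \<alpha> V k (\<theta> + t *\<^sub>R \<alpha>))"
    if "\<bar>t\<bar> < \<rho>" for k t
    using real_derivs_of_holomorphic[OF hol real that, of k] by (simp add: flow_deriv_along)
  have z0: "(deriv ^^ n) (F \<theta>) 0 = 0" if "0 < n" for n
    using der[of 0 n] zero[of n] that \<rho> by simp
  have const: "F \<theta> w = F \<theta> 0" if "w \<in> ball 0 \<rho>" for w
    by (rule holomorphic_fun_eq_const_on_connected[OF hol open_ball connected_ball z0 _ that]) (use \<rho> in simp_all)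
  have "flow_deriv \<alpha> V k (\<theta> + t *\<^sub>R \<alpha>) = 0" if "k \<ge> 1" "\<bar>t\<bar> < \<rho>" for k t
  proof -
    have "(deriv ^^ k) (F \<theta>) (complex_of_real t) = (deriv ^^ k) (\<lambda>_. F \<theta> 0) (complex_of_real t)"
      by (rule higher_deriv_transform_within_open[OF hol holomorphic_on_const open_ball _ const])
         (use that in simp_all)
    also have "\<dots> = 0" using that by (simp add: higher_deriv_const)
    finally show ?thesis using der[OF that(2), of k] by simp
  qed
  then show ?thesis using that[OF \<rho>] by blast
qed

text \<open>Otherwise all derivatives vanish along the whole line, since the parameters with this property form an
open and closed set. Then \<open>V\<close> is constant on an orbit, and so everywhere.\<close>

theorem exists_nonzero_flow_deriv:
  assumes \<alpha>: "rationally_independent \<alpha>" and V: "real_analytic_on V UNIV" and per: "torus_periodic V"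
    and nonconst: "\<not> V constant_on UNIV"
  shows "\<exists>k\<ge>1. flow_deriv \<alpha> V k \<theta> \<noteq> 0"
proof (rule ccontr)
  assume "\<not> ?thesis"
  then have z: "\<And>k. k \<ge> 1 \<Longrightarrow> flow_deriv \<alpha> V k \<theta> = 0" by blast
  define S where "S = {t. \<forall>k\<ge>1. flow_deriv \<alpha> V k (\<theta> + t *\<^sub>R \<alpha>) = 0}"
  have "open S"
    unfolding open_dist
  proof
    fix t assume "t \<in> S"
    then have "\<And>k. k \<ge> 1 \<Longrightarrow> flow_deriv \<alpha> V k (\<theta> + t *\<^sub>R \<alpha>) = 0" by (auto simp: S_def)
    then obtain \<rho> where \<rho>: "\<rho> > 0" "\<And>k s. k \<ge> 1 \<Longrightarrow> \<bar>s\<bar> < \<rho> \<Longrightarrow> flow_deriv \<alpha> V k (\<theta> + t *\<^sub>R \<alpha> + s *\<^sub>R \<alpha>) = 0"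
      using flow_deriv_locally_zero[OF V] by blast
    have "u \<in> S" if "dist u t < \<rho>" for u
    proof -
      have e: "\<theta> + t *\<^sub>R \<alpha> + (u - t) *\<^sub>R \<alpha> = \<theta> + u *\<^sub>R \<alpha>" by (simp add: algebra_simps)
      show ?thesis using \<rho>(2)[of _ "u - t", unfolded e] that by (auto simp: S_def dist_real_def)
    qed
    then show "\<exists>e>0. \<forall>y. dist y t < e \<longrightarrow> y \<in> S" using \<rho>(1) by blast
  qed
  moreover have "closed S"
  proof -
    have c: "continuous_on UNIV (\<lambda>t. flow_deriv \<alpha> V k (\<theta> + t *\<^sub>R \<alpha>))" for k
      using flow_deriv_has_derivative[OF V] by (meson DERIV_isCont continuous_at_imp_continuous_on)
    have "S = (\<Inter>k\<in>{1..}. {t. flow_deriv \<alpha> V k (\<theta> + t *\<^sub>R \<alpha>) = 0})" by (auto simp: S_def)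
    moreover have "closed {t. flow_deriv \<alpha> V k (\<theta> + t *\<^sub>R \<alpha>) = 0}" for k
      by (intro closed_Collect_eq c continuous_on_const)
    ultimately show ?thesis by auto
  qed
  moreover have "0 \<in> S" using z by (simp add: S_def)
  ultimately have "S = UNIV" using clopen[of S] by blast
  then have d0: "flow_deriv \<alpha> V (Suc 0) (\<theta> + t *\<^sub>R \<alpha>) = 0" for t by (auto simp: S_def)
  have "V (\<theta> + t *\<^sub>R \<alpha>) = V \<theta>" for t
  proof -
    have "((\<lambda>t. flow_deriv \<alpha> V 0 (\<theta> + t *\<^sub>R \<alpha>)) has_real_derivative 0) (at t)" for t
      using flow_deriv_has_derivative[OF V, of \<alpha> 0 \<theta> t] by (simp only: d0)
    then have "((\<lambda>t. V (\<theta> + t *\<^sub>R \<alpha>)) has_real_derivative 0) (at t)" for t by (simp only: flow_deriv_0)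
    then show ?thesis using DERIV_isconst_all[of "\<lambda>t. V (\<theta> + t *\<^sub>R \<alpha>)" t 0] by simp
  qed
  then have "V (\<theta> + real j *\<^sub>R \<alpha>) = V \<theta>" for j :: nat by blast
  then have "V \<eta> = V \<theta>" for \<eta>
    by (rule constant_on_orbit_imp_constant[OF \<alpha>, rotated]) (simp add: torus_cont_def per real_analytic_continuous[OF V])
  then show False using nonconst by (auto simp: constant_on_def)
qed

section \<open>Uniform integrability of the logarithm\<close>

text \<open>Some derivative of order \<open>k \<ge> 1\<close> is bounded away from zero near \<open>\<theta>0\<close>. Subtracting the constant \<open>x\<close>
does not change it, whence the uniformity in \<open>x\<close>.\<close>

lemma segment_bound_local:
  assumes \<alpha>: "rationally_independent \<alpha>" and V: "real_analytic_on V UNIV" and per: "torus_periodic V"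
    and nonconst: "\<not> V constant_on UNIV"
  shows "\<exists>d>0. \<exists>\<delta>>0. \<exists>L. \<forall>\<theta>\<in>ball \<theta>0 d. \<forall>x \<tau>. \<tau> > 0 \<longrightarrow>
    (\<integral>\<^sup>+t. ennreal (- ln (max \<tau> \<bar>V (\<theta> + t *\<^sub>R \<alpha>) - x\<bar>)) * indicator {0..\<delta>} t \<partial>lborel) \<le> ennreal L"
proof -
  obtain k where k: "k \<ge> 1" "flow_deriv \<alpha> V k \<theta>0 \<noteq> 0"
    using exists_nonzero_flow_deriv[OF assms] by blast
  define c where "c = \<bar>flow_deriv \<alpha> V k \<theta>0\<bar> / 2"
  have c: "c > 0" using k by (simp add: c_def)
  have "isCont (flow_deriv \<alpha> V k) \<theta>0" by (rule flow_deriv_isCont[OF V])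
  then obtain e where e: "e > 0" "\<And>\<eta>. dist \<eta> \<theta>0 < e \<Longrightarrow> dist (flow_deriv \<alpha> V k \<eta>) (flow_deriv \<alpha> V k \<theta>0) < c"
    using c unfolding continuous_at_eps_delta by blast
  define \<delta> where "\<delta> = e / (2 * (norm \<alpha> + 1))"
  have p: "norm \<alpha> + 1 > 0" by (simp add: add_nonneg_pos)
  have \<delta>: "\<delta> > 0" unfolding \<delta>_def using e(1) p by (intro divide_pos_pos) auto
  have \<delta>\<alpha>: "\<delta> * norm \<alpha> \<le> e / 2"
  proof -
    have "\<delta> * norm \<alpha> = e / 2 * (norm \<alpha> / (norm \<alpha> + 1))" by (simp add: \<delta>_def)
    also have "\<dots> \<le> e / 2 * 1" using e(1) p by (intro mult_left_mono) (auto simp: divide_le_eq)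
    finally show ?thesis by simp
  qed
  obtain L where L: "\<And>h \<tau>. continuous_on UNIV h \<Longrightarrow>
     (\<And>r. 0 < r \<Longrightarrow> r < 1 \<Longrightarrow> emeasure lborel {t\<in>{0..\<delta>}. \<bar>h t\<bar> \<le> c * r} \<le> ennreal (sublevel_const k * r powr (1 / 2 ^ k))) \<Longrightarrow> \<tau> > 0 \<Longrightarrow>
     (\<integral>\<^sup>+t. ennreal (- ln (max \<tau> \<bar>h t\<bar>)) * indicator {0..\<delta>} t \<partial>lborel) \<le> ennreal L"
    using nn_integral_neg_ln_le[OF c sublevel_const_nonneg[of k] _ \<delta>, of "1 / 2 ^ k"] by auto
  have "(\<integral>\<^sup>+t. ennreal (- ln (max \<tau> \<bar>V (\<theta> + t *\<^sub>R \<alpha>) - x\<bar>)) * indicator {0..\<delta>} t \<partial>lborel) \<le> ennreal L"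
    if \<theta>: "\<theta> \<in> ball \<theta>0 (e / 2)" and \<tau>: "\<tau> > 0" for \<theta> x \<tau>
  proof (rule L[OF _ _ \<tau>])
    have cf: "continuous_on UNIV (\<lambda>t. flow_deriv \<alpha> V i (\<theta> + t *\<^sub>R \<alpha>))" for i
      using flow_deriv_has_derivative[OF V] by (meson DERIV_isCont continuous_at_imp_continuous_on)
    then show "continuous_on UNIV (\<lambda>t. V (\<theta> + t *\<^sub>R \<alpha>) - x)"
      using cf[of 0] by (auto simp: flow_deriv_0 intro!: continuous_intros)
    fix r :: real assume r: "0 < r" "r < 1"
    define g where "g i t = (if i = 0 then V (\<theta> + t *\<^sub>R \<alpha>) - x else flow_deriv \<alpha> V i (\<theta> + t *\<^sub>R \<alpha>))" for i t
    have g0: "g 0 = (\<lambda>t. V (\<theta> + t *\<^sub>R \<alpha>) - x)" by (rule ext) (simp add: g_def)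
    have gk: "g k = (\<lambda>t. flow_deriv \<alpha> V k (\<theta> + t *\<^sub>R \<alpha>))" using k by (intro ext) (simp add: g_def)
    have "emeasure lborel {t\<in>{0..\<delta>}. \<bar>g 0 t\<bar> \<le> c * r} \<le> ennreal (sublevel_const k * r powr (1 / 2 ^ k))"
    proof (rule emeasure_sublevel_le[OF _ _ _ _ c _ r])
      fix i t assume "i < k"
      show "(g i has_real_derivative g (Suc i) t) (at t)"
      proof (cases "i = 0")
        case True
        have "((\<lambda>t. V (\<theta> + t *\<^sub>R \<alpha>) - x) has_real_derivative flow_deriv \<alpha> V (Suc 0) (\<theta> + t *\<^sub>R \<alpha>) - 0) (at t)"
          using flow_deriv_has_derivative[OF V, of \<alpha> 0 \<theta> t] unfolding flow_deriv_0 by (intro DERIV_diff DERIV_const)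
        then show ?thesis using True by (simp add: g_def[abs_def])
      next
        case False
        then show ?thesis using flow_deriv_has_derivative[OF V, of \<alpha> i \<theta> t] by (simp add: g_def[abs_def])
      qed
    next
      show "continuous_on UNIV (g k)" unfolding gk by (rule cf)
      fix t assume t: "t \<in> {0..\<delta>}"
      have "dist (\<theta> + t *\<^sub>R \<alpha>) \<theta>0 \<le> dist \<theta> \<theta>0 + t * norm \<alpha>"
        using t norm_triangle_ineq[of "\<theta> - \<theta>0" "t *\<^sub>R \<alpha>"] by (simp add: dist_norm algebra_simps)
      also have "\<dots> < e / 2 + \<delta> * norm \<alpha>"
        using \<theta> t by (intro add_less_le_mono mult_right_mono) (auto simp: dist_commute)
      also have "\<dots> \<le> e" using \<delta>\<alpha> by linarith
      finally have "dist (flow_deriv \<alpha> V k (\<theta> + t *\<^sub>R \<alpha>)) (flow_deriv \<alpha> V k \<theta>0) < c" by (rule e(2))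
      then show "c \<le> \<bar>g k t\<bar>" unfolding gk c_def dist_real_def by linarith
    qed (auto simp: is_interval_cc)
    then show "emeasure lborel {t\<in>{0..\<delta>}. \<bar>V (\<theta> + t *\<^sub>R \<alpha>) - x\<bar> \<le> c * r} \<le> ennreal (sublevel_const k * r powr (1 / 2 ^ k))"
      by (simp add: g0)
  qed
  then show ?thesis using e(1) \<delta>
    by (intro exI[of _ "e / 2"] conjI exI[of _ \<delta>] exI[of _ L]) auto
qed

text \<open>Finitely many of the neighbourhoods in \<open>segment_bound_local\<close> cover the cube, so that one
length \<open>\<delta>m\<close> and one bound \<open>Lm\<close> serve for all segments.\<close>

theorem truncated_log_mean_bounded_below:
  fixes V :: "real ^ 'd \<Rightarrow> real" and \<alpha> :: "real ^ 'd"
  assumes \<alpha>: "rationally_independent \<alpha>" and V: "real_analytic_on V UNIV" and per: "torus_periodic V"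
    and nonconst: "\<not> V constant_on UNIV"
  obtains C where "\<And>x \<tau>. \<tau> > 0 \<Longrightarrow> - C \<le> torus_mean (\<lambda>\<theta>. ln (max \<tau> \<bar>V \<theta> - x\<bar>))"
proof -
  have VC: "torus_cont V" by (simp add: torus_cont_def per real_analytic_continuous[OF V])
  let ?J = "\<lambda>\<theta> x \<tau> \<delta>. (\<integral>\<^sup>+t. ennreal (- ln (max \<tau> \<bar>V (\<theta> + t *\<^sub>R \<alpha>) - x\<bar>)) * indicator {0..\<delta>} t \<partial>lborel)"
  define P where "P \<theta>0 d \<delta> L \<longleftrightarrow> d > 0 \<and> \<delta> > 0 \<and>
      (\<forall>\<theta>\<in>ball \<theta>0 d. \<forall>x \<tau>. \<tau> > 0 \<longrightarrow> ?J \<theta> x \<tau> \<delta> \<le> ennreal L)" for \<theta>0 and d \<delta> L :: real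
  have "\<exists>d \<delta> L. P \<theta>0 d \<delta> L" for \<theta>0
  proof -
    obtain d \<delta> L where "d > 0" "\<delta> > 0" "\<forall>\<theta>\<in>ball \<theta>0 d. \<forall>x \<tau>. \<tau> > 0 \<longrightarrow> ?J \<theta> x \<tau> \<delta> \<le> ennreal L"
      using segment_bound_local[OF assms, of \<theta>0] by (elim exE conjE)
    then show ?thesis unfolding P_def by (intro exI conjI)
  qed
  then obtain d \<delta> L where P: "\<And>\<theta>0. P \<theta>0 (d \<theta>0) (\<delta> \<theta>0) (L \<theta>0)" by metis
  then have d: "\<And>\<theta>0. d \<theta>0 > 0" and \<delta>: "\<And>\<theta>0. \<delta> \<theta>0 > 0" unfolding P_def by simp_all
  have J: "?J \<theta> x \<tau> (\<delta> \<theta>0) \<le> ennreal (L \<theta>0)" if "\<theta> \<in> ball \<theta>0 (d \<theta>0)" "\<tau> > 0" for \<theta>0 \<theta> x \<tau>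
    using P[of \<theta>0] that unfolding P_def by simp
  let ?Q = "cbox 0 1 :: (real ^ 'd) set"
  have "?Q \<subseteq> (\<Union>\<theta>0\<in>?Q. ball \<theta>0 (d \<theta>0))" using d by force
  then obtain K where K: "K \<subseteq> ?Q" "finite K" "?Q \<subseteq> (\<Union>\<theta>0\<in>K. ball \<theta>0 (d \<theta>0))"
    using compactE_image[of ?Q ?Q "\<lambda>\<theta>0. ball \<theta>0 (d \<theta>0)"] compact_cbox by auto
  have "0 \<in> ?Q" by (simp add: mem_box_cart)
  then have Kne: "K \<noteq> {}" using K(3) by auto
  define \<delta>m where "\<delta>m = Min (\<delta> ` K)"
  define Lm where "Lm = Max (insert 0 (L ` K))"
  have \<delta>m: "\<delta>m > 0" "\<And>\<theta>0. \<theta>0 \<in> K \<Longrightarrow> \<delta>m \<le> \<delta> \<theta>0" using K(2) Kne \<delta> by (auto simp: \<delta>m_def)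
  have Lm: "Lm \<ge> 0" "\<And>\<theta>0. \<theta>0 \<in> K \<Longrightarrow> L \<theta>0 \<le> Lm" using K(2) by (auto simp: Lm_def)
  have seg: "?J \<theta> x \<tau> \<delta>m \<le> ennreal Lm" if "\<theta> \<in> ?Q" "\<tau> > 0" for \<theta> x \<tau>
  proof -
    obtain \<theta>0 where \<theta>0: "\<theta>0 \<in> K" "\<theta> \<in> ball \<theta>0 (d \<theta>0)" using K(3) \<open>\<theta> \<in> ?Q\<close> by blast
    have "?J \<theta> x \<tau> \<delta>m \<le> ?J \<theta> x \<tau> (\<delta> \<theta>0)"
      using \<delta>m(2)[OF \<theta>0(1)] by (intro nn_integral_mono mult_left_mono) (auto simp: indicator_def)
    also have "\<dots> \<le> ennreal (L \<theta>0)" by (rule J[OF \<theta>0(2) that(2)])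
    also have "\<dots> \<le> ennreal Lm" using Lm(2)[OF \<theta>0(1)] by (rule ennreal_leI)
    finally show ?thesis .
  qed
  have "- (Lm / \<delta>m) \<le> torus_mean (\<lambda>\<theta>. ln (max \<tau> \<bar>V \<theta> - x\<bar>))" if \<tau>: "\<tau> > 0" for x \<tau>
  proof -
    let ?h = "\<lambda>\<theta>. ln (max \<tau> \<bar>V \<theta> - x\<bar>)"
    \<comment> \<open>The segment estimates hold for nonnegative integrands, so they are applied to the negative part.\<close>
    let ?f = "\<lambda>\<theta>. max 0 (0 - ?h \<theta>)"
    have "torus_cont (\<lambda>\<theta>. ln (max \<tau> (norm (V \<theta> - x))))"
      using \<tau> by (intro torus_cont_ln torus_cont_max torus_cont_norm torus_cont_diff torus_cont_const VC) auto
    then have h: "torus_cont ?h" by simp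
    have f: "torus_cont ?f" by (intro torus_cont_max torus_cont_diff torus_cont_const h)
    have ef: "ennreal (?f \<theta>) = ennreal (- ?h \<theta>)" for \<theta> by (simp add: max_def ennreal_neg)
    have "torus_mean ?f \<le> Lm / \<delta>m"
    proof (rule torus_mean_le_of_segments[OF f _ \<delta>m(1) Lm(1), of \<alpha>])
      show "0 \<le> ?f \<theta>" for \<theta> by simp
      show "(\<integral>\<^sup>+t. ennreal (?f (\<theta> + t *\<^sub>R \<alpha>)) * indicator {0..\<delta>m} t \<partial>lborel) \<le> ennreal Lm"
        if "\<theta> \<in> ?Q" for \<theta>
        unfolding ef by (rule seg[OF that \<tau>])
    qed
    moreover have "torus_mean (\<lambda>\<theta>. 0 - ?h \<theta>) \<le> torus_mean ?f"
      by (intro torus_mean_mono torus_cont_diff torus_cont_const h f) simp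
    moreover have "torus_mean (\<lambda>\<theta>. 0 - ?h \<theta>) = - torus_mean ?h"
      unfolding torus_mean_diff[OF torus_cont_const h] by simp
    ultimately show ?thesis by linarith
  qed
  then show ?thesis by (rule that)
qed

section \<open>The logarithmic potential\<close>

locale analytic_potential =
  fixes V :: "real ^ 'd \<Rightarrow> real" and \<alpha> :: "real ^ 'd"
  assumes indep: "rationally_independent \<alpha>"
    and periodic: "torus_periodic V"
    and analytic: "real_analytic_on V UNIV"
    and nonconst: "\<not> V constant_on UNIV"
begin

abbreviation G :: "complex \<Rightarrow> real" where
  "G \<equiv> G_fun (complex_of_real \<circ> V)"

abbreviation R :: "complex set" where
  "R \<equiv> complex_of_real ` range V"

lemma cont: "torus_cont V"
  by (simp add: torus_cont_def periodic real_analytic_continuous[OF analytic])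

lemma shifted_cont: "torus_cont (\<lambda>\<theta>. z - complex_of_real (V \<theta>))"
  by (intro torus_cont_diff torus_cont_const torus_cont_of_real cont)

lemma G_eq: "G z = torus_mean (\<lambda>\<theta>. ln (cmod (z - complex_of_real (V \<theta>))))"
  by (simp add: G_fun_def torus_mean_eq)

lemma range_interval: obtains m M where "m \<le> M" "range V = {m..M}"
proof -
  have "connected (range V)"
    using cont by (auto simp: torus_cont_def intro: connected_continuous_image)
  then obtain m M where "range V = {m..M}"
    using connected_compact_interval_1[of "range V"] torus_cont_compact_range[OF cont] by blast
  moreover have "m \<le> M" using calculation by (metis UNIV_not_empty atLeastatMost_empty_iff image_is_empty)
  ultimately show ?thesis using that by blast
qed

text \<open>The truncation makes the logarithm continuous; \<open>G z\<close> is the limit of the means for \<open>\<tau> \<rightarrow> 0\<close>.\<close>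

definition trunc_log :: "real \<Rightarrow> complex \<Rightarrow> real ^ 'd \<Rightarrow> real" where
  "trunc_log \<tau> z \<theta> = ln (max \<tau> (cmod (z - complex_of_real (V \<theta>))))"

lemma trunc_log_cont: "\<tau> > 0 \<Longrightarrow> torus_cont (trunc_log \<tau> z)"
  unfolding trunc_log_def[abs_def]
  by (intro torus_cont_ln torus_cont_max torus_cont_const torus_cont_norm shifted_cont) auto

lemma trunc_log_mean_bounded_below:
  obtains C where "\<And>z \<tau>. \<tau> > 0 \<Longrightarrow> - C \<le> torus_mean (trunc_log \<tau> z)"
proof -
  obtain C where C: "\<And>x \<tau>. \<tau> > 0 \<Longrightarrow> - C \<le> torus_mean (\<lambda>\<theta>. ln (max \<tau> \<bar>V \<theta> - x\<bar>))"
    using truncated_log_mean_bounded_below[OF indep analytic periodic nonconst] by blast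
  have "- C \<le> torus_mean (trunc_log \<tau> z)" if \<tau>: "\<tau> > 0" for z \<tau>
  proof -
    have le: "\<bar>V \<theta> - Re z\<bar> \<le> cmod (z - complex_of_real (V \<theta>))" for \<theta>
      using abs_Re_le_cmod[of "z - complex_of_real (V \<theta>)"] by (simp add: abs_minus_commute)
    have "torus_cont (\<lambda>\<theta>. ln (max \<tau> (norm (V \<theta> - Re z))))"
      using \<tau> by (intro torus_cont_ln torus_cont_max torus_cont_norm torus_cont_diff torus_cont_const cont) auto
    then have c: "torus_cont (\<lambda>\<theta>. ln (max \<tau> \<bar>V \<theta> - Re z\<bar>))" by simp
    have "ln (max \<tau> \<bar>V \<theta> - Re z\<bar>) \<le> trunc_log \<tau> z \<theta>" for \<theta>
      unfolding trunc_log_def using \<tau> le[of \<theta>] by (subst ln_le_cancel_iff) (auto simp: less_max_iff_disj le_max_iff_disj)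
    then have "torus_mean (\<lambda>\<theta>. ln (max \<tau> \<bar>V \<theta> - Re z\<bar>)) \<le> torus_mean (trunc_log \<tau> z)"
      by (rule torus_mean_mono[OF c trunc_log_cont[OF \<tau>]])
    with C[OF \<tau>, of "Re z"] show ?thesis by linarith
  qed
  then show ?thesis by (rule that)
qed

text \<open>On the level set \<open>V = z\<close> the truncated logarithm is \<open>ln \<tau>\<close>. If the level set had positive measure,
the means would not be bounded below as \<open>\<tau> \<rightarrow> 0\<close>. This is why the value of \<open>ln 0\<close> does not affect \<open>G\<close>.\<close>

lemma AE_off_level_set: "AE \<theta> in cube. z - complex_of_real (V \<theta>) \<noteq> 0"
proof -
  obtain C where C: "\<And>z \<tau>. \<tau> > 0 \<Longrightarrow> - C \<le> torus_mean (trunc_log \<tau> z)"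
    using trunc_log_mean_bounded_below by blast
  obtain B where B: "B > 0" "\<And>\<theta>. cmod (z - complex_of_real (V \<theta>)) \<le> B"
    using torus_cont_bounded[OF shifted_cont] by blast
  define b where "b = ln (max 1 B)"
  define Z where "Z = {\<theta> \<in> space cube. z - complex_of_real (V \<theta>) = 0}"
  have Z: "Z \<in> sets cube"
    unfolding Z_def using torus_cont_measurable[OF shifted_cont[of z]] by measurable
  interpret finite_measure "cube :: (real ^ 'd) measure" by (rule prob_space_cube)
  have "real n * measure cube Z \<le> b + C" for n :: nat
  proof -
    have int: "integrable cube (\<lambda>\<theta>. b - real n * indicator Z \<theta>)"
      using Z by (intro Bochner_Integration.integrable_diff integrable_const integrable_mult_right integrable_real_indicator)
        (auto simp: less_top[symmetric])
    have "- C \<le> torus_mean (trunc_log (exp (- real n)) z)" by (rule C) simp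
    also have "\<dots> \<le> (LINT \<theta>|cube. b - real n * indicator Z \<theta>)"
      unfolding torus_mean_def
    proof (rule integral_mono[OF torus_cont_integrable[OF trunc_log_cont] int])
      fix \<theta> :: "real ^ 'd" assume \<theta>: "\<theta> \<in> space cube"
      show "trunc_log (exp (- real n)) z \<theta> \<le> b - real n * indicator Z \<theta>"
      proof (cases "\<theta> \<in> Z")
        case True
        then have "trunc_log (exp (- real n)) z \<theta> = - real n" by (simp add: trunc_log_def Z_def)
        moreover have "b \<ge> 0" by (simp add: b_def)
        ultimately show ?thesis using True by simp
      next
        case False
        have "max (exp (- real n)) (cmod (z - complex_of_real (V \<theta>))) \<le> max 1 B"
          using B(2)[of \<theta>] by (intro max.mono) auto
        then have "trunc_log (exp (- real n)) z \<theta> \<le> b"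
          unfolding trunc_log_def b_def by (subst ln_le_cancel_iff) (auto simp: max_def)
        then show ?thesis using False by simp
      qed
    qed simp
    also have "\<dots> = b - real n * measure cube Z"
    proof -
      have "(LINT \<theta>|cube. b - real n * indicator Z \<theta>) = (LINT \<theta>|(cube :: (real ^ 'd) measure). b) - (LINT \<theta>|cube. real n * indicator Z \<theta>)"
        using Z by (intro Bochner_Integration.integral_diff integrable_const integrable_mult_right integrable_real_indicator)
          (auto simp: less_top[symmetric])
      moreover have "(LINT \<theta>|(cube :: (real ^ 'd) measure). b) = b"
        using torus_mean_const[of b] unfolding torus_mean_def .
      moreover have "(LINT \<theta>|cube. real n * indicator Z \<theta>) = real n * measure cube Z"
        using Z by (subst integral_mult_right_zero) (simp add: sets.Int_space_eq2)
      ultimately show ?thesis by (simp only:)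
    qed
    finally show ?thesis by linarith
  qed
  then have "measure cube Z \<le> 0"
    by (metis (no_types, opaque_lifting) reals_Archimedean3 not_less measure_nonneg less_eq_real_def)
  then have "emeasure cube Z = 0" by (simp add: emeasure_eq_measure measure_le_0_iff)
  then show ?thesis
    by (rule AE_I[of _ _ Z, rotated]) (use Z in \<open>auto simp: Z_def\<close>)
qed

text \<open>Monotone convergence of the truncations, whose means are bounded below.\<close>

lemma log_integrable: "integrable cube (\<lambda>\<theta>. ln (cmod (z - complex_of_real (V \<theta>))))" (is ?int)
  and trunc_log_mean_tendsto: "(\<lambda>n. torus_mean (trunc_log (exp (- real n)) z)) \<longlonglongrightarrow> G z" (is ?lim)
proof -
  obtain C where C: "\<And>z \<tau>. \<tau> > 0 \<Longrightarrow> - C \<le> torus_mean (trunc_log \<tau> z)"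
    using trunc_log_mean_bounded_below by blast
  let ?X = "\<lambda>n. torus_mean (trunc_log (exp (- real n)) z)"
  let ?u = "\<lambda>\<theta>. ln (cmod (z - complex_of_real (V \<theta>)))"
  have mono: "trunc_log (exp (- real n)) z \<theta> \<le> trunc_log (exp (- real m)) z \<theta>" if "m \<le> n" for m n :: nat and \<theta>
  proof -
    have "max (exp (- real n)) (cmod (z - complex_of_real (V \<theta>))) \<le> max (exp (- real m)) (cmod (z - complex_of_real (V \<theta>)))"
      by (intro max.mono) (use that in auto)
    then show ?thesis unfolding trunc_log_def by (subst ln_le_cancel_iff) (auto simp: less_max_iff_disj)
  qed
  have "decseq ?X"
    unfolding decseq_def using mono by (intro allI impI torus_mean_mono trunc_log_cont) auto
  then obtain L where L: "?X \<longlonglongrightarrow> L"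
    by (rule decseq_convergent[of _ "- C"]) (auto intro: C)
  have lim: "AE \<theta> in cube. (\<lambda>n. - trunc_log (exp (- real n)) z \<theta>) \<longlonglongrightarrow> - ?u \<theta>"
    using AE_off_level_set[of z]
  proof eventually_elim
    case (elim \<theta>)
    then have pos: "cmod (z - complex_of_real (V \<theta>)) > 0" by simp
    have "exp (- real n) = exp (- 1) ^ n" for n
      by (simp flip: exp_of_nat_mult)
    then have "(\<lambda>n. exp (- real n)) \<longlonglongrightarrow> 0"
      using LIMSEQ_realpow_zero[of "exp (- 1 :: real)"] by simp
    then have "eventually (\<lambda>n. exp (- real n) < cmod (z - complex_of_real (V \<theta>))) sequentially"
      using pos by (rule order_tendstoD)
    then have "eventually (\<lambda>n. - trunc_log (exp (- real n)) z \<theta> = - ?u \<theta>) sequentially"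
      by eventually_elim (simp add: trunc_log_def max_def)
    then show ?case by (rule tendsto_eventually)
  qed
  have ilim: "(\<lambda>n. LINT \<theta>|cube. - trunc_log (exp (- real n)) z \<theta>) \<longlonglongrightarrow> - L"
    using tendsto_minus[OF L] by (simp add: torus_mean_def)
  have meas: "?u \<in> borel_measurable cube"
    using torus_cont_measurable[OF shifted_cont[of z]] by measurable
  have i: "integrable cube (\<lambda>\<theta>. - trunc_log (exp (- real n)) z \<theta>)" for n
    by (intro Bochner_Integration.integrable_minus torus_cont_integrable trunc_log_cont) simp
  have m: "AE \<theta> in cube. mono (\<lambda>n. - trunc_log (exp (- real n)) z \<theta>)"
    using mono by (simp add: mono_def)
  have hb: "has_bochner_integral cube (\<lambda>\<theta>. - ?u \<theta>) (- L)"
    by (rule has_bochner_integral_monotone_convergence[OF i m lim ilim]) (use meas in simp)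
  then have "has_bochner_integral cube ?u L"
    using has_bochner_integral_minus[OF hb] by simp
  then show ?int and ?lim
    using L by (auto simp: G_eq torus_mean_def has_bochner_integral_iff)
qed

lemma G_le_trunc:
  assumes "\<tau> > 0"
  shows "G z \<le> torus_mean (trunc_log \<tau> z)"
  unfolding G_eq torus_mean_def
proof (rule integral_mono_AE[OF log_integrable torus_cont_integrable[OF trunc_log_cont[OF assms]]])
  show "AE \<theta> in cube. ln (cmod (z - complex_of_real (V \<theta>))) \<le> trunc_log \<tau> z \<theta>"
    using AE_off_level_set[of z]
    by eventually_elim (auto simp: trunc_log_def intro: ln_mono)
qed

lemma G_less_imp_trunc:
  assumes "G z < c"
  obtains \<tau> where "\<tau> > 0" "torus_mean (trunc_log \<tau> z) < c"
proof -
  have "eventually (\<lambda>n. torus_mean (trunc_log (exp (- real n)) z) < c) sequentially"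
    by (rule order_tendstoD(2)[OF trunc_log_mean_tendsto assms])
  then obtain n :: nat where "torus_mean (trunc_log (exp (- real n)) z) < c"
    by (auto simp: eventually_sequentially)
  then show ?thesis by (intro that[of "exp (- real n)"]) auto
qed

lemma G_bounded_below: obtains C where "\<And>z. - C \<le> G z"
proof -
  obtain C where C: "\<And>z \<tau>. \<tau> > 0 \<Longrightarrow> - C \<le> torus_mean (trunc_log \<tau> z)"
    using trunc_log_mean_bounded_below by blast
  have "- C \<le> G z" for z
    by (rule LIMSEQ_le_const[OF trunc_log_mean_tendsto[of z]]) (intro exI allI impI C exp_gt_zero)
  then show ?thesis by (rule that)
qed

lemma G_mono:
  assumes "\<And>\<theta>. cmod (z - complex_of_real (V \<theta>)) \<le> cmod (w - complex_of_real (V \<theta>))"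
  shows "G z \<le> G w"
  unfolding G_eq torus_mean_def
proof (rule integral_mono_AE[OF log_integrable log_integrable])
  show "AE \<theta> in cube. ln (cmod (z - complex_of_real (V \<theta>))) \<le> ln (cmod (w - complex_of_real (V \<theta>)))"
    using AE_off_level_set[of z] by eventually_elim (use assms in \<open>auto intro: ln_mono\<close>)
qed

lemma G_strict_mono:
  assumes "\<And>\<theta>. cmod (z - complex_of_real (V \<theta>)) < cmod (w - complex_of_real (V \<theta>))"
  shows "G z < G w"
proof -
  interpret finite_measure "cube :: (real ^ 'd) measure" by (rule prob_space_cube)
  show ?thesis
    unfolding G_eq torus_mean_def
  proof (rule integral_less_AE_space[OF log_integrable log_integrable])
    show "AE \<theta> in cube. ln (cmod (z - complex_of_real (V \<theta>))) < ln (cmod (w - complex_of_real (V \<theta>)))"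
      using AE_off_level_set[of z]
    proof eventually_elim
      case (elim \<theta>)
      then have "0 < cmod (z - complex_of_real (V \<theta>))" by simp
      then show ?case using assms[of \<theta>] by (subst ln_less_cancel_iff) auto
    qed
  qed (simp add: emeasure_cube)
qed

text \<open>The nearest point of the range, obtained by clamping the real part, is closer to every value of \<open>V\<close>.\<close>

lemma G_off_range_greater:
  assumes "z \<notin> R"
  obtains x where "x \<in> range V" "G (complex_of_real x) < G z"
proof -
  obtain m M where mM: "m \<le> M" "range V = {m..M}" by (rule range_interval)
  define x where "x = max m (min M (Re z))"
  have x: "x \<in> range V" unfolding mM(2) using mM(1) by (auto simp: x_def)
  have "cmod (complex_of_real x - complex_of_real (V \<theta>)) < cmod (z - complex_of_real (V \<theta>))" for \<theta>
  proof -
    have v: "m \<le> V \<theta>" "V \<theta> \<le> M" using mM(2) by (metis atLeastAtMost_iff rangeI)+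
    have n: "cmod (complex_of_real x - complex_of_real (V \<theta>)) = \<bar>x - V \<theta>\<bar>"
      by (metis norm_of_real of_real_diff)
    have re: "\<bar>Re z - V \<theta>\<bar> \<le> cmod (z - complex_of_real (V \<theta>))"
      using abs_Re_le_cmod[of "z - complex_of_real (V \<theta>)"] by simp
    show ?thesis
    proof (cases "Re z \<in> {m..M}")
      case True
      then have xz: "x = Re z" by (auto simp: x_def)
      have "Im z \<noteq> 0"
      proof
        assume "Im z = 0"
        then have "z = complex_of_real (Re z)" by (simp add: complex_eq_iff)
        then show False using True assms mM(2) by blast
      qed
      then have "(x - V \<theta>)\<^sup>2 < (Re z - V \<theta>)\<^sup>2 + (Im z)\<^sup>2" by (simp add: xz)
      then have "sqrt ((x - V \<theta>)\<^sup>2) < sqrt ((Re z - V \<theta>)\<^sup>2 + (Im z)\<^sup>2)" by (rule real_sqrt_less_mono)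
      then show ?thesis unfolding n by (simp add: cmod_def)
    next
      case False
      then have "\<bar>x - V \<theta>\<bar> < \<bar>Re z - V \<theta>\<bar>" using v mM(1) by (auto simp: x_def)
      then show ?thesis unfolding n using re by linarith
    qed
  qed
  then show ?thesis using that[OF x] G_strict_mono by blast
qed

lemma off_range_distance:
  assumes "z \<notin> R"
  obtains \<kappa> where "\<kappa> > 0" "\<And>\<theta>. \<kappa> \<le> cmod (z - complex_of_real (V \<theta>))"
proof -
  have "compact R"
    by (rule compact_continuous_image[OF _ torus_cont_compact_range[OF cont]]) (intro continuous_intros)
  then have "closed R" by (rule compact_imp_closed)
  then obtain \<kappa> where \<kappa>: "\<kappa> > 0" "\<And>y. y \<in> R \<Longrightarrow> \<kappa> \<le> dist z y"
    using separate_point_closed[OF _ assms] by blast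
  then show ?thesis using that[of \<kappa>] by (auto simp: dist_norm)
qed

lemma log_cont_off_range:
  assumes "z \<notin> R"
  shows "torus_cont (\<lambda>\<theta>. ln (cmod (z - complex_of_real (V \<theta>))))"
  using assms by (intro torus_cont_ln torus_cont_norm shifted_cont) auto

text \<open>If the quotient were a nonpositive number, \<open>z\<close> would be a convex combination of two values of \<open>V\<close>, and
the range is an interval. The principal branch therefore gives a continuous logarithm of \<open>z - V\<close>
up to a constant factor.\<close>

lemma quotient_not_nonpos:
  assumes "z \<notin> R"
  shows "(z - complex_of_real (V \<theta>)) / (z - complex_of_real (V \<eta>)) \<notin> \<real>\<^sub>\<le>\<^sub>0"
proof
  let ?v = "V \<theta>" and ?x = "V \<eta>"
  assume "(z - complex_of_real ?v) / (z - complex_of_real ?x) \<in> \<real>\<^sub>\<le>\<^sub>0"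
  then obtain t where t: "t \<le> 0" "(z - complex_of_real ?v) / (z - complex_of_real ?x) = complex_of_real t"
    by (auto elim!: nonpos_Reals_cases)
  have "z - complex_of_real ?x \<noteq> 0" using assms by auto
  then have "z - complex_of_real ?v = complex_of_real t * (z - complex_of_real ?x)"
    using t(2) by (simp add: divide_eq_eq)
  then have "z * complex_of_real (1 - t) = complex_of_real (?v - t * ?x)" by (simp add: algebra_simps)
  moreover have "complex_of_real (1 - t) \<noteq> 0" using t(1) by (simp del: of_real_diff)
  ultimately have z: "z = complex_of_real ((?v - t * ?x) / (1 - t))"
    unfolding of_real_divide by (intro eq_divide_imp)
  obtain m M where mM: "m \<le> M" "range V = {m..M}" by (rule range_interval)
  have v: "m \<le> ?v" "?v \<le> M" "m \<le> ?x" "?x \<le> M" using mM(2) by (metis atLeastAtMost_iff rangeI)+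
  have "- t * m \<le> - t * ?x" "- t * ?x \<le> - t * M" using t(1) v by (auto intro: mult_left_mono_neg)
  then have "m * (1 - t) \<le> ?v - t * ?x" "?v - t * ?x \<le> M * (1 - t)" using v by (simp_all add: algebra_simps)
  then have "(?v - t * ?x) / (1 - t) \<in> range V"
    unfolding mM(2) using t(1) by (simp add: le_divide_eq divide_le_eq)
  then show False using z assms by blast
qed

section \<open>The spectrum in terms of the potential\<close>

abbreviation A_op :: "complex \<Rightarrow> complex \<Rightarrow> (int ^ 'd \<Rightarrow> complex) \<Rightarrow> int ^ 'd \<Rightarrow> complex" where
  "A_op z \<mu> \<equiv> cocycle_op \<alpha> (\<lambda>\<theta>. z - complex_of_real (V \<theta>)) \<mu>"

lemma A_op_invertible_large_coupling:
  assumes "exp (G z) < cmod \<mu>"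
  shows "ell2_invertible (A_op z \<mu>)"
proof -
  have \<mu>: "cmod \<mu> > 0" using assms by (meson exp_gt_zero less_trans)
  then have "G z < ln (cmod \<mu>)" using assms by (metis exp_less_cancel_iff exp_ln)
  then obtain \<tau> where \<tau>: "\<tau> > 0" "torus_mean (trunc_log \<tau> z) < ln (cmod \<mu>)" by (rule G_less_imp_trunc)
  show ?thesis
  proof (rule cocycle_op_invertible_majorant[OF indep shifted_cont trunc_log_cont[OF \<tau>(1)]])
    show "cmod (z - complex_of_real (V \<theta>)) \<le> exp (trunc_log \<tau> z \<theta>)" for \<theta>
      using \<tau>(1) by (simp add: trunc_log_def less_max_iff_disj)
    show "exp (torus_mean (trunc_log \<tau> z)) < cmod \<mu>"
      using \<tau>(2) \<mu> by (metis exp_less_cancel_iff exp_ln)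
  qed
qed

lemma A_op_invertible_small_coupling:
  assumes "z \<notin> R" "cmod \<mu> < exp (G z)"
  shows "ell2_invertible (A_op z \<mu>)"
proof (rule cocycle_op_invertible_minorant[OF indep shifted_cont log_cont_off_range[OF assms(1)]])
  show "exp (ln (cmod (z - complex_of_real (V \<theta>)))) \<le> cmod (z - complex_of_real (V \<theta>))" for \<theta>
  proof -
    have "z \<noteq> complex_of_real (V \<theta>)" using assms(1) by auto
    then show ?thesis by simp
  qed
  show "cmod \<mu> < exp (torus_mean (\<lambda>\<theta>. ln (cmod (z - complex_of_real (V \<theta>)))))"
    using assms(2) by (simp add: G_eq)
qed

lemma A_op_not_invertible_critical:
  assumes z: "z \<notin> R" and \<mu>: "cmod \<mu> = exp (G z)"
  shows "\<not> ell2_invertible (A_op z \<mu>)"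
proof -
  let ?q = "\<lambda>\<theta>. (z - complex_of_real (V \<theta>)) / (z - complex_of_real (V 0))"
  \<comment> \<open>Dividing by the value at \<open>0\<close> keeps the quotient off the cut of the principal branch.\<close>
  define b where "b \<theta> = Ln (?q \<theta>) + Ln (z - complex_of_real (V 0))" for \<theta>
  have nz: "z - complex_of_real (V \<theta>) \<noteq> 0" for \<theta> using z by auto
  have q: "torus_cont ?q" by (intro torus_cont_divide shifted_cont torus_cont_const nz)
  have "torus_cont (\<lambda>\<theta>. Ln (?q \<theta>))"
    by (rule torus_cont_compose[OF q]) (use quotient_not_nonpos[OF z] in \<open>auto intro!: continuous_on_Ln\<close>)
  then have b: "torus_cont b" unfolding b_def[abs_def] by (intro torus_cont_add torus_cont_const)
  have eb: "exp (b \<theta>) = z - complex_of_real (V \<theta>)" for \<theta>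
    using nz[of \<theta>] nz[of 0] by (simp add: b_def exp_add)
  have "Re (b \<theta>) = ln (cmod (z - complex_of_real (V \<theta>)))" for \<theta>
    by (simp flip: eb add: norm_exp_eq_Re)
  then have "Re (torus_mean b) = G z" unfolding G_eq by (subst torus_mean_Re[OF b, symmetric]) simp
  then show ?thesis
    using cocycle_op_not_invertible_log[OF indep b, of \<mu>] \<mu> by (simp add: eb)
qed

lemma A_op_not_invertible_in_range:
  assumes "cmod \<mu> \<le> exp (G (complex_of_real (V \<theta>0)))"
  shows "\<not> ell2_invertible (A_op (complex_of_real (V \<theta>0)) \<mu>)"
proof (rule cocycle_op_not_invertible_in_range[OF indep cont])
  fix y :: real assume "y > 0"
  have "G (complex_of_real (V \<theta>0)) \<le> G (Complex (V \<theta>0) y)"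
  proof (rule G_mono)
    fix \<theta>
    show "cmod (complex_of_real (V \<theta>0) - complex_of_real (V \<theta>)) \<le> cmod (Complex (V \<theta>0) y - complex_of_real (V \<theta>))"
      using abs_Re_le_cmod[of "Complex (V \<theta>0) y - complex_of_real (V \<theta>)"]
      by (simp flip: of_real_diff)
  qed
  then have "exp (G (complex_of_real (V \<theta>0))) \<le> exp (G (Complex (V \<theta>0) y))" by simp
  then show "cmod \<mu> \<le> exp (torus_mean (\<lambda>\<theta>. ln (cmod (Complex (V \<theta>0) y - complex_of_real (V \<theta>)))))"
    using assms by (simp only: G_eq)
qed

lemma mult_op_shifted:
  assumes "u \<in> ell2"
  shows "mult_op (\<lambda>\<theta>. z - complex_of_real (V \<theta>)) u n = z * u n - mult_op (complex_of_real \<circ> V) u n"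
proof -
  have V: "torus_cont (complex_of_real \<circ> V)" using torus_cont_of_real[OF cont] by (simp add: comp_def)
  have V': "torus_cont (\<lambda>\<theta>. (-1) * (complex_of_real \<circ> V) \<theta>)" by (intro torus_cont_mult torus_cont_const V)
  have "mult_op (\<lambda>\<theta>. z + (-1) * (complex_of_real \<circ> V) \<theta>) u n
      = mult_op (\<lambda>_. z) u n + mult_op (\<lambda>\<theta>. (-1) * (complex_of_real \<circ> V) \<theta>) u n"
    by (rule mult_op_add_fun[OF torus_cont_const V' assms])
  then show ?thesis unfolding mult_op_const mult_op_cmult_fun by (simp add: comp_def)
qed

lemma spectrum_eq:
  "ell2_spectrum (H_op (complex_of_real \<circ> V) \<alpha> lam \<omega>) = {z. \<not> ell2_invertible (A_op z (lam * cis (2 * pi * \<omega>)))}"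
proof -
  let ?H = "H_op (complex_of_real \<circ> V) \<alpha> lam \<omega>" and ?\<mu> = "lam * cis (2 * pi * \<omega>)"
  have eq: "(\<lambda>n. z * u n - ?H u n) = A_op z ?\<mu> u" if "u \<in> ell2" for z u
    by (auto simp: H_op_eq cocycle_op_def mult_op_shifted[OF that])
  have "z \<in> ell2_resolvent_set ?H \<longleftrightarrow> ell2_invertible (\<lambda>u n. z * u n - ?H u n)" for z
    by (simp add: ell2_resolvent_set_def ell2_invertible_def)
  also have "ell2_invertible (\<lambda>u n. z * u n - ?H u n) \<longleftrightarrow> ell2_invertible (A_op z ?\<mu>)" for z
    by (rule ell2_invertible_cong) (rule eq)
  finally show ?thesis unfolding ell2_spectrum_def by auto
qed

text \<open>For \<open>z\<close> outside the range, the couplings of modulus smaller and larger than \<open>exp (G z)\<close> give invertible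
operators; in the range only the larger ones do.\<close>

theorem mem_spectrum_iff:
  "z \<in> ell2_spectrum (H_op (complex_of_real \<circ> V) \<alpha> lam \<omega>) \<longleftrightarrow>
    (if z \<in> R then cmod lam \<le> exp (G z) else cmod lam = exp (G z))"
proof -
  let ?\<mu> = "lam * cis (2 * pi * \<omega>)"
  have \<mu>: "cmod ?\<mu> = cmod lam" by (simp add: norm_mult)
  have inR: "\<not> ell2_invertible (A_op z ?\<mu>)" if "z \<in> R" "cmod lam \<le> exp (G z)"
    using that A_op_not_invertible_in_range[of ?\<mu>] \<mu> by auto
  show ?thesis
  proof (cases "z \<in> R")
    case True
    then have "\<not> ell2_invertible (A_op z ?\<mu>) \<longleftrightarrow> cmod lam \<le> exp (G z)"
      using inR A_op_invertible_large_coupling[of z ?\<mu>] \<mu> by (metis not_le)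
    then show ?thesis using True by (simp only: spectrum_eq mem_Collect_eq if_True)
  next
    case False
    then have "\<not> ell2_invertible (A_op z ?\<mu>) \<longleftrightarrow> cmod lam = exp (G z)"
      using A_op_invertible_large_coupling[of z ?\<mu>] A_op_invertible_small_coupling[of z ?\<mu>]
        A_op_not_invertible_critical[of z ?\<mu>] \<mu> by (metis linorder_neqE_linordered_idom)
    then show ?thesis using False by (simp only: spectrum_eq mem_Collect_eq if_False)
  qed
qed

end

section \<open>Real analytic level sets\<close>

text \<open>Multi-indices in two real variables, arranged by their total degree \<open>n\<close>.\<close>

lemma Basis_complex_functions_bij:
  "bij_betw (\<lambda>(n, j). \<lambda>b\<in>Basis. if b = (1::complex) then j else n - j) (Sigma UNIV (\<lambda>n::nat. {..n}))
     (Basis \<rightarrow>\<^sub>E UNIV)"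
  (is "bij_betw ?f ?A ?B")
proof (rule bij_betw_byWitness[where f' = "\<lambda>m. (m 1 + m \<i>, m 1)"])
  have ne: "(1::complex) \<noteq> \<i>" by (simp add: complex_eq_iff)
  show "\<forall>a\<in>?A. (\<lambda>m. (m 1 + m \<i>, m 1)) (?f a) = a"
    using ne by (auto simp: Basis_complex_def)
  show "\<forall>m\<in>?B. ?f (m 1 + m \<i>, m 1) = m"
  proof
    fix m :: "complex \<Rightarrow> nat" assume m: "m \<in> ?B"
    show "?f (m 1 + m \<i>, m 1) = m"
    proof
      fix b show "?f (m 1 + m \<i>, m 1) b = m b"
        using m by (cases "b \<in> Basis") (auto simp: Basis_complex_def PiE_def extensional_def)
    qed
  qed
qed auto

text \<open>Expanding \<open>(s + i t)\<^sup>n\<close> in the power series by the binomial theorem gives a double series, which is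
absolutely convergent because \<open>\<bar>s\<bar> + \<bar>t\<bar>\<close> is less than the radius of convergence.\<close>

theorem holomorphic_imp_real_analytic_on:
  fixes f :: "complex \<Rightarrow> complex"
  assumes f: "f holomorphic_on U" and "open U"
  shows "real_analytic_on f U"
  unfolding real_analytic_on_def
proof
  fix x assume "x \<in> U"
  then obtain R where R: "R > 0" "ball x R \<subseteq> U" using \<open>open U\<close> by (auto simp: open_contains_ball)
  have fb: "f holomorphic_on ball x R" by (rule holomorphic_on_subset[OF f R(2)])
  define a where "a n = (deriv ^^ n) f x / fact n" for n
  have a: "(\<lambda>n. a n * (w - x) ^ n) sums f w" if "w \<in> ball x R" for w
    using holomorphic_power_series[OF fb that] by (simp add: a_def)
  define c where "c m = a (m 1 + m \<i>) * of_nat ((m 1 + m \<i>) choose m 1) * \<i> ^ m \<i>" for m :: "complex \<Rightarrow> nat"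
  have "((\<lambda>m. (\<Prod>b\<in>Basis. ((y - x) \<bullet> b) ^ m b) *\<^sub>R c m) has_sum f y) (Basis \<rightarrow>\<^sub>E UNIV)"
    if y: "y \<in> ball x (R / 3)" for y
  proof -
    define s where "s = Re (y - x)"
    define t where "t = Im (y - x)"
    have yx: "y - x = complex_of_real s + \<i> * complex_of_real t" by (simp add: s_def t_def complex_eq_iff)
    have "cmod (y - x) < R / 3" using y by (simp add: dist_norm norm_minus_commute)
    then have st: "\<bar>s\<bar> + \<bar>t\<bar> < 2 * R / 3"
      using abs_Re_le_cmod[of "y - x"] abs_Im_le_cmod[of "y - x"] by (simp add: s_def t_def)
    define h where "h n j = a n * of_nat (n choose j) * complex_of_real s ^ j * (\<i> * complex_of_real t) ^ (n - j)" for n j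
    have sumh: "(\<Sum>j\<le>n. h n j) = a n * (y - x) ^ n" for n
      unfolding yx binomial_ring by (simp add: h_def sum_distrib_left mult_ac)
    have sumn: "(\<Sum>j\<le>n. norm (h n j)) = norm (a n * complex_of_real (\<bar>s\<bar> + \<bar>t\<bar>) ^ n)" for n
    proof -
      have "(\<Sum>j\<le>n. norm (h n j)) = norm (a n) * (\<bar>s\<bar> + \<bar>t\<bar>) ^ n"
        unfolding binomial_ring by (simp add: h_def norm_mult norm_power sum_distrib_left mult_ac)
      also have "\<dots> = norm (a n * complex_of_real (\<bar>s\<bar> + \<bar>t\<bar>) ^ n)"
        by (simp add: norm_mult norm_power del: of_real_add)
      finally show ?thesis .
    qed
    have "x + complex_of_real (2 * R / 3) \<in> ball x R" using R(1) by (simp add: dist_norm)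
    from sums_summable[OF a[OF this]]
    have "summable (\<lambda>n. a n * complex_of_real (2 * R / 3) ^ n)" by simp
    then have "summable (\<lambda>n. norm (a n * complex_of_real (\<bar>s\<bar> + \<bar>t\<bar>) ^ n))"
      by (rule powser_insidea) (use st R(1) in \<open>simp only: norm_of_real; linarith\<close>)
    then have sm: "(\<lambda>n. \<Sum>j\<le>n. norm (h n j)) summable_on UNIV"
      unfolding sumn by (subst summable_on_UNIV_nonneg_real_iff) auto
    have "(\<lambda>(n, j). norm (h n j)) summable_on Sigma UNIV (\<lambda>n. {..n})"
      by (rule summable_on_SigmaI[OF _ sm]) (auto intro!: has_sum_finite)
    then have "(\<lambda>p. norm (case p of (n, j) \<Rightarrow> h n j)) summable_on Sigma UNIV (\<lambda>n. {..n})"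
      by (simp add: split_beta')
    then have hs: "(\<lambda>(n, j). h n j) summable_on Sigma UNIV (\<lambda>n. {..n})"
      by (rule abs_summable_summable)
    have "((\<lambda>n. \<Sum>j\<le>n. h n j) has_sum infsum (\<lambda>(n, j). h n j) (Sigma UNIV (\<lambda>n. {..n}))) UNIV"
      by (rule has_sum_SigmaD[OF has_sum_infsum[OF hs]]) (auto intro: has_sum_finite)
    then have "(\<lambda>n. a n * (y - x) ^ n) sums infsum (\<lambda>(n, j). h n j) (Sigma UNIV (\<lambda>n. {..n}))"
      unfolding sumh by (rule has_sum_imp_sums)
    moreover have "(\<lambda>n. a n * (y - x) ^ n) sums f y" by (rule a) (use y R(1) in simp)
    ultimately have "infsum (\<lambda>(n, j). h n j) (Sigma UNIV (\<lambda>n. {..n})) = f y" by (rule sums_unique2)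
    then have fin: "((\<lambda>(n, j). h n j) has_sum f y) (Sigma UNIV (\<lambda>n. {..n}))"
      using has_sum_infsum[OF hs] by simp
    let ?g = "\<lambda>(n, j). \<lambda>b\<in>Basis. if b = (1::complex) then j else n - (j::nat)"
    have ne: "(1::complex) \<noteq> \<i>" by (simp add: complex_eq_iff)
    let ?F = "\<lambda>m. (\<Prod>b\<in>Basis. ((y - x) \<bullet> b) ^ m b) *\<^sub>R c m"
    have "?F (?g p) = (case p of (n, j) \<Rightarrow> h n j)" if "p \<in> Sigma UNIV (\<lambda>n. {..n})" for p
    proof -
      obtain n j where p: "p = (n, j)" "j \<le> n" using \<open>p \<in> _\<close> by auto
      have "(\<Prod>b\<in>Basis. ((y - x) \<bullet> b) ^ (?g p) b) = s ^ j * t ^ (n - j)"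
        using ne by (simp add: Basis_complex_def p s_def t_def inner_complex_def)
      moreover have "c (?g p) = a n * of_nat (n choose j) * \<i> ^ (n - j)"
        using ne p(2) by (simp add: c_def p Basis_complex_def)
      ultimately show ?thesis by (simp add: p h_def scaleR_conv_of_real power_mult_distrib mult_ac)
    qed
    then have "((\<lambda>p. ?F (?g p)) has_sum f y) (Sigma UNIV (\<lambda>n. {..n}))"
      using fin by (subst has_sum_cong[where g = "\<lambda>(n, j). h n j"]) auto
    then show ?thesis
      by (rule has_sum_reindex_bij_betw[OF Basis_complex_functions_bij, where f = ?F, THEN iffD1])
  qed
  then show "\<exists>c. \<exists>r>0. \<forall>y\<in>ball x r. ((\<lambda>m. (\<Prod>b\<in>Basis. ((y - x) \<bullet> b) ^ m b) *\<^sub>R c m) has_sum f y) (Basis \<rightarrow>\<^sub>E UNIV)"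
    using R(1) by (intro exI[of _ c] exI[of _ "R / 3"]) auto
qed

text \<open>The chart is \<open>i g\<close>, which is locally biholomorphic and real exactly where the real part of \<open>g\<close> vanishes.\<close>

lemma level_set_real_analytic_curve:
  assumes "S \<noteq> {}"
    and loc: "\<And>p. p \<in> S \<Longrightarrow> \<exists>r>0. \<exists>g. g holomorphic_on ball p r \<and> deriv g p \<noteq> 0 \<and> (\<forall>z\<in>ball p r. z \<in> S \<longleftrightarrow> Re (g z) = 0)"
  shows "real_analytic_curve S"
  unfolding real_analytic_curve_def
proof (intro conjI assms(1) ballI)
  fix p assume "p \<in> S"
  then obtain r g where r: "r > 0" and g: "g holomorphic_on ball p r" "deriv g p \<noteq> 0"
    and S: "\<And>z. z \<in> ball p r \<Longrightarrow> z \<in> S \<longleftrightarrow> Re (g z) = 0"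
    using loc by blast
  define \<phi> where "\<phi> z = \<i> * g z" for z
  have \<phi>: "\<phi> holomorphic_on ball p r" unfolding \<phi>_def[abs_def] by (intro holomorphic_intros g)
  have "g field_differentiable at p" using g(1) r by (intro holomorphic_on_imp_differentiable_at[of _ "ball p r"]) auto
  then have "deriv \<phi> p = \<i> * deriv g p" unfolding \<phi>_def[abs_def] by (rule deriv_cmult)
  then have d: "deriv \<phi> p \<noteq> 0" using g(2) by simp
  obtain \<rho> where \<rho>: "\<rho> > 0" "ball p \<rho> \<subseteq> ball p r" "inj_on \<phi> (ball p \<rho>)"
    using has_complex_derivative_locally_injective[OF \<phi> _ open_ball d] r by auto
  let ?U = "ball p \<rho>"
  have hU: "\<phi> holomorphic_on ?U" by (rule holomorphic_on_subset[OF \<phi> \<rho>(2)])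
  obtain \<psi> where \<psi>: "\<psi> holomorphic_on (\<phi> ` ?U)" "\<And>z. z \<in> ?U \<Longrightarrow> deriv \<phi> z * deriv \<psi> (\<phi> z) = 1" "\<And>z. z \<in> ?U \<Longrightarrow> \<psi> (\<phi> z) = z"
    by (rule holomorphic_has_inverse[OF hU open_ball \<rho>(3)]) blast
  have oW: "open (\<phi> ` ?U)" by (rule open_mapping_thm3[OF hU open_ball \<rho>(3)])
  have hom: "homeomorphism ?U (\<phi> ` ?U) \<phi> \<psi>"
    unfolding homeomorphism_def using \<psi>(3)
    by (auto intro: holomorphic_on_imp_continuous_on[OF hU] holomorphic_on_imp_continuous_on[OF \<psi>(1)] simp: image_iff)
  have "\<phi> ` (S \<inter> ?U) = \<phi> ` ?U \<inter> \<real>"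
  proof -
    have "z \<in> S \<longleftrightarrow> \<phi> z \<in> \<real>" if "z \<in> ?U" for z
      using S[of z] that \<rho>(2) by (auto simp: \<phi>_def complex_is_Real_iff)
    then show ?thesis by blast
  qed
  then show "\<exists>U W (\<phi> :: complex \<Rightarrow> complex) \<psi>. open U \<and> open W \<and> p \<in> U \<and> homeomorphism U W \<phi> \<psi> \<and>
        real_analytic_on \<phi> U \<and> real_analytic_on \<psi> W \<and> \<phi> ` (S \<inter> U) = W \<inter> \<real>"
    using hom oW \<rho>(1) holomorphic_imp_real_analytic_on[OF hU open_ball] holomorphic_imp_real_analytic_on[OF \<psi>(1) oW]
    by (intro exI[of _ ?U] exI[of _ "\<phi> ` ?U"] exI[of _ \<phi>] exI[of _ \<psi>]) simp
qed

section \<open>Harmonicity and continuity of the potential\<close>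

lemma torus_mean_nonzero_of_sign:
  fixes f :: "real ^ 'd \<Rightarrow> real"
  assumes f: "torus_cont f" and "(\<forall>\<theta>. f \<theta> > 0) \<or> (\<forall>\<theta>. f \<theta> < 0)"
  shows "torus_mean f \<noteq> 0"
proof
  assume 0: "torus_mean f = 0"
  from assms(2) show False
  proof
    assume pos: "\<forall>\<theta>. f \<theta> > 0"
    then have "f 0 = 0" by (intro torus_mean_eq_0_imp[OF f _ 0]) (auto intro: less_imp_le)
    then show False using pos by (metis less_irrefl)
  next
    assume neg: "\<forall>\<theta>. f \<theta> < 0"
    have "torus_mean (\<lambda>\<theta>. 0 - f \<theta>) = 0" unfolding torus_mean_diff[OF torus_cont_const f] 0 by simp
    then have "0 - f 0 = 0"
      using neg by (intro torus_mean_eq_0_imp[of "\<lambda>\<theta>. 0 - f \<theta>"] torus_cont_diff torus_cont_const f) (auto intro: less_imp_le)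
    then show False using neg by (metis diff_0 less_irrefl neg_equal_0_iff_equal)
  qed
qed

text \<open>The gauge integral is needed for the differentiation under the integral sign.\<close>

lemma torus_mean_eq_integral:
  fixes f :: "real ^ 'd \<Rightarrow> 'b::euclidean_space"
  assumes "torus_cont f"
  shows "f integrable_on cbox 0 1" "torus_mean f = integral (cbox 0 1) f"
proof -
  have "continuous_on (cbox 0 1) f" using assms by (auto simp: torus_cont_def intro: continuous_on_subset)
  then have "set_integrable lborel (cbox 0 1) f"
    unfolding set_integrable_def by (intro borel_integrable_compact compact_cbox)
  then show "f integrable_on cbox 0 1" "torus_mean f = integral (cbox 0 1) f"
    unfolding torus_mean_eq by (rule set_borel_integral_eq_integral)+
qed

context analytic_potential
begin

text \<open>The function is \<open>g z = \<integral> Ln ((z - V) / (p - V))\<close>; near \<open>p\<close> the quotient stays in the right half plane. Its derivative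
at \<open>p\<close> is \<open>\<integral> 1 / (p - V)\<close>, and the imaginary part of the integrand has a constant sign if \<open>p\<close> is not
real, while the integrand itself has a constant sign if \<open>p\<close> is real and outside the interval of values of \<open>V\<close>.\<close>

lemma G_locally_harmonic:
  assumes p: "p \<notin> R"
  obtains r g where "r > 0" "g holomorphic_on ball p r" "deriv g p \<noteq> 0"
    "\<And>z. z \<in> ball p r \<Longrightarrow> z \<notin> R \<and> G z = G p + Re (g z)"
proof -
  obtain r where r: "r > 0" "\<And>\<theta>. r \<le> cmod (p - complex_of_real (V \<theta>))" using off_range_distance[OF p] by blast
  let ?q = "\<lambda>z \<theta>. (z - complex_of_real (V \<theta>)) / (p - complex_of_real (V \<theta>))"
  have pn: "p - complex_of_real (V \<theta>) \<noteq> 0" for \<theta> using p by auto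
  have qr: "Re (?q z \<theta>) > 0" if z: "z \<in> ball p r" for z \<theta>
  proof -
    have "?q z \<theta> - 1 = (z - p) / (p - complex_of_real (V \<theta>))" using pn[of \<theta>] by (simp add: field_simps)
    then have "cmod (?q z \<theta> - 1) = cmod (z - p) / cmod (p - complex_of_real (V \<theta>))" by (simp add: norm_divide)
    also have "\<dots> < 1"
    proof -
      have "cmod (z - p) < r" using z by (simp add: dist_norm norm_minus_commute)
      also have "\<dots> \<le> cmod (p - complex_of_real (V \<theta>))" by (rule r(2))
      finally show ?thesis using pn[of \<theta>] by simp
    qed
    finally show ?thesis using abs_Re_le_cmod[of "?q z \<theta> - 1"] by simp
  qed
  have qn: "?q z \<theta> \<notin> \<real>\<^sub>\<le>\<^sub>0" if "z \<in> ball p r" for z \<theta>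
    using qr[OF that, of \<theta>] by (auto elim!: nonpos_Reals_cases)
  have zn: "z - complex_of_real (V \<theta>) \<noteq> 0" if "z \<in> ball p r" for z \<theta>
    using qr[OF that, of \<theta>] by auto
  have zR: "z \<notin> R" if "z \<in> ball p r" for z using zn[OF that] by auto
  have qc: "torus_cont (?q z)" for z by (intro torus_cont_divide shifted_cont pn)
  have lc: "torus_cont (\<lambda>\<theta>. Ln (?q z \<theta>))" if "z \<in> ball p r" for z
    by (rule torus_cont_compose[OF qc]) (use qn[OF that] in \<open>auto intro!: continuous_on_Ln\<close>)
  define g where "g z = integral (cbox 0 1) (\<lambda>\<theta>. Ln (?q z \<theta>))" for z
  have gm: "g z = torus_mean (\<lambda>\<theta>. Ln (?q z \<theta>))" if "z \<in> ball p r" for z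
    unfolding g_def by (rule torus_mean_eq_integral(2)[OF lc[OF that], symmetric])
  have der: "((\<lambda>z. Ln (?q z \<theta>)) has_field_derivative 1 / (z - complex_of_real (V \<theta>))) (at z within ball p r)"
    if z: "z \<in> ball p r" for z \<theta>
  proof -
    have "((\<lambda>z. Ln (?q z \<theta>)) has_field_derivative (1 / (p - complex_of_real (V \<theta>))) / ?q z \<theta>) (at z within ball p r)"
      using qn[OF z, of \<theta>] pn[of \<theta>] by (auto intro!: derivative_eq_intros)
    then show ?thesis using pn[of \<theta>] by simp
  qed
  have Vc: "continuous_on A V" for A using cont by (auto simp: torus_cont_def intro: continuous_on_subset)
  have cf: "continuous_on (ball p r \<times> cbox 0 1) (\<lambda>(z, \<theta>). 1 / (z - complex_of_real (V \<theta>)))"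
    unfolding split_beta' using zn
    by (intro continuous_intros continuous_on_compose2[OF Vc[of UNIV]]) auto
  have int: "(\<lambda>\<theta>. Ln (?q z \<theta>)) integrable_on cbox 0 1" if "z \<in> ball p r" for z
    by (rule torus_mean_eq_integral(1)[OF lc[OF that]])
  have hol: "g holomorphic_on ball p r"
    unfolding g_def[abs_def] by (rule leibniz_rule_holomorphic[OF der int cf]) auto
  have dg: "(g has_field_derivative integral (cbox 0 1) (\<lambda>\<theta>. 1 / (p - complex_of_real (V \<theta>)))) (at p within ball p r)"
    unfolding g_def[abs_def] by (rule leibniz_rule_field_derivative[OF der int cf]) (use r in auto)
  let ?k = "\<lambda>\<theta>. 1 / (p - complex_of_real (V \<theta>))"
  have kc: "torus_cont ?k" by (intro torus_cont_divide torus_cont_const shifted_cont pn)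
  have "integral (cbox 0 1) ?k = torus_mean ?k" by (rule torus_mean_eq_integral(2)[OF kc, symmetric])
  moreover have "torus_mean ?k \<noteq> 0"
  proof (cases "Im p = 0")
    case False
    have "Im (torus_mean ?k) = torus_mean (\<lambda>\<theta>. Im (?k \<theta>))"
      unfolding torus_mean_def using torus_cont_integrable[OF kc] by (rule integral_Im[symmetric])
    moreover have "torus_mean (\<lambda>\<theta>. Im (?k \<theta>)) \<noteq> 0"
    proof (rule torus_mean_nonzero_of_sign[OF torus_cont_Im[OF kc]])
      have im: "Im (?k \<theta>) = - Im p / ((Re p - V \<theta>)\<^sup>2 + (Im p)\<^sup>2)" for \<theta> by (simp add: Im_divide)
      have den: "(Re p - V \<theta>)\<^sup>2 + (Im p)\<^sup>2 > 0" for \<theta> using False by (simp add: add_nonneg_pos)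
      show "(\<forall>\<theta>. 0 < Im (?k \<theta>)) \<or> (\<forall>\<theta>. Im (?k \<theta>) < 0)"
        unfolding im using den False by (cases "Im p > 0") (auto simp: zero_less_divide_iff divide_less_0_iff not_less)
    qed
    ultimately show ?thesis by auto
  next
    case True
    then have pr: "p = complex_of_real (Re p)" by (simp add: complex_eq_iff)
    obtain m M where mM: "m \<le> M" "range V = {m..M}" by (rule range_interval)
    have v: "m \<le> V \<theta>" "V \<theta> \<le> M" for \<theta> using mM(2) by (metis atLeastAtMost_iff rangeI)+
    have "Re p \<notin> {m..M}" using p pr mM(2) by blast
    then have sgn: "(\<forall>\<theta>. Re p - V \<theta> > 0) \<or> (\<forall>\<theta>. Re p - V \<theta> < 0)"
    proof (cases "Re p < m")
      case True
      then show ?thesis using less_le_trans[OF True v(1)] by simp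
    next
      case False
      then have "M < Re p" using \<open>Re p \<notin> {m..M}\<close> by simp
      then show ?thesis using le_less_trans[OF v(2) \<open>M < Re p\<close>] by simp
    qed
    have re: "?k \<theta> = complex_of_real (1 / (Re p - V \<theta>))" for \<theta> by (subst pr) simp
    have "Re (torus_mean ?k) = torus_mean (\<lambda>\<theta>. Re (?k \<theta>))" by (rule torus_mean_Re[OF kc, symmetric])
    moreover have "torus_mean (\<lambda>\<theta>. Re (?k \<theta>)) \<noteq> 0"
    proof (rule torus_mean_nonzero_of_sign[OF torus_cont_Re[OF kc]])
      show "(\<forall>\<theta>. 0 < Re (?k \<theta>)) \<or> (\<forall>\<theta>. Re (?k \<theta>) < 0)"
        unfolding re Re_complex_of_real using sgn by (auto simp: zero_less_divide_iff divide_less_0_iff)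
    qed
    ultimately show ?thesis by auto
  qed
  moreover have "deriv g p = integral (cbox 0 1) ?k"
    using dg r(1) by (intro DERIV_imp_deriv) (simp add: at_within_open[OF _ open_ball])
  ultimately have dn: "deriv g p \<noteq> 0" by simp
  have val: "G z = G p + Re (g z)" if z: "z \<in> ball p r" for z
  proof -
    have "Re (g z) = torus_mean (\<lambda>\<theta>. Re (Ln (?q z \<theta>)))" unfolding gm[OF z] by (rule torus_mean_Re[OF lc[OF z], symmetric])
    also have "(\<lambda>\<theta>. Re (Ln (?q z \<theta>))) = (\<lambda>\<theta>. ln (cmod (z - complex_of_real (V \<theta>))) - ln (cmod (p - complex_of_real (V \<theta>))))"
    proof
      fix \<theta>
      have "?q z \<theta> \<noteq> 0" using zn[OF z, of \<theta>] pn[of \<theta>] by simp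
      then show "Re (Ln (?q z \<theta>)) = ln (cmod (z - complex_of_real (V \<theta>))) - ln (cmod (p - complex_of_real (V \<theta>)))"
        using zn[OF z, of \<theta>] pn[of \<theta>] by (simp add: norm_divide ln_div)
    qed
    also have "torus_mean \<dots> = G z - G p"
      unfolding G_eq by (intro torus_mean_diff log_cont_off_range zR[OF z] p)
    finally show ?thesis by simp
  qed
  show ?thesis by (rule that[OF r(1) hol dn]) (use zR val in blast)
qed

lemma G_continuous_off_range: "continuous_on (- R) G"
proof (rule continuous_at_imp_continuous_on, rule ballI)
  fix p assume "p \<in> - R"
  then have "p \<notin> R" by simp
  obtain r g where r: "r > 0" "g holomorphic_on ball p r" "deriv g p \<noteq> 0"
    "\<And>z. z \<in> ball p r \<Longrightarrow> z \<notin> R \<and> G z = G p + Re (g z)"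
    using that by (rule G_locally_harmonic[OF \<open>p \<notin> R\<close>])
  have "continuous_on (ball p r) (\<lambda>z. G p + Re (g z))"
    by (intro continuous_intros holomorphic_on_imp_continuous_on r)
  then have "continuous_on (ball p r) G"
    by (rule continuous_on_eq) (use r(4) in auto)
  then show "isCont G p" using r(1) by (simp add: continuous_on_eq_continuous_at)
qed

text \<open>The intermediate value theorem on the vertical line through \<open>x\<close>. Near the real axis \<open>G\<close> is
bounded by means of truncated logarithms, which tend to \<open>G x < c\<close>, and at height \<open>e\<^sup>c\<close> it
is at least \<open>c\<close>.\<close>

lemma vertical_level_point:
  assumes x: "x \<in> range V" and less: "G (complex_of_real x) < c"
  obtains y where "y > 0" "Complex x y \<notin> R" "G (Complex x y) = c"
proof -
  have nR: "Complex x y \<notin> R" if "y \<noteq> 0" for y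
    using that by (auto simp: complex_eq_iff)
  obtain \<tau> where \<tau>: "\<tau> > 0" "torus_mean (trunc_log \<tau> (complex_of_real x)) < c" by (rule G_less_imp_trunc[OF less])
  define T where "T = torus_mean (trunc_log \<tau> (complex_of_real x))"
  have low: "G (Complex x y) \<le> T + ln (1 + y / \<tau>)" if y: "y > 0" for y
  proof -
    have "torus_mean (\<lambda>\<theta>. ln (cmod (Complex x y - complex_of_real (V \<theta>))))
        \<le> torus_mean (\<lambda>\<theta>. trunc_log \<tau> (complex_of_real x) \<theta> + ln (1 + y / \<tau>))"
    proof (intro torus_mean_mono torus_cont_add torus_cont_const trunc_log_cont \<tau>(1) log_cont_off_range nR)
      show "y \<noteq> 0" using y by simp
      fix \<theta>
      let ?m = "max \<tau> (cmod (complex_of_real x - complex_of_real (V \<theta>)))"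
      have m: "?m \<ge> \<tau>" by simp
      have "Complex x y - complex_of_real (V \<theta>) \<noteq> 0" using y by (simp add: complex_eq_iff)
      then have pos: "cmod (Complex x y - complex_of_real (V \<theta>)) > 0" by simp
      have "Complex x y - complex_of_real (V \<theta>) = (complex_of_real x - complex_of_real (V \<theta>)) + \<i> * complex_of_real y"
        by (simp add: Complex_eq)
      then have "cmod (Complex x y - complex_of_real (V \<theta>)) \<le> cmod (complex_of_real x - complex_of_real (V \<theta>)) + cmod (\<i> * complex_of_real y)"
        by (metis norm_triangle_ineq)
      also have "\<dots> \<le> ?m + y" using y by (simp add: norm_mult)
      also have "\<dots> \<le> ?m + ?m * (y / \<tau>)"
        using m y \<tau>(1) mult_right_mono[OF m, of "y / \<tau>"] by simp
      also have "\<dots> = ?m * (1 + y / \<tau>)" by (simp add: distrib_left)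
      finally have "ln (cmod (Complex x y - complex_of_real (V \<theta>))) \<le> ln (?m * (1 + y / \<tau>))"
        using pos by (intro ln_mono)
      also have "\<dots> = ln ?m + ln (1 + y / \<tau>)"
        using y \<tau>(1) by (intro ln_mult_pos) (auto simp: less_max_iff_disj add_pos_pos)
      finally show "ln (cmod (Complex x y - complex_of_real (V \<theta>))) \<le> trunc_log \<tau> (complex_of_real x) \<theta> + ln (1 + y / \<tau>)"
        by (simp add: trunc_log_def)
    qed
    also have "\<dots> = T + ln (1 + y / \<tau>)"
      unfolding torus_mean_add[OF trunc_log_cont[OF \<tau>(1)] torus_cont_const] T_def by simp
    finally show ?thesis unfolding G_eq .
  qed
  \<comment> \<open>The second bound for \<open>y0\<close> is the height where \<open>T + ln (1 + y / \<tau>)\<close> equals \<open>c\<close>; the first one keeps \<open>y0\<close> below the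
    upper end \<open>e\<^sup>c\<close>.\<close>
  define y0 where "y0 = min (exp c) (\<tau> * (exp (c - T) - 1))"
  have cT: "exp (c - T) > 1" using \<tau>(2) by (simp add: T_def)
  have y0: "y0 > 0" "y0 \<le> exp c" using \<tau>(1) cT by (auto simp: y0_def)
  have "y0 / \<tau> \<le> exp (c - T) - 1"
    using \<tau>(1) by (simp add: y0_def pos_divide_le_eq mult.commute min.coboundedI2)
  then have "ln (1 + y0 / \<tau>) \<le> ln (exp (c - T))"
    using y0(1) \<tau>(1) by (intro ln_mono) (auto simp: add_pos_pos)
  then have lo: "G (Complex x y0) \<le> c" using low[OF y0(1)] by simp
  have hi: "c \<le> G (Complex x (exp c))"
  proof -
    have "torus_mean (\<lambda>_::real ^ 'd. c) \<le> torus_mean (\<lambda>\<theta>. ln (cmod (Complex x (exp c) - complex_of_real (V \<theta>))))"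
    proof (intro torus_mean_mono torus_cont_const log_cont_off_range nR)
      fix \<theta>
      have "exp c \<le> cmod (Complex x (exp c) - complex_of_real (V \<theta>))"
        using abs_Im_le_cmod[of "Complex x (exp c) - complex_of_real (V \<theta>)"] by simp
      then have "ln (exp c) \<le> ln (cmod (Complex x (exp c) - complex_of_real (V \<theta>)))" by (intro ln_mono) auto
      then show "c \<le> ln (cmod (Complex x (exp c) - complex_of_real (V \<theta>)))" by simp
    qed simp
    then show ?thesis unfolding G_eq by simp
  qed
  have "continuous_on {y0..exp c} (\<lambda>y. G (Complex x y))"
  proof (rule continuous_on_compose2[OF G_continuous_off_range])
    show "continuous_on {y0..exp c} (Complex x)"
      unfolding Complex_eq[abs_def] by (intro continuous_intros)
    have "Complex x y \<in> - R" if "y \<in> {y0..exp c}" for y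
      using nR[of y] y0(1) that by simp
    then show "Complex x ` {y0..exp c} \<subseteq> - R" by (rule image_subsetI)
  qed
  then obtain y where y: "y0 \<le> y" "y \<le> exp c" "G (Complex x y) = c"
    using IVT'[of "\<lambda>y. G (Complex x y)" y0 c "exp c"] lo hi y0(2) by blast
  then show ?thesis using that[of y] nR[of y] y0(1) by auto
qed

lemma trunc_log_mean_lipschitz:
  assumes "\<tau> > 0"
  shows "torus_mean (trunc_log \<tau> z) \<le> torus_mean (trunc_log \<tau> w) + cmod (z - w) / \<tau>"
proof -
  have "torus_mean (trunc_log \<tau> z) \<le> torus_mean (\<lambda>\<theta>. trunc_log \<tau> w \<theta> + cmod (z - w) / \<tau>)"
  proof (intro torus_mean_mono torus_cont_add torus_cont_const trunc_log_cont assms)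
    fix \<theta>
    let ?m = "max \<tau> (cmod (w - complex_of_real (V \<theta>)))" and ?n = "max \<tau> (cmod (z - complex_of_real (V \<theta>)))"
    have m: "?m \<ge> \<tau>" and n: "?n \<ge> \<tau>" by simp_all
    have "cmod (z - complex_of_real (V \<theta>)) \<le> cmod (w - complex_of_real (V \<theta>)) + cmod (z - w)"
      using norm_triangle_ineq[of "w - complex_of_real (V \<theta>)" "z - w"] by simp
    then have "?n \<le> ?m + cmod (z - w)" using norm_ge_zero[of "z - w"] by linarith
    also have "\<dots> \<le> ?m + ?m * (cmod (z - w) / \<tau>)"
      using assms mult_right_mono[OF m, of "cmod (z - w) / \<tau>"] by simp
    also have "\<dots> = ?m * (1 + cmod (z - w) / \<tau>)" by (simp add: distrib_left)
    finally have "ln ?n \<le> ln (?m * (1 + cmod (z - w) / \<tau>))" using n assms by (intro ln_mono) linarith+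
    also have "\<dots> = ln ?m + ln (1 + cmod (z - w) / \<tau>)"
      using assms by (intro ln_mult_pos) (auto simp: less_max_iff_disj add_pos_nonneg)
    also have "ln (1 + cmod (z - w) / \<tau>) \<le> cmod (z - w) / \<tau>"
      using assms by (intro ln_add_one_self_le_self) simp
    finally show "trunc_log \<tau> z \<theta> \<le> trunc_log \<tau> w \<theta> + cmod (z - w) / \<tau>" by (simp add: trunc_log_def)
  qed
  then show ?thesis by (simp add: torus_mean_add trunc_log_cont assms torus_cont_const)
qed

lemma G_bounded_above_on_range: "bdd_above (G ` R)"
proof -
  obtain B where B: "B > 0" "\<And>\<theta>. \<bar>V \<theta>\<bar> \<le> B" using torus_cont_bounded[OF cont] unfolding real_norm_def by blast
  have "G (complex_of_real (V \<eta>)) \<le> ln (max 1 (2 * B))" for \<eta>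
  proof -
    have "torus_mean (trunc_log 1 (complex_of_real (V \<eta>))) \<le> torus_mean (\<lambda>_::real ^ 'd. ln (max 1 (2 * B)))"
    proof (intro torus_mean_mono trunc_log_cont torus_cont_const)
      fix \<theta>
      have "cmod (complex_of_real (V \<eta>) - complex_of_real (V \<theta>)) \<le> 2 * B"
        using B(2)[of \<eta>] B(2)[of \<theta>] unfolding of_real_diff[symmetric] norm_of_real by linarith
      then show "trunc_log 1 (complex_of_real (V \<eta>)) \<theta> \<le> ln (max 1 (2 * B))"
        unfolding trunc_log_def by (intro ln_mono) (auto simp: less_max_iff_disj le_max_iff_disj)
    qed simp
    then show ?thesis using G_le_trunc[of 1 "complex_of_real (V \<eta>)"] by simp
  qed
  then show ?thesis by (intro bdd_aboveI[of _ "ln (max 1 (2 * B))"]) auto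
qed

lemma G_bounded_below_on_range: "bdd_below (G ` R)"
proof -
  obtain C where "\<And>z. - C \<le> G z" using that by (rule G_bounded_below)
  then show ?thesis by (intro bdd_belowI[of _ "- C"]) auto
qed

text \<open>\<open>G\<close> is an infimum of the continuous means of truncated logarithms, so it is upper semicontinuous,
and the range is compact.\<close>

lemma G_attains_sup_on_range:
  obtains z where "z \<in> R" "(SUP z\<in>R. G z) \<le> G z"
proof -
  let ?S = "SUP z\<in>R. G z"
  have "\<exists>z\<in>R. ?S - 1 / real (Suc n) < G z" for n
  proof -
    have "?S - 1 / real (Suc n) < ?S" by simp
    then show ?thesis using less_cSUP_iff[OF _ G_bounded_above_on_range] by auto
  qed
  then obtain \<zeta> where \<zeta>: "\<And>n. \<zeta> n \<in> R" "\<And>n. ?S - 1 / real (Suc n) < G (\<zeta> n)" by metis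
  have "compact R"
    by (rule compact_continuous_image[OF _ torus_cont_compact_range[OF cont]]) (intro continuous_intros)
  then obtain z \<rho> where z: "z \<in> R" "strict_mono \<rho>" "(\<zeta> \<circ> \<rho>) \<longlonglongrightarrow> z"
    using \<zeta>(1) unfolding compact_def by metis
  have "?S \<le> torus_mean (trunc_log \<tau> z)" if \<tau>: "\<tau> > 0" for \<tau>
  proof (rule LIMSEQ_le)
    show "(\<lambda>n. ?S - 1 / real (Suc (\<rho> n))) \<longlonglongrightarrow> ?S"
      using tendsto_diff[OF tendsto_const[of ?S] LIMSEQ_subseq_LIMSEQ[OF LIMSEQ_inverse_real_of_nat z(2)]]
      by (simp add: inverse_eq_divide comp_def)
    show "(\<lambda>n. torus_mean (trunc_log \<tau> z) + cmod ((\<zeta> \<circ> \<rho>) n - z) / \<tau>) \<longlonglongrightarrow> torus_mean (trunc_log \<tau> z)"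
    proof -
      have "(\<lambda>n. cmod ((\<zeta> \<circ> \<rho>) n - z)) \<longlonglongrightarrow> 0" by (intro tendsto_norm_zero LIM_zero z(3))
      from tendsto_add[OF tendsto_const tendsto_divide[OF this tendsto_const[of \<tau>]]] show ?thesis
        using \<tau> by simp
    qed
    show "\<exists>N. \<forall>n\<ge>N. ?S - 1 / real (Suc (\<rho> n)) \<le> torus_mean (trunc_log \<tau> z) + cmod ((\<zeta> \<circ> \<rho>) n - z) / \<tau>"
    proof (intro exI allI impI)
      fix n
      show "?S - 1 / real (Suc (\<rho> n)) \<le> torus_mean (trunc_log \<tau> z) + cmod ((\<zeta> \<circ> \<rho>) n - z) / \<tau>"
        using \<zeta>(2)[of "\<rho> n"] G_le_trunc[OF \<tau>, of "\<zeta> (\<rho> n)"] trunc_log_mean_lipschitz[OF \<tau>, of "\<zeta> (\<rho> n)" z] by simp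
    qed
  qed
  then have "?S \<le> G z" by (intro LIMSEQ_le_const[OF trunc_log_mean_tendsto]) auto
  then show ?thesis by (rule that[OF z(1)])
qed

section \<open>The three regimes\<close>

lemma range_comp: "range (complex_of_real \<circ> V) = R"
  by auto

lemma lambda_0_le: "z \<in> R \<Longrightarrow> lambda_0 (complex_of_real \<circ> V) \<le> exp (G z)"
  unfolding lambda_0_def range_comp exp_le_cancel_iff by (rule cINF_lower[OF G_bounded_below_on_range])

lemma lambda_1_ge: "z \<in> R \<Longrightarrow> exp (G z) \<le> lambda_1 (complex_of_real \<circ> V)"
  unfolding lambda_1_def range_comp exp_le_cancel_iff by (rule cSUP_upper[OF _ G_bounded_above_on_range])

lemma lambda_0_less_obtain:
  assumes "lambda_0 (complex_of_real \<circ> V) < r"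
  obtains x where "x \<in> range V" "G (complex_of_real x) < ln r"
proof -
  have "r > 0" using assms by (metis exp_gt_zero lambda_0_def less_trans)
  then have "(INF z\<in>R. G z) < ln r"
    using assms unfolding lambda_0_def range_comp by (metis exp_less_cancel_iff exp_ln)
  then obtain z where "z \<in> R" "G z < ln r" using cInf_lessD[of "G ` R" "ln r"] by auto
  then show ?thesis using that by auto
qed

abbreviation spectrum :: "complex \<Rightarrow> real \<Rightarrow> complex set" where
  "spectrum lam \<omega> \<equiv> ell2_spectrum (H_op (complex_of_real \<circ> V) \<alpha> lam \<omega>)"

lemma spectrum_subcritical:
  assumes "cmod lam \<le> lambda_0 (complex_of_real \<circ> V)"
  shows "spectrum lam \<omega> = R"
proof (rule set_eqI)
  fix z
  show "z \<in> spectrum lam \<omega> \<longleftrightarrow> z \<in> R"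
  proof (cases "z \<in> R")
    case True
    then show ?thesis using lambda_0_le[OF True] assms by (auto simp: mem_spectrum_iff)
  next
    case False
    obtain x where x: "x \<in> range V" "G (complex_of_real x) < G z" by (rule G_off_range_greater[OF False])
    have "lambda_0 (complex_of_real \<circ> V) \<le> exp (G (complex_of_real x))" using x(1) by (intro lambda_0_le) auto
    then have "cmod lam < exp (G z)" using assms x(2) by (meson exp_less_mono le_less_trans order_trans)
    then show ?thesis using False by (simp add: mem_spectrum_iff)
  qed
qed

lemma spectrum_supercritical_nonreal:
  assumes "lambda_0 (complex_of_real \<circ> V) < cmod lam"
  obtains z where "z \<in> spectrum lam \<omega>" "z \<notin> \<real>"
proof -
  have pos: "cmod lam > 0" using assms by (metis exp_gt_zero lambda_0_def less_trans)
  obtain x where x: "x \<in> range V" "G (complex_of_real x) < ln (cmod lam)" by (rule lambda_0_less_obtain[OF assms])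
  obtain y where y: "y > 0" "Complex x y \<notin> R" "G (Complex x y) = ln (cmod lam)"
    by (rule vertical_level_point[OF x])
  have "Complex x y \<in> spectrum lam \<omega>" using y pos by (simp add: mem_spectrum_iff)
  moreover have "Complex x y \<notin> \<real>" using y(1) by (simp add: complex_is_Real_iff)
  ultimately show ?thesis by (rule that)
qed

lemma spectrum_real_point:
  assumes "cmod lam \<le> lambda_1 (complex_of_real \<circ> V)"
  obtains z where "z \<in> spectrum lam \<omega>" "z \<in> \<real>"
proof -
  obtain z where z: "z \<in> R" "(SUP z\<in>R. G z) \<le> G z" by (rule G_attains_sup_on_range)
  have "cmod lam \<le> exp (SUP z\<in>R. G z)" using assms unfolding lambda_1_def range_comp .
  also have "\<dots> \<le> exp (G z)" using z(2) by simp
  finally have "z \<in> spectrum lam \<omega>" using z(1) by (simp add: mem_spectrum_iff)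
  then show ?thesis using that z(1) by auto
qed

lemma spectrum_curve:
  assumes "lambda_1 (complex_of_real \<circ> V) < cmod lam"
  shows "real_analytic_curve (spectrum lam \<omega>)"
proof -
  have "cmod lam > 0" using assms by (metis exp_gt_zero lambda_1_def less_trans)
  have S: "z \<in> spectrum lam \<omega> \<longleftrightarrow> z \<notin> R \<and> G z = ln (cmod lam)" for z
  proof (cases "z \<in> R")
    case True
    then show ?thesis using lambda_1_ge[OF True] assms by (simp add: mem_spectrum_iff)
  next
    case False
    then show ?thesis using \<open>cmod lam > 0\<close> by (auto simp: mem_spectrum_iff)
  qed
  show ?thesis
  proof (rule level_set_real_analytic_curve)
    have x: "V 0 \<in> range V" by simp
    have "exp (G (complex_of_real (V 0))) < cmod lam"
      using lambda_1_ge[of "complex_of_real (V 0)"] assms by auto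
    then have "G (complex_of_real (V 0)) < ln (cmod lam)"
      using \<open>cmod lam > 0\<close> by (metis exp_less_cancel_iff exp_ln)
    then obtain y where "Complex (V 0) y \<notin> R" "G (Complex (V 0) y) = ln (cmod lam)"
      by (rule vertical_level_point[OF x])
    then show "spectrum lam \<omega> \<noteq> {}" using S by blast
    fix p assume "p \<in> spectrum lam \<omega>"
    then have p: "p \<notin> R" "G p = ln (cmod lam)" using S by auto
    obtain r g where r: "r > 0" "g holomorphic_on ball p r" "deriv g p \<noteq> 0"
      "\<And>z. z \<in> ball p r \<Longrightarrow> z \<notin> R \<and> G z = G p + Re (g z)"
      using that by (rule G_locally_harmonic[OF p(1)])
    have "\<forall>z\<in>ball p r. z \<in> spectrum lam \<omega> \<longleftrightarrow> Re (g z) = 0"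
      using r(4) p(2) by (simp add: S)
    then show "\<exists>r>0. \<exists>g. g holomorphic_on ball p r \<and> deriv g p \<noteq> 0 \<and> (\<forall>z\<in>ball p r. z \<in> spectrum lam \<omega> \<longleftrightarrow> Re (g z) = 0)"
      using r(1-3) by blast
  qed
qed

lemma pt_symmetric_real:
  assumes "lam \<in> \<real>"
  shows "pt_symmetric (complex_of_real \<circ> V) lam 0"
proof -
  have "fourier_coeff (complex_of_real \<circ> V) k = cnj (fourier_coeff (complex_of_real \<circ> V) (- k))" for k
    unfolding fourier_coeff_eq torus_mean_def Bochner_Integration.integral_cnj[symmetric]
    by (simp add: character_minus)
  then show ?thesis using assms Ints_0 unfolding pt_symmetric_def by blast
qed

lemma pt_symmetry_broken: "pt_symmetric_breaking (complex_of_real \<circ> V) \<alpha>"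
proof -
  define r where "r = lambda_0 (complex_of_real \<circ> V) + 1"
  have r: "r > 0" by (simp add: r_def lambda_0_def add_pos_pos)
  obtain z where "z \<in> spectrum (complex_of_real (cmod (complex_of_real r))) 0" "z \<notin> \<real>"
    by (rule spectrum_supercritical_nonreal[of "complex_of_real (cmod (complex_of_real r))" 0])
       (use r in \<open>simp_all add: r_def\<close>)
  then show ?thesis
    unfolding pt_symmetric_breaking_def
    by (intro exI[of _ "complex_of_real r"] conjI pt_symmetric_real) auto
qed

end

theorem corollary1p3:
  fixes \<alpha> :: "real ^ 'd" and \<omega> :: real and lam :: complex and V :: "real ^ 'd \<Rightarrow> real"
  assumes "rationally_independent \<alpha>"
    and "torus_periodic V"
    and "real_analytic_on V UNIV"
    and "\<not> V constant_on UNIV"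
  shows "pt_symmetric_family (complex_of_real \<circ> V)
    \<and> pt_symmetric_breaking (complex_of_real \<circ> V) \<alpha>
    \<and> (cmod lam \<le> lambda_0 (complex_of_real \<circ> V) \<longrightarrow>
         ell2_spectrum (H_op (complex_of_real \<circ> V) \<alpha> lam \<omega>)
           = complex_of_real ` {(INF \<theta>. V \<theta>)..(SUP \<theta>. V \<theta>)}
         \<and> ell2_spectrum (H_op (complex_of_real \<circ> V) \<alpha> lam \<omega>) \<subseteq> \<real>)
    \<and> (lambda_0 (complex_of_real \<circ> V) < cmod lam \<and> cmod lam \<le> lambda_1 (complex_of_real \<circ> V) \<longrightarrow>
         ell2_spectrum (H_op (complex_of_real \<circ> V) \<alpha> lam \<omega>) \<inter> (- \<real>) \<noteq> {}
         \<and> ell2_spectrum (H_op (complex_of_real \<circ> V) \<alpha> lam \<omega>) \<inter> \<real> \<noteq> {})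
    \<and> (lambda_1 (complex_of_real \<circ> V) < cmod lam \<longrightarrow>
         real_analytic_curve (ell2_spectrum (H_op (complex_of_real \<circ> V) \<alpha> lam \<omega>)))"
proof -
  interpret analytic_potential V \<alpha> by unfold_locales fact+
  obtain m M where mM: "m \<le> M" "range V = {m..M}" by (rule range_interval)
  have R: "R = complex_of_real ` {(INF \<theta>. V \<theta>)..(SUP \<theta>. V \<theta>)}"
    unfolding mM(2) using mM(1) by simp
  have 1: "spectrum lam \<omega> = complex_of_real ` {(INF \<theta>. V \<theta>)..(SUP \<theta>. V \<theta>)} \<and> spectrum lam \<omega> \<subseteq> \<real>"
    if "cmod lam \<le> lambda_0 (complex_of_real \<circ> V)"
    using spectrum_subcritical[OF that, of \<omega>] R by auto
  have 2: "spectrum lam \<omega> \<inter> (- \<real>) \<noteq> {} \<and> spectrum lam \<omega> \<inter> \<real> \<noteq> {}"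
    if "lambda_0 (complex_of_real \<circ> V) < cmod lam" "cmod lam \<le> lambda_1 (complex_of_real \<circ> V)"
    using spectrum_supercritical_nonreal[OF that(1), of \<omega>] spectrum_real_point[OF that(2), of \<omega>]
    by (metis ComplI IntI empty_iff)
  have "pt_symmetric_family (complex_of_real \<circ> V)"
    unfolding pt_symmetric_family_def by (intro allI pt_symmetric_real Reals_of_real)
  then show ?thesis
    using pt_symmetry_broken 1 2 spectrum_curve by blast
qed

end
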